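(* For every integer $n\ge 1$, the Rochberg space $\mathfrak R^{(n)}$ (obtained at $\theta=1/2$ from complex interpolation of the couple $(\ell_\infty,\ell_1)$) is symplectic, i.e. there exists a symplectic form on $\mathfrak R^{(n)}$.
   Context: A symplectic form on a real Banach space $X$ is a bilinear map $\omega:X\times X\to\mathbb R$ such that (1) $\omega$ is continuous: $|\omega(x,y)|\le K\|x\|\|y\|$ for some $K>0$; (2) $\omega$ is alternating: $\omega(x,y)=-\omega(y,x)$; (3) the induced map $L_\omega:X\to X^*$, $L_\omega(x)(y)=\omega(x,y)$, is an isomorphism of $X$ onto $X^*$. $X$ is called symplectic if it admits a symplectic form. Rochberg spaces: let $\mathbb S=\{z\in\mathbb C:0\le \mathrm{Re}\, z\le 1\}$ and let $\mathcal C$ be the Calderón space of the couple $(\ell_\infty,\ell_1)$, i.e. the Banach space of all bounded continuous functions $f:\mathbb S\to\ell_\infty$ (complex sequences; note $\ell_\infty+\ell_1=\ell_\infty$) that are analytic in the interior of $\mathbb S$ and such that $t\mapsto f(it)\in\ell_\infty$ and $t\mapsto f(1+it)\in\ell_1$ are bounded and continuous, with norm $\|f\|_{\mathcal C}=\max\{\sup_t\|f(it)\|_{\infty},\sup_t\|f(1+it)\|_{1}\}$. For $n\ge1$, $$\mathfrak R^{(n)}=\{(x_{n-1},\dots,x_1,x_0)\in\ell_\infty^n:\ x_i=f^{(i)}(1/2)/i!\ \text{for some } f\in\mathcal C \text{ and all } 0\le i\le n-1\},$$ with the quotient norm $\|x\|=\inf\{\|f\|_{\mathcal C}: f^{(i)}(1/2)/i!=x_i,\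 0\le i\le n-1\}$. As a real Banach space, $\mathfrak R^{(n)}$ denotes the subspace of those tuples all of whose entries are real sequences. One has $\mathfrak R^{(1)}=\ell_2$ and $\mathfrak R^{(2)}=Z_2$ (the Kalton–Peck space), up to equivalence of norms. *)

theory Defs
  imports "HOL-Analysis.Analysis" "HOL-Library.Function_Algebras"
begin

section \<open>Symplectic forms on Banach spaces with an explicit carrier\<close>

text \<open>
  The Rochberg spaces form a family of Banach spaces indexed by a natural number, so a Banach space
  is rendered as a linear subspace \<open>V\<close> of an ambient real vector space together with a norm \<open>N\<close>
  on \<open>V\<close>. The values of \<open>N\<close> outside \<open>V\<close> are irrelevant, and so are any norm or topology of the
  ambient type.
\<close>

definition real_banach_on :: "'a::real_vector set \<Rightarrow> ('a \<Rightarrow> real) \<Rightarrow> bool" where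
  "real_banach_on V N \<longleftrightarrow>
     subspace V \<and>
     (\<forall>x\<in>V. 0 \<le> N x) \<and>
     (\<forall>x\<in>V. N x = 0 \<longleftrightarrow> x = 0) \<and>
     (\<forall>x\<in>V. \<forall>y\<in>V. N (x + y) \<le> N x + N y) \<and>
     (\<forall>r. \<forall>x\<in>V. N (r *\<^sub>R x) = \<bar>r\<bar> * N x) \<and>
     (\<forall>X. (\<forall>m::nat. X m \<in> V) \<and> (\<forall>e>0. \<exists>M. \<forall>m\<ge>M. \<forall>k\<ge>M. N (X m - X k) < e) \<longrightarrow>
        (\<exists>x\<in>V. (\<lambda>m. N (X m - x)) \<longlonglongrightarrow> 0))"

definition linear_functional_on :: "'a::real_vector set \<Rightarrow> ('a \<Rightarrow> real) \<Rightarrow> bool" where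
  "linear_functional_on V \<phi> \<longleftrightarrow>
     (\<forall>x\<in>V. \<forall>y\<in>V. \<phi> (x + y) = \<phi> x + \<phi> y) \<and>
     (\<forall>r. \<forall>x\<in>V. \<phi> (r *\<^sub>R x) = r * \<phi> x)"

text \<open>Functionals on \<open>V\<close> are extensional, so that equality in the dual is equality on \<open>V\<close>.\<close>

definition dual_on :: "'a::real_vector set \<Rightarrow> ('a \<Rightarrow> real) \<Rightarrow> ('a \<Rightarrow> real) set" where
  "dual_on V N =
     {\<phi> \<in> extensional V. linear_functional_on V \<phi> \<and> (\<exists>K. \<forall>x\<in>V. \<bar>\<phi> x\<bar> \<le> K * N x)}"

definition dual_norm :: "'a::real_vector set \<Rightarrow> ('a \<Rightarrow> real) \<Rightarrow> ('a \<Rightarrow> real) \<Rightarrow> real" where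
  "dual_norm V N \<phi> = (SUP x\<in>{x\<in>V. N x \<le> 1}. \<bar>\<phi> x\<bar>)"

text \<open>
  Linearity of \<open>x \<mapsto> restrict (\<omega> x) V\<close> is part of bilinearity; the last two conjuncts state that this
  map is a bijection onto the dual which is bounded and has a bounded inverse.
\<close>

definition symplectic_form ::
  "'a::real_vector set \<Rightarrow> ('a \<Rightarrow> real) \<Rightarrow> ('a \<Rightarrow> 'a \<Rightarrow> real) \<Rightarrow> bool" where
  "symplectic_form V N \<omega> \<longleftrightarrow>
     (\<forall>x\<in>V. linear_functional_on V (\<lambda>y. \<omega> x y)) \<and>
     (\<forall>y\<in>V. linear_functional_on V (\<lambda>x. \<omega> x y)) \<and>
     (\<exists>K>0. \<forall>x\<in>V. \<forall>y\<in>V. \<bar>\<omega> x y\<bar> \<le> K * N x * N y) \<and>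
     (\<forall>x\<in>V. \<forall>y\<in>V. \<omega> x y = - \<omega> y x) \<and>
     bij_betw (\<lambda>x. restrict (\<omega> x) V) V (dual_on V N) \<and>
     (\<exists>c>0. \<exists>C>0. \<forall>x\<in>V. c * N x \<le> dual_norm V N (restrict (\<omega> x) V) \<and>
                        dual_norm V N (restrict (\<omega> x) V) \<le> C * N x)"

definition symplectic_space :: "'a::real_vector set \<Rightarrow> ('a \<Rightarrow> real) \<Rightarrow> bool" where
  "symplectic_space V N \<longleftrightarrow> real_banach_on V N \<and> (\<exists>\<omega>. symplectic_form V N \<omega>)"


section \<open>Complex sequence spaces and complex derivatives\<close>

text \<open>
  As \<open>nat\<close> carries the discrete topology, the bounded continuous functions on it are all bounded
  complex sequences, with the supremum norm.
\<close>

type_synonym linf = "nat \<Rightarrow>\<^sub>C complex"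

definition scaleC_linf :: "complex \<Rightarrow> linf \<Rightarrow> linf" where
  "scaleC_linf c x = Bcontfun (\<lambda>k. c * apply_bcontfun x k)"

lemma apply_scaleC_linf: "apply_bcontfun (scaleC_linf c x) k = c * apply_bcontfun x k"
proof -
  have "bounded ((\<lambda>y. c * y) ` range (apply_bcontfun x))"
    by (intro bounded_linear_image bounded_linear_mult_right bounded_apply_bcontfun)
  then have "(\<lambda>k. c * apply_bcontfun x k) \<in> bcontfun"
    by (simp add: bcontfun_def image_image)
  then show ?thesis
    by (simp add: scaleC_linf_def Bcontfun_inverse)
qed

definition in_l1 :: "linf \<Rightarrow> bool" where
  "in_l1 x \<longleftrightarrow> summable (\<lambda>k. norm (apply_bcontfun x k))"

definition l1_norm :: "linf \<Rightarrow> real" where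
  "l1_norm x = (\<Sum>k. norm (apply_bcontfun x k))"

text \<open>Complex (Frechet) differentiability with respect to the supremum norm.\<close>

definition has_complex_deriv :: "(complex \<Rightarrow> linf) \<Rightarrow> linf \<Rightarrow> complex \<Rightarrow> bool" where
  "has_complex_deriv f D z \<longleftrightarrow> (f has_derivative (\<lambda>h. scaleC_linf h D)) (at z)"

definition complex_deriv :: "(complex \<Rightarrow> linf) \<Rightarrow> complex \<Rightarrow> linf" where
  "complex_deriv f z = (THE D. has_complex_deriv f D z)"

lemma complex_deriv_eq:
  assumes "has_complex_deriv f D z"
  shows "complex_deriv f z = D"
  unfolding complex_deriv_def
proof (rule the_equality)
  fix E assume "has_complex_deriv f E z"
  then have "scaleC_linf 1 E = scaleC_linf 1 D"
    using assms has_derivative_unique unfolding has_complex_deriv_def by metis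
  then show "E = D"
    by (metis apply_scaleC_linf bcontfun_eqI mult_1)
qed (fact assms)


section \<open>The Calderon space of the couple of bounded and summable sequences\<close>

definition strip :: "complex set" where
  "strip = {z. 0 \<le> Re z \<and> Re z \<le> 1}"

text \<open>
  The values of \<open>f\<close> outside the strip are unconstrained; nothing below depends on them.
\<close>

definition calderon_space :: "(complex \<Rightarrow> linf) set" where
  "calderon_space = {f.
     continuous_on strip f \<and> bounded (f ` strip) \<and>
     (\<forall>z\<in>interior strip. \<exists>D. has_complex_deriv f D z) \<and>
     continuous_on UNIV (\<lambda>t::real. f (\<i> * of_real t)) \<and>
     bounded (range (\<lambda>t::real. f (\<i> * of_real t))) \<and>
     (\<forall>t::real. in_l1 (f (1 + \<i> * of_real t))) \<and>
     (\<forall>t::real. ((\<lambda>s::real. l1_norm (f (1 + \<i> * of_real s) - f (1 + \<i> * of_real t)))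
        \<longlongrightarrow> 0) (at t)) \<and>
     bounded (range (\<lambda>t::real. l1_norm (f (1 + \<i> * of_real t))))}"

definition calderon_norm :: "(complex \<Rightarrow> linf) \<Rightarrow> real" where
  "calderon_norm f =
     max (SUP t::real. norm (f (\<i> * of_real t))) (SUP t::real. l1_norm (f (1 + \<i> * of_real t)))"


section \<open>Rochberg spaces\<close>

instantiation "fun" :: (type, real_vector) real_vector
begin

definition scaleR_fun :: "real \<Rightarrow> ('a \<Rightarrow> 'b) \<Rightarrow> 'a \<Rightarrow> 'b" where
  "scaleR_fun r f = (\<lambda>x. r *\<^sub>R f x)"

instance
  by standard (auto simp: scaleR_fun_def plus_fun_def scaleR_add_right scaleR_add_left)

end

text \<open>
  An \<open>n\<close>-tuple \<open>(x\<^sub>n\<^sub>-\<^sub>1, \<dots>, x\<^sub>1, x\<^sub>0)\<close> is a function on the indices that vanishes from \<open>n\<close> on.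
\<close>

definition tuples :: "nat \<Rightarrow> (nat \<Rightarrow> linf) set" where
  "tuples n = {x. \<forall>i\<ge>n. x i = 0}"

definition taylor_coeff :: "nat \<Rightarrow> (complex \<Rightarrow> linf) \<Rightarrow> linf" where
  "taylor_coeff i f = (1 / fact i) *\<^sub>R (complex_deriv ^^ i) f (1/2)"

definition complex_rochberg :: "nat \<Rightarrow> (nat \<Rightarrow> linf) set" where
  "complex_rochberg n = {x \<in> tuples n. \<exists>f\<in>calderon_space. \<forall>i<n. taylor_coeff i f = x i}"

definition rochberg_norm :: "nat \<Rightarrow> (nat \<Rightarrow> linf) \<Rightarrow> real" where
  "rochberg_norm n x =
     (INF f\<in>{f\<in>calderon_space. \<forall>i<n. taylor_coeff i f = x i}. calderon_norm f)"

text \<open>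
  The norm on the real space is the restriction of the complex quotient norm: the infimum still
  ranges over all functions of the Calderon space, not only those with real derivatives.
\<close>

definition rochberg :: "nat \<Rightarrow> (nat \<Rightarrow> linf) set" where
  "rochberg n = {x \<in> complex_rochberg n. \<forall>i k. apply_bcontfun (x i) k \<in> \<real>}"

end

theory Submission
  imports Defs "HOL-Complex_Analysis.Complex_Analysis"
begin

text \<open>
  For lifts \<open>f\<close> and \<open>g\<close> of \<open>x\<close> and \<open>y\<close> the function \<open>\<Sum>k. f\<^sub>k(z) g\<^sub>k(1 - z)\<close> is bounded on the edges of the
  strip, where one factor is bounded and the other one summable. Hence its Taylor coefficient of order
  \<open>n - 1\<close> at \<open>1/2\<close> is a continuous bilinear pairing
  \<open>\<langle>x, y\<rangle> = \<Sum>k. \<Sum>i<n. (-1)\<^bsup>n-1-i\<^esup> x\<^sub>i(k) y\<^sub>n\<^sub>-\<^sub>1\<^sub>-\<^sub>i(k)\<close>. Shifting tuples and evaluating \<open>x\<^sub>0\<close> give an exact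
  sequence that relates the spaces of order \<open>n\<close> and \<open>n + 1\<close> and \<open>\<ell>\<^sub>2\<close>, so induction on \<open>n\<close> shows that the pairing
  identifies each Rochberg space with its dual; completeness follows from this duality. The pairing is
  alternating for even \<open>n\<close> and symmetric for odd \<open>n\<close>, where it is composed with an isometry of square \<open>-1\<close>
  that permutes the coordinates up to signs.
\<close>


section \<open>Bounded holomorphic functions on the strip\<close>

text \<open>The reflection \<open>1 - z\<close> exchanges the two edges of the strip and fixes 1/2,
  so \<open>g(1 - z)\<close> belongs to the couple in reversed order, which is dual to the original
  one coordinate by coordinate. The quotient norm has no explicit formula: every bounded map on
  tuples has to come from an operation on lifts that stays inside the Calderon space, and every
  lower bound for the norm comes from the maximum principle on the strip. The exact sequence is
  \<open>0 -> R(n) -> R(n+1) -> l2 -> 0\<close>. Under the pairings the adjoint of the shift is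
  truncation, and the adjoint of \<open>x -> x 0\<close> is, up to sign, the embedding of
  \<open>l2\<close> into the top entry. The dual sequence thus has the same terms in reversed order,
  and the induction step is a five lemma argument with explicit constants. For odd \<open>n\<close>
  the situation is that of \<open>l2\<close>: a symmetric duality becomes symplectic after twisting
  by a skew-adjoint complex structure. Coordinate permutations with signs are isometries of both end
  spaces of the couple, so one such structure acts on the Rochberg spaces of all orders.\<close>

lemma interior_strip: "interior strip = {z. 0 < Re z \<and> Re z < 1}"
proof -
  have "strip = {z. 1 \<bullet> z \<ge> 0} \<inter> {z. (1::complex) \<bullet> z \<le> 1}"
    by (auto simp: strip_def)
  then have "interior strip = interior {z. 1 \<bullet> z \<ge> 0} \<inter> interior {z. (1::complex) \<bullet> z \<le> 1}"
    by (metis interior_Int)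
  also have "\<dots> = {z. 1 \<bullet> z > 0} \<inter> {z. (1::complex) \<bullet> z < 1}"
    by (simp only: interior_halfspace_ge[OF one_neq_zero] interior_halfspace_le[OF one_neq_zero])
  finally show ?thesis
    by auto
qed

text \<open>Maximum principle of Phragmen-Lindelof type. A Gaussian factor
  \<open>exp (\<epsilon> * (w^2 - 1))\<close> makes \<open>H\<close> small far out, the maximum
  principle on a large rectangle then applies, and \<epsilon> tends to 0.\<close>

lemma strip_bounded_by_boundary:
  assumes cont: "continuous_on strip H" and holo: "H holomorphic_on interior strip"
    and bdd: "\<And>z. z \<in> strip \<Longrightarrow> cmod (H z) \<le> M"
    and bnd: "\<And>z. Re z = 0 \<or> Re z = 1 \<Longrightarrow> cmod (H z) \<le> A"
    and z: "z \<in> strip"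
  shows "cmod (H z) \<le> A"
proof -
  have A0: "A \<ge> 0"
    using bnd[of 0] norm_ge_zero[of "H 0"] by (simp del: norm_ge_zero)
  have M0: "M \<ge> 0"
    using bdd[OF z] norm_ge_zero[of "H z"] by linarith
  have key: "cmod (H z) * exp (\<epsilon> * ((Re z)\<^sup>2 - (Im z)\<^sup>2 - 1)) \<le> A + \<epsilon>" if e: "\<epsilon> > 0" for \<epsilon>
  proof -
    \<comment> \<open>The \<open>- 1\<close> keeps the modulus of the factor at most 1 on the strip,
      where the square of the real part is at most 1. The vertical sides therefore give the bound
      \<open>A\<close>, and the horizontal ones give \<epsilon> by the choice of
      \<open>R\<close>.\<close>
    define G where "G w = H w * exp (of_real \<epsilon> * (w\<^sup>2 - 1))" for w
    have normG: "cmod (G w) = cmod (H w) * exp (\<epsilon> * ((Re w)\<^sup>2 - (Im w)\<^sup>2 - 1))" for w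
      by (simp add: G_def norm_mult power2_eq_square)
    have "((\<lambda>R. M * exp (- (\<epsilon> * R\<^sup>2))) \<longlongrightarrow> 0) at_top"
      using e by real_asymp
    then have "\<forall>\<^sub>F R in at_top. M * exp (- (\<epsilon> * R\<^sup>2)) < \<epsilon>"
      using e by (auto dest: order_tendstoD)
    moreover have "\<forall>\<^sub>F R in at_top. R \<ge> \<bar>Im z\<bar> + 1"
      by (rule eventually_ge_at_top)
    ultimately obtain R where R: "M * exp (- (\<epsilon> * R\<^sup>2)) < \<epsilon>" "R \<ge> \<bar>Im z\<bar> + 1"
      using eventually_happens[OF eventually_conj] by (metis (mono_tags, lifting) trivial_limit_at_top_linorder)
    define S where "S = cbox (Complex 0 (-R)) (Complex 1 R)"
    have Ss: "S \<subseteq> strip" and Si: "interior S \<subseteq> interior strip"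
      by (auto simp: S_def interior_strip, auto simp: strip_def in_cbox_complex_iff in_box_complex_iff)
    have "cmod (G z) \<le> A + \<epsilon>"
    proof (rule maximum_modulus_frontier[of G S])
      show "G holomorphic_on interior S"
        unfolding G_def using holo Si by (auto intro!: holomorphic_intros intro: holomorphic_on_subset)
      show "continuous_on (closure S) G"
        unfolding G_def using cont Ss
        by (auto simp: S_def intro!: continuous_intros intro: continuous_on_subset)
      show "bounded S"
        by (simp add: S_def)
      show "z \<in> S"
        using z R(2) by (auto simp: S_def strip_def in_cbox_complex_iff)
      fix w assume "w \<in> frontier S"
      then have wS: "w \<in> S" and "w \<notin> box (Complex 0 (-R)) (Complex 1 R)"
        by (auto simp: S_def frontier_cbox)
      then have ws: "0 \<le> Re w" "Re w \<le> 1" and w: "(Re w = 0 \<or> Re w = 1) \<or> \<bar>Im w\<bar> = R"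
        by (auto simp: S_def in_cbox_complex_iff in_box_complex_iff)
      have re1: "(Re w)\<^sup>2 \<le> 1"
        using ws by (simp add: power_le_one)
      from w show "cmod (G w) \<le> A + \<epsilon>"
      proof
        assume "Re w = 0 \<or> Re w = 1"
        then have "cmod (H w) \<le> A" by (rule bnd)
        moreover have "exp (\<epsilon> * ((Re w)\<^sup>2 - (Im w)\<^sup>2 - 1)) \<le> 1"
          using e re1 by (auto simp: mult_le_0_iff) (smt (verit) zero_le_power2)
        ultimately have "cmod (G w) \<le> A * 1"
          unfolding normG using A0 by (intro mult_mono) auto
        then show ?thesis using e by simp
      next
        assume "\<bar>Im w\<bar> = R"
        then have "(Im w)\<^sup>2 = R\<^sup>2" by (metis power2_abs)
        then have "\<epsilon> * ((Re w)\<^sup>2 - (Im w)\<^sup>2 - 1) \<le> - (\<epsilon> * R\<^sup>2)"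
          using e re1 by (simp add: algebra_simps)
        then have "cmod (G w) \<le> M * exp (- (\<epsilon> * R\<^sup>2))"
          unfolding normG using M0 bdd[of w] wS Ss by (intro mult_mono) auto
        then show ?thesis using R A0 by linarith
      qed
    qed
    then show ?thesis by (simp add: normG)
  qed
  have "((\<lambda>\<epsilon>. cmod (H z) * exp (\<epsilon> * ((Re z)\<^sup>2 - (Im z)\<^sup>2 - 1))) \<longlongrightarrow>
      cmod (H z) * exp (0 * ((Re z)\<^sup>2 - (Im z)\<^sup>2 - 1))) (at_right 0)"
    by (intro tendsto_intros)
  moreover have "((\<lambda>\<epsilon>. A + \<epsilon>) \<longlongrightarrow> A + 0) (at_right 0)"
    by (intro tendsto_intros)
  ultimately have "cmod (H z) * exp (0 * ((Re z)\<^sup>2 - (Im z)\<^sup>2 - 1)) \<le> A + 0"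
    using key by (intro tendsto_le[of "at_right 0"]) (auto simp: eventually_at_right_less intro!: eventually_at_rightI[of 0 1])
  then show ?thesis by simp
qed

section \<open>Scalar Taylor coefficients at 1/2\<close>

definition half_coeff :: "nat \<Rightarrow> (complex \<Rightarrow> complex) \<Rightarrow> complex" where
  "half_coeff i F = (deriv ^^ i) F (1/2) / fact i"

lemma half_in_strip: "1/2 \<in> interior strip"
  by (simp add: interior_strip)

lemma half_coeff_0 [simp]: "half_coeff 0 F = F (1/2)"
  by (simp add: half_coeff_def)

lemma half_coeff_add:
  "F holomorphic_on interior strip \<Longrightarrow> G holomorphic_on interior strip \<Longrightarrow>
    half_coeff i (\<lambda>z. F z + G z) = half_coeff i F + half_coeff i G"
  unfolding half_coeff_def by (simp add: higher_deriv_add[OF _ _ open_interior half_in_strip] add_divide_distrib)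

lemma half_coeff_cmult:
  "F holomorphic_on interior strip \<Longrightarrow> half_coeff i (\<lambda>z. c * F z) = c * half_coeff i F"
  unfolding half_coeff_def by (simp add: higher_deriv_cmult[OF _ half_in_strip open_interior])

lemma half_coeff_zero [simp]: "half_coeff i (\<lambda>z. 0) = 0"
  by (simp add: half_coeff_def)

lemma half_coeff_sum:
  assumes "finite K" "\<And>k. k \<in> K \<Longrightarrow> F k holomorphic_on interior strip"
  shows "half_coeff i (\<lambda>z. \<Sum>k\<in>K. F k z) = (\<Sum>k\<in>K. half_coeff i (F k))"
  using assms by (induction K rule: finite_induct) (auto simp: half_coeff_add holomorphic_on_sum)

lemma half_coeff_cong:
  assumes "F holomorphic_on interior strip" "\<And>z. z \<in> interior strip \<Longrightarrow> F z = G z"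
  shows "half_coeff i F = half_coeff i G"
proof -
  have "G holomorphic_on interior strip"
    using assms by (simp cong: holomorphic_cong)
  then show ?thesis
    unfolding half_coeff_def using higher_deriv_transform_within_open[OF assms(1) _ open_interior half_in_strip assms(2)]
    by simp
qed

lemma half_coeff_mult:
  assumes "F holomorphic_on interior strip" "G holomorphic_on interior strip"
  shows "half_coeff n (\<lambda>z. F z * G z) = (\<Sum>i\<le>n. half_coeff i F * half_coeff (n - i) G)"
proof -
  have "half_coeff n (\<lambda>z. F z * G z) = (\<Sum>i\<le>n. of_nat (n choose i) * (deriv ^^ i) F (1/2) * (deriv ^^ (n-i)) G (1/2) / fact n)"
    unfolding half_coeff_def
    by (simp add: higher_deriv_mult[OF assms open_interior half_in_strip] sum_divide_distrib atMost_atLeast0)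
  also have "\<dots> = (\<Sum>i\<le>n. half_coeff i F * half_coeff (n - i) G)"
    by (intro sum.cong refl) (simp add: half_coeff_def binomial_fact field_simps)
  finally show ?thesis .
qed

lemma half_coeff_shift:
  assumes "F holomorphic_on interior strip"
  shows "half_coeff (Suc n) (\<lambda>z. (z - 1/2) * F z) = half_coeff n F"
proof -
  have lin: "(deriv ^^ i) (\<lambda>z::complex. z - 1/2) (1/2) = (if i = 1 then 1 else 0)" for i
    using higher_deriv_diff[OF _ _ open_interior half_in_strip, of "\<lambda>w. w" "\<lambda>w. 1/2" i] by simp
  have "half_coeff (Suc n) (\<lambda>z. (z - 1/2) * F z) = (\<Sum>i\<le>Suc n. half_coeff i (\<lambda>z. z - 1/2) * half_coeff (Suc n - i) F)"
    by (intro half_coeff_mult holomorphic_intros assms)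
  also have "\<dots> = (\<Sum>i\<in>{1}. half_coeff i (\<lambda>z. z - 1/2) * half_coeff (Suc n - i) F)"
    by (intro sum.mono_neutral_right) (auto simp: half_coeff_def lin)
  finally show ?thesis by (simp add: half_coeff_def lin)
qed

lemma reflect_strip: "1 - z \<in> strip \<longleftrightarrow> z \<in> strip" "1 - z \<in> interior strip \<longleftrightarrow> z \<in> interior strip"
  by (auto simp: interior_strip) (auto simp: strip_def)

lemma holomorphic_reflect:
  "F holomorphic_on interior strip \<Longrightarrow> (\<lambda>z. F (1 - z)) holomorphic_on interior strip"
  by (rule holomorphic_on_compose_gen[of "\<lambda>z. 1 - z" _ F, unfolded o_def])
    (auto intro!: holomorphic_intros simp: reflect_strip)

text \<open>The reflection fixes 1/2 and each derivative contributes a factor -1. The signs in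
  \<open>pair_term\<close>, and with them the dependence on the parity of the order, originate
  here.\<close>

lemma half_coeff_reflect:
  assumes "F holomorphic_on interior strip"
  shows "half_coeff n (\<lambda>z. F (1 - z)) = (-1) ^ n * half_coeff n F"
  using higher_deriv_compose_linear'[OF assms open_interior open_interior half_in_strip, of "-1" 1 n]
  by (simp add: half_coeff_def interior_strip)

text \<open>Cauchy's inequality on the circle of radius 1/4, whose closed disc lies in the open
  strip. The powers of 4 in the later estimates come from this radius.\<close>

lemma half_coeff_bound:
  assumes holo: "F holomorphic_on interior strip"
    and bdd: "\<And>z. z \<in> interior strip \<Longrightarrow> cmod (F z) \<le> A"
  shows "cmod (half_coeff i F) \<le> A * 4 ^ i"
proof -
  have sub: "cball (1/2) (1/4) \<subseteq> interior strip"
  proof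
    fix z :: complex assume "z \<in> cball (1/2) (1/4)"
    then have "\<bar>Re (1/2 - z)\<bar> \<le> 1/4"
      using abs_Re_le_cmod[of "1/2 - z"] by (simp add: dist_norm)
    then have "\<bar>1/2 - Re z\<bar> \<le> 1/4" by simp
    then show "z \<in> interior strip" unfolding interior_strip mem_Collect_eq by linarith
  qed
  have "cmod ((deriv ^^ i) F (1/2)) \<le> fact i * A / (1/4) ^ i"
  proof (rule Cauchy_inequality)
    show "F holomorphic_on ball (1/2) (1/4)"
      using holo sub ball_subset_cball holomorphic_on_subset by blast
    show "continuous_on (cball (1/2) (1/4)) F"
      using holo sub holomorphic_on_imp_continuous_on continuous_on_subset by blast
    show "cmod (F x) \<le> A" if "cmod (1/2 - x) = 1/4" for x
      by (rule bdd, rule subsetD[OF sub]) (simp add: dist_norm that)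
  qed simp
  then show ?thesis
    by (simp add: half_coeff_def norm_divide field_simps power_divide)
qed


section \<open>Differentiability of sequence-valued functions\<close>

lemma apply_Bcontfun_nat:
  assumes "\<And>k. cmod (a k) \<le> b"
  shows "apply_bcontfun (Bcontfun a :: linf) k = a k"
proof -
  have "a \<in> bcontfun"
    by (rule bcontfun_normI[OF _ assms]) simp
  then show ?thesis by (simp add: Bcontfun_inverse)
qed

lemma bounded_linear_coordinate: "bounded_linear (\<lambda>x::linf. apply_bcontfun x k)"
  by (rule bounded_linear_intro[of _ 1]) (auto simp: norm_bounded)

lemma norm_scaleC_linf_le: "norm (scaleC_linf c x) \<le> cmod c * norm x"
  by (rule norm_bound) (simp add: apply_scaleC_linf norm_mult norm_bounded mult_left_mono)

lemma bounded_linear_scaleC_linf: "bounded_linear (\<lambda>h. scaleC_linf h D)"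
proof (rule bounded_linear_intro)
  show "norm (scaleC_linf x D) \<le> norm x * norm D" for x
    by (rule norm_scaleC_linf_le)
qed (auto intro!: bcontfun_eqI simp: apply_scaleC_linf algebra_simps)

lemma has_complex_deriv_coordinate:
  assumes "has_complex_deriv g D z"
  shows "((\<lambda>w. apply_bcontfun (g w) k) has_field_derivative apply_bcontfun D k) (at z)"
  using bounded_linear.has_derivative[OF bounded_linear_coordinate assms[unfolded has_complex_deriv_def], of k]
  by (simp add: has_field_derivative_def apply_scaleC_linf mult.commute[of "apply_bcontfun D k", abs_def] flip: fun_eq_iff)

text \<open>Taylor's formula, with the second derivative bounded by Cauchy's inequality on discs of
  radius \<open>r/4\<close> about points of the half-size ball:
  \<open>2! * M / (r/4)^2 = 32 * M / r^2\<close>. The bound depends on \<open>F\<close> only through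
  \<open>M\<close>, so it is the same for all coordinates of a bounded sequence-valued
  function.\<close>

lemma holomorphic_remainder_bound:
  assumes holo: "F holomorphic_on ball z r" and r: "r > 0"
    and bdd: "\<And>w. w \<in> ball z r \<Longrightarrow> cmod (F w) \<le> M"
    and w: "w \<in> ball z (r/2)"
  shows "cmod (F w - F z - deriv F z * (w - z)) \<le> 32 * M / r\<^sup>2 * (cmod (w - z))\<^sup>2"
proof -
  have sub: "ball z (r/2) \<subseteq> ball z r"
    using r by (intro subset_ball) auto
  have d: "((deriv ^^ i) F has_field_derivative (deriv ^^ Suc i) F x) (at x within ball z (r/2))"
    if "x \<in> ball z (r/2)" for i x
    using holomorphic_derivI[OF holomorphic_higher_deriv[OF holo open_ball, of i] open_ball, of x] sub that
    by (auto intro: has_field_derivative_at_within)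
  have b: "cmod ((deriv ^^ Suc 1) F x) \<le> 32 * M / r\<^sup>2" if x: "x \<in> ball z (r/2)" for x
  proof -
    have sub': "cball x (r/4) \<subseteq> ball z r"
    proof
      fix y assume "y \<in> cball x (r/4)"
      then have "dist z y \<le> dist z x + dist x y" "dist x y \<le> r/4" "dist z x < r/2"
        using x by (auto simp: dist_triangle)
      then show "y \<in> ball z r" using r by simp
    qed
    have "cmod ((deriv ^^ 2) F x) \<le> fact 2 * M / (r/4)^2"
    proof (rule Cauchy_inequality)
      show "F holomorphic_on ball x (r/4)"
        using holo sub' ball_subset_cball holomorphic_on_subset by blast
      show "continuous_on (cball x (r/4)) F"
        using holo sub' holomorphic_on_imp_continuous_on continuous_on_subset by blast
      show "cmod (F y) \<le> M" if "cmod (x - y) = r/4" for y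
        by (rule bdd, rule subsetD[OF sub']) (simp add: dist_norm that)
    qed (use r in simp)
    then show ?thesis by (simp add: power2_eq_square numeral_2_eq_2)
  qed
  have "cmod ((deriv ^^ 0) F w - (\<Sum>i\<le>1. (deriv ^^ i) F z * (w - z) ^ i / fact i))
      \<le> 32 * M / r\<^sup>2 * cmod (w - z) ^ Suc 1 / fact 1"
    by (rule complex_Taylor[of "ball z (r/2)" 1 "\<lambda>i. (deriv ^^ i) F"])
      (use d b w r in auto)
  then show ?thesis by (simp add: power2_eq_square algebra_simps)
qed

text \<open>Cauchy estimates are uniform over the coordinates, so coordinatewise holomorphy of a locally
  bounded function gives differentiability in the supremum norm.\<close>

lemma has_complex_derivI:
  assumes holo: "\<And>k. (\<lambda>w. apply_bcontfun (g w) k) holomorphic_on ball z r" and r: "r > 0"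
    and bdd: "\<And>w. w \<in> ball z r \<Longrightarrow> norm (g w) \<le> M"
  shows "has_complex_deriv g (Bcontfun (\<lambda>k. deriv (\<lambda>w. apply_bcontfun (g w) k) z)) z"
proof -
  define F where "F k w = apply_bcontfun (g w) k" for k w
  define D where "D = (Bcontfun (\<lambda>k. deriv (F k) z) :: linf)"
  have Fb: "cmod (F k w) \<le> M" if "w \<in> ball z r" for k w
    unfolding F_def using norm_bounded bdd[OF that] by (rule order_trans)
  have holF: "F k holomorphic_on ball z r" for k
    using holo[of k] by (simp add: F_def[abs_def])
  have M: "M \<ge> 0"
    using Fb[of z 0] r norm_ge_zero[of "F 0 z"] by (simp del: norm_ge_zero)
  \<comment> \<open>A bound independent of \<open>k\<close> is what makes the sequence of coordinate
    derivatives an element of \<open>linf\<close>; for an unbounded sequence the value of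
    \<open>Bcontfun\<close> would be unspecified.\<close>
  have "cmod ((deriv ^^ 1) (F k) z) \<le> fact 1 * M / (r/2) ^ 1" for k
  proof (rule Cauchy_inequality)
    have sub: "cball z (r/2) \<subseteq> ball z r" using r by auto
    show "F k holomorphic_on ball z (r/2)"
      using holF sub ball_subset_cball holomorphic_on_subset by blast
    show "continuous_on (cball z (r/2)) (F k)"
      using holF sub holomorphic_on_imp_continuous_on continuous_on_subset by blast
    show "cmod (F k y) \<le> M" if "cmod (z - y) = r/2" for y
      by (rule Fb, rule subsetD[OF sub]) (simp add: dist_norm that)
  qed (use r in simp)
  then have D: "apply_bcontfun D k = deriv (F k) z" for k
    unfolding D_def by (intro apply_Bcontfun_nat[of _ "M / (r/2)"]) simp
  define C where "C = 32 * M / r\<^sup>2"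
  have C: "C \<ge> 0" using M by (simp add: C_def)
  have rem: "norm (g w - g z - scaleC_linf (w - z) D) \<le> C * (cmod (w - z))\<^sup>2" if "w \<in> ball z (r/2)" for w
  proof (rule norm_bound)
    fix k
    show "cmod (apply_bcontfun (g w - g z - scaleC_linf (w - z) D) k) \<le> C * (cmod (w - z))\<^sup>2"
      using holomorphic_remainder_bound[OF holF r Fb that, of k]
      by (simp add: apply_scaleC_linf D C_def F_def[abs_def] mult.commute)
  qed
  have "(g has_derivative (\<lambda>h. scaleC_linf h D)) (at z)"
    unfolding has_derivative_at_alt
  proof (intro conjI allI impI)
    show "bounded_linear (\<lambda>h. scaleC_linf h D)" by (rule bounded_linear_scaleC_linf)
    fix e :: real assume e: "e > 0"
    have "norm (g y - g z - scaleC_linf (y - z) D) \<le> e * cmod (y - z)"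
      if y: "cmod (y - z) < min (r/2) (e/(C+1))" for y
    proof -
      have "y \<in> ball z (r/2)" using y by (simp add: dist_norm norm_minus_commute)
      then have "norm (g y - g z - scaleC_linf (y - z) D) \<le> (C * cmod (y - z)) * cmod (y - z)"
        using rem by (simp add: power2_eq_square mult.assoc)
      also have "C * cmod (y - z) \<le> (C + 1) * (e/(C+1))"
        using y C by (intro mult_mono) auto
      also have "\<dots> = e" using C by simp
      finally show ?thesis by (simp add: mult_right_mono)
    qed
    moreover have "min (r/2) (e/(C+1)) > 0" using r e C by simp
    ultimately show "\<exists>d>0. \<forall>y. cmod (y - z) < d \<longrightarrow>
        norm (g y - g z - scaleC_linf (y - z) D) \<le> e * cmod (y - z)" by blast
  qed
  then show ?thesis
    by (simp add: has_complex_deriv_def D_def F_def[abs_def])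
qed

lemma has_complex_deriv_locally_bounded:
  assumes "has_complex_deriv f D z" "open U" "z \<in> U"
  obtains r M where "r > 0" "ball z r \<subseteq> U" "\<And>w. w \<in> ball z r \<Longrightarrow> norm (f w) \<le> M"
proof -
  have "isCont f z"
    using assms(1) unfolding has_complex_deriv_def by (rule has_derivative_continuous)
  then obtain d where d: "d > 0" "\<And>w. dist w z < d \<Longrightarrow> dist (f w) (f z) < 1"
    unfolding continuous_at_eps_delta by (metis zero_less_one)
  obtain e where e: "e > 0" "ball z e \<subseteq> U"
    using assms(2,3) openE by blast
  show ?thesis
  proof (rule that[of "min d e" "norm (f z) + 1"])
    show "min d e > 0" using d e by simp
    show "ball z (min d e) \<subseteq> U" using e by auto
    fix w assume "w \<in> ball z (min d e)"
    then have "dist (f w) (f z) < 1" using d(2)[of w] by (simp add: dist_commute)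
    then show "norm (f w) \<le> norm (f z) + 1"
      using norm_triangle_ineq2[of "f w" "f z"] by (simp add: dist_norm)
  qed
qed

lemma has_complex_deriv_coordinate_holomorphic:
  assumes "\<And>w. w \<in> U \<Longrightarrow> \<exists>D. has_complex_deriv f D w" "open U"
  shows "(\<lambda>w. apply_bcontfun (f w) k) holomorphic_on U"
proof -
  have "\<exists>D. ((\<lambda>w. apply_bcontfun (f w) k) has_field_derivative D) (at x)" if "x \<in> U" for x
    using assms(1)[OF that] has_complex_deriv_coordinate by blast
  then show ?thesis
    using assms(2) by (auto simp: holomorphic_on_open)
qed

text \<open>The coordinates of the derivative are holomorphic, and Cauchy's inequality bounds them
  uniformly on a smaller disc, so \<open>has_complex_derivI\<close> applies once more.\<close>

lemma has_complex_deriv_complex_deriv: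
  assumes ex: "\<And>w. w \<in> U \<Longrightarrow> \<exists>D. has_complex_deriv f D w" and U: "open U" and z: "z \<in> U"
  shows "\<exists>D. has_complex_deriv (complex_deriv f) D z"
proof -
  obtain D r M where D: "has_complex_deriv f D z" and r: "r > 0" "ball z r \<subseteq> U"
    and M: "\<And>w. w \<in> ball z r \<Longrightarrow> norm (f w) \<le> M"
    using ex[OF z] has_complex_deriv_locally_bounded[OF _ U z] by metis
  define F where "F k w = apply_bcontfun (f w) k" for k w
  have Fb: "cmod (F k w) \<le> M" if "w \<in> ball z r" for k w
    unfolding F_def using norm_bounded M[OF that] by (rule order_trans)
  have holF: "F k holomorphic_on ball z r" for k
    using has_complex_deriv_coordinate_holomorphic[OF ex U, of k] r(2)
    unfolding F_def[abs_def] by (rule holomorphic_on_subset)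
  have coord: "apply_bcontfun (complex_deriv f w) k = deriv (F k) w" if "w \<in> U" for w k
    using ex[OF that] has_complex_deriv_coordinate DERIV_imp_deriv complex_deriv_eq
    unfolding F_def[abs_def] by metis
  have sub: "ball z (r/2) \<subseteq> ball z r" using r(1) by (intro subset_ball) auto
  have "has_complex_deriv (complex_deriv f)
      (Bcontfun (\<lambda>k. deriv (\<lambda>w. apply_bcontfun (complex_deriv f w) k) z)) z"
  proof (rule has_complex_derivI)
    show "r/2 > 0" using r by simp
    fix k
    have "deriv (F k) holomorphic_on ball z (r/2)"
      using holomorphic_deriv[OF holF open_ball] sub by (rule holomorphic_on_subset)
    then show "(\<lambda>w. apply_bcontfun (complex_deriv f w) k) holomorphic_on ball z (r/2)"
      by (rule holomorphic_transform) (metis coord sub r(2) subsetD)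
  next
    fix w assume w: "w \<in> ball z (r/2)"
    show "norm (complex_deriv f w) \<le> M / (r/4)"
    proof (rule norm_bound)
      fix k
      have sub': "cball w (r/4) \<subseteq> ball z r"
      proof
        fix y assume "y \<in> cball w (r/4)"
        then have "dist z y \<le> dist z w + dist w y" "dist w y \<le> r/4" "dist z w < r/2"
          using w by (auto simp: dist_triangle)
        then show "y \<in> ball z r" using r by simp
      qed
      have "cmod ((deriv ^^ 1) (F k) w) \<le> fact 1 * M / (r/4) ^ 1"
      proof (rule Cauchy_inequality)
        show "F k holomorphic_on ball w (r/4)"
          using holF sub' ball_subset_cball holomorphic_on_subset by blast
        show "continuous_on (cball w (r/4)) (F k)"
          using holF sub' holomorphic_on_imp_continuous_on continuous_on_subset by blast
        show "cmod (F k y) \<le> M" if "cmod (w - y) = r/4" for y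
          by (rule Fb, rule subsetD[OF sub']) (simp add: dist_norm that)
      qed (use r in simp)
      then show "cmod (apply_bcontfun (complex_deriv f w) k) \<le> M / (r/4)"
        using w sub r(2) by (subst coord) auto
    qed
  qed
  then show ?thesis by blast
qed

text \<open>The two claims are proved together: \<open>complex_deriv\<close> is a definite
  description, and it can be evaluated only where the previous iterate is known to be
  differentiable.\<close>

lemma complex_deriv_funpow_coordinate:
  assumes ex: "\<And>w. w \<in> U \<Longrightarrow> \<exists>D. has_complex_deriv f D w" and U: "open U"
  shows "z \<in> U \<Longrightarrow> (\<exists>D. has_complex_deriv ((complex_deriv ^^ i) f) D z) \<and>
    (\<forall>k. apply_bcontfun ((complex_deriv ^^ i) f z) k = (deriv ^^ i) (\<lambda>w. apply_bcontfun (f w) k) z)"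
proof (induction i arbitrary: z)
  case 0
  then show ?case using ex by simp
next
  case (Suc i)
  have 1: "\<exists>D. has_complex_deriv ((complex_deriv ^^ Suc i) f) D z"
    using has_complex_deriv_complex_deriv[OF _ U Suc.prems, of "(complex_deriv ^^ i) f"] Suc.IH by auto
  have "apply_bcontfun ((complex_deriv ^^ Suc i) f z) k = (deriv ^^ Suc i) (\<lambda>w. apply_bcontfun (f w) k) z" for k
  proof -
    obtain D where D: "has_complex_deriv ((complex_deriv ^^ i) f) D z"
      using Suc by blast
    then have "((\<lambda>w. apply_bcontfun ((complex_deriv ^^ i) f w) k) has_field_derivative apply_bcontfun D k) (at z)"
      by (rule has_complex_deriv_coordinate)
    then have "((deriv ^^ i) (\<lambda>w. apply_bcontfun (f w) k) has_field_derivative apply_bcontfun D k) (at z)"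
      by (rule has_field_derivative_transform_within_open[OF _ U Suc.prems]) (use Suc.IH in auto)
    then show ?thesis
      using complex_deriv_eq[OF D] by (simp add: DERIV_imp_deriv)
  qed
  with 1 show ?case by blast
qed

section \<open>Elementary properties of the l1 norm\<close>

lemma in_l1_add: "in_l1 x \<Longrightarrow> in_l1 y \<Longrightarrow> in_l1 (x + y)"
  and l1_norm_triangle: "in_l1 x \<Longrightarrow> in_l1 y \<Longrightarrow> l1_norm (x + y) \<le> l1_norm x + l1_norm y"
proof -
  assume "in_l1 x" "in_l1 y"
  then have s: "summable (\<lambda>k. cmod (apply_bcontfun x k) + cmod (apply_bcontfun y k))"
    and e: "l1_norm x + l1_norm y = (\<Sum>k. cmod (apply_bcontfun x k) + cmod (apply_bcontfun y k))"
    by (auto simp: in_l1_def l1_norm_def suminf_add intro: summable_add)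
  show i: "in_l1 (x + y)"
    unfolding in_l1_def by (rule summable_comparison_test'[OF s]) (simp add: norm_triangle_ineq)
  show "l1_norm (x + y) \<le> l1_norm x + l1_norm y"
    unfolding e using i[unfolded in_l1_def] s
    by (auto simp: l1_norm_def norm_triangle_ineq intro!: suminf_le)
qed

lemma in_l1_scaleC: "in_l1 x \<Longrightarrow> in_l1 (scaleC_linf c x)"
  and l1_norm_scaleC: "in_l1 x \<Longrightarrow> l1_norm (scaleC_linf c x) = cmod c * l1_norm x"
  by (auto simp: in_l1_def l1_norm_def apply_scaleC_linf norm_mult suminf_mult intro: summable_mult)

lemma l1_norm_nonneg: "in_l1 x \<Longrightarrow> 0 \<le> l1_norm x"
  by (simp add: in_l1_def l1_norm_def suminf_nonneg)

lemma in_l1_diff: "in_l1 x \<Longrightarrow> in_l1 y \<Longrightarrow> in_l1 (x - y)"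
proof -
  assume "in_l1 x" "in_l1 y"
  then have "in_l1 (x + scaleC_linf (-1) y)"
    by (intro in_l1_add in_l1_scaleC)
  also have "x + scaleC_linf (-1) y = x - y"
    by (rule bcontfun_eqI) (simp add: apply_scaleC_linf)
  finally show ?thesis .
qed


section \<open>The Calderon space\<close>

lemma Re_0_eq: "Re z = 0 \<Longrightarrow> z = \<i> * of_real (Im z)"
  and Re_1_eq: "Re z = 1 \<Longrightarrow> z = 1 + \<i> * of_real (Im z)"
  by (simp_all add: complex_eq_iff)

text \<open>Differentiability in norm follows from \<open>has_complex_derivI\<close>, and continuity
  on the left edge from continuity on the strip. Continuity in the l1 norm on the right edge is a
  separate matter, since the sup norm does not control the l1 norm.\<close>

lemma calderonI:
  assumes cont: "continuous_on strip f"
    and bdd: "\<And>z. z \<in> strip \<Longrightarrow> norm (f z) \<le> M"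
    and holo: "\<And>k. (\<lambda>z. apply_bcontfun (f z) k) holomorphic_on interior strip"
    and l1: "\<And>t. in_l1 (f (1 + \<i> * of_real t))"
    and lim: "\<And>t. ((\<lambda>s. l1_norm (f (1 + \<i> * of_real s) - f (1 + \<i> * of_real t))) \<longlongrightarrow> 0) (at t)"
    and l1_bdd: "\<And>t. l1_norm (f (1 + \<i> * of_real t)) \<le> M'"
  shows "f \<in> calderon_space"
proof -
  have "\<exists>D. has_complex_deriv f D z" if z: "z \<in> interior strip" for z
  proof -
    obtain r where r: "r > 0" "ball z r \<subseteq> interior strip"
      using z open_interior openE by blast
    have "has_complex_deriv f (Bcontfun (\<lambda>k. deriv (\<lambda>w. apply_bcontfun (f w) k) z)) z"
    proof (rule has_complex_derivI)
      show "(\<lambda>w. apply_bcontfun (f w) k) holomorphic_on ball z r" for k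
        using holo r(2) by (rule holomorphic_on_subset)
      show "norm (f w) \<le> M" if "w \<in> ball z r" for w
        using bdd that r(2) interior_subset by blast
    qed (fact r)
    then show ?thesis by blast
  qed
  moreover have "continuous_on UNIV (\<lambda>t::real. f (\<i> * of_real t))"
    by (rule continuous_on_compose2[OF cont]) (auto simp: strip_def intro!: continuous_intros)
  moreover have "bounded (f ` strip)" "bounded (range (\<lambda>t::real. f (\<i> * of_real t)))"
    using bdd by (auto simp: bounded_iff strip_def intro!: exI[of _ M])
  moreover have "bounded (range (\<lambda>t::real. l1_norm (f (1 + \<i> * of_real t))))"
    using l1_bdd l1 by (auto simp: bounded_iff l1_norm_nonneg)
  ultimately show ?thesis
    using cont l1 lim by (auto simp: calderon_space_def)
qed

lemma calderon_normI:
  assumes "\<And>z. Re z = 0 \<Longrightarrow> norm (f z) \<le> A"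
    and "\<And>z. Re z = 1 \<Longrightarrow> l1_norm (f z) \<le> A"
  shows "calderon_norm f \<le> A"
  unfolding calderon_norm_def using assms by (auto intro!: cSUP_least)

lemma calderon_continuous: "f \<in> calderon_space \<Longrightarrow> continuous_on strip f"
  by (simp add: calderon_space_def)

lemma calderon_bounded:
  assumes "f \<in> calderon_space"
  obtains M where "\<And>z. z \<in> strip \<Longrightarrow> norm (f z) \<le> M"
  using assms by (auto simp: calderon_space_def bounded_iff)

lemma calderon_coordinate_continuous:
  "f \<in> calderon_space \<Longrightarrow> continuous_on strip (\<lambda>z. apply_bcontfun (f z) k)"
  using bounded_linear.continuous_on[OF bounded_linear_coordinate] calderon_continuous by blast

lemma calderon_holomorphic:
  "f \<in> calderon_space \<Longrightarrow> (\<lambda>z. apply_bcontfun (f z) k) holomorphic_on interior strip"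
  by (rule has_complex_deriv_coordinate_holomorphic) (auto simp: calderon_space_def)

text \<open>The bridge to scalar functions: all later computations with Taylor coefficients of lifts
  are done in a single coordinate.\<close>

lemma calderon_taylor_coeff:
  assumes "f \<in> calderon_space"
  shows "apply_bcontfun (taylor_coeff i f) k = half_coeff i (\<lambda>z. apply_bcontfun (f z) k)"
proof -
  have "apply_bcontfun ((complex_deriv ^^ i) f (1/2)) k = (deriv ^^ i) (\<lambda>w. apply_bcontfun (f w) k) (1/2)"
    using complex_deriv_funpow_coordinate[of "interior strip" f "1/2" i] assms half_in_strip
    by (auto simp: calderon_space_def)
  then show ?thesis
    unfolding taylor_coeff_def half_coeff_def by (simp add: scaleR_conv_of_real)
qed

lemma calderon_in_l1: "f \<in> calderon_space \<Longrightarrow> Re z = 1 \<Longrightarrow> in_l1 (f z)"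
  by (subst Re_1_eq[of z]) (auto simp: calderon_space_def)

lemma calderon_l1_le:
  assumes "f \<in> calderon_space" "Re z = 1"
  shows "l1_norm (f z) \<le> calderon_norm f"
proof -
  have "l1_norm (f (1 + \<i> * of_real (Im z))) \<le> (SUP t::real. l1_norm (f (1 + \<i> * of_real t)))"
    by (rule cSUP_upper) (use assms(1) in \<open>auto simp: calderon_space_def bounded_imp_bdd_above\<close>)
  then show ?thesis
    using Re_1_eq[OF assms(2)] by (simp add: calderon_norm_def)
qed

lemma norm_le_l1_norm:
  assumes "in_l1 x"
  shows "cmod (apply_bcontfun x k) \<le> l1_norm x"
  using sum_le_suminf[of "\<lambda>k. cmod (apply_bcontfun x k)" "{k}"] assms
  by (simp add: in_l1_def l1_norm_def)

lemma calderon_le_0: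
  assumes "f \<in> calderon_space" "Re z = 0"
  shows "norm (f z) \<le> calderon_norm f"
proof -
  have "norm (f (\<i> * of_real (Im z))) \<le> (SUP t::real. norm (f (\<i> * of_real t)))"
    by (rule cSUP_upper)
      (use assms(1) in \<open>auto simp: calderon_space_def bounded_iff bdd_above_def\<close>)
  then show ?thesis
    using Re_0_eq[OF assms(2)] by (simp add: calderon_norm_def)
qed

lemma calderon_norm_nonneg: "f \<in> calderon_space \<Longrightarrow> 0 \<le> calderon_norm f"
  using calderon_le_0[of f 0] norm_ge_zero[of "f 0"] by (simp del: norm_ge_zero)

text \<open>The maximum principle in each coordinate; on the right edge the l1 norm dominates every
  coordinate.\<close>

lemma calderon_coordinate_le:
  assumes f: "f \<in> calderon_space" and z: "z \<in> strip"
  shows "cmod (apply_bcontfun (f z) k) \<le> calderon_norm f"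
proof -
  obtain M where M: "\<And>z. z \<in> strip \<Longrightarrow> norm (f z) \<le> M"
    using calderon_bounded[OF f] by blast
  show ?thesis
  proof (rule strip_bounded_by_boundary[OF calderon_coordinate_continuous[OF f] calderon_holomorphic[OF f] _ _ z])
    show "cmod (apply_bcontfun (f z) k) \<le> M" if "z \<in> strip" for z
      using norm_bounded M[OF that] by (rule order_trans)
    show "cmod (apply_bcontfun (f z) k) \<le> calderon_norm f" if "Re z = 0 \<or> Re z = 1" for z
      using that
    proof
      assume "Re z = 0"
      then show ?thesis using order_trans[OF norm_bounded calderon_le_0[OF f]] by blast
    next
      assume "Re z = 1"
      then show ?thesis
        using order_trans[OF norm_le_l1_norm[OF calderon_in_l1[OF f]] calderon_l1_le[OF f]] by blast
    qed
  qed
qed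

lemma calderon_l1_tendsto:
  "f \<in> calderon_space \<Longrightarrow>
    ((\<lambda>s. l1_norm (f (1 + \<i> * of_real s) - f (1 + \<i> * of_real t))) \<longlongrightarrow> 0) (at t)"
  by (simp add: calderon_space_def)

lemma calderon_add:
  assumes f: "f \<in> calderon_space" and g: "g \<in> calderon_space"
  shows "(\<lambda>z. f z + g z) \<in> calderon_space"
    and "calderon_norm (\<lambda>z. f z + g z) \<le> calderon_norm f + calderon_norm g"
proof -
  have in1: "in_l1 (f (1 + \<i> * of_real t))" "in_l1 (g (1 + \<i> * of_real t))" for t
    using calderon_in_l1[OF f] calderon_in_l1[OF g] by auto
  have l1: "l1_norm (f z + g z) \<le> calderon_norm f + calderon_norm g" if "Re z = 1" for z
    using l1_norm_triangle calderon_in_l1[OF f that] calderon_in_l1[OF g that]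
      calderon_l1_le[OF f that] calderon_l1_le[OF g that] by fastforce
  obtain M M' where M: "\<And>z. z \<in> strip \<Longrightarrow> norm (f z) \<le> M" "\<And>z. z \<in> strip \<Longrightarrow> norm (g z) \<le> M'"
    using calderon_bounded[OF f] calderon_bounded[OF g] by metis
  show "(\<lambda>z. f z + g z) \<in> calderon_space"
  proof (rule calderonI)
    show "continuous_on strip (\<lambda>z. f z + g z)"
      by (intro continuous_intros calderon_continuous f g)
    show "norm (f z + g z) \<le> M + M'" if "z \<in> strip" for z
      using M that by (intro norm_triangle_le add_mono)
    show "(\<lambda>z. apply_bcontfun (f z + g z) k) holomorphic_on interior strip" for k
      by (auto intro!: holomorphic_intros calderon_holomorphic f g)
    show "in_l1 (f (1 + \<i> * of_real t) + g (1 + \<i> * of_real t))" for t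
      by (intro in_l1_add in1)
    show "l1_norm (f (1 + \<i> * of_real t) + g (1 + \<i> * of_real t)) \<le> calderon_norm f + calderon_norm g" for t
      by (rule l1) simp
    fix t
    let ?d = "\<lambda>f s. f (1 + \<i> * of_real s) - f (1 + \<i> * of_real t) :: linf"
    have "((\<lambda>s. l1_norm (?d f s) + l1_norm (?d g s)) \<longlongrightarrow> 0 + 0) (at t)"
      by (intro tendsto_add calderon_l1_tendsto f g)
    moreover have "l1_norm (?d (\<lambda>z. f z + g z) s) \<le> l1_norm (?d f s) + l1_norm (?d g s)" for s
      using l1_norm_triangle[of "?d f s" "?d g s"] in1 by (simp add: in_l1_diff add_diff_add)
    moreover have "0 \<le> l1_norm (?d (\<lambda>z. f z + g z) s)" for s
      by (intro l1_norm_nonneg in_l1_diff in_l1_add in1)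
    ultimately show "((\<lambda>s. l1_norm (?d (\<lambda>z. f z + g z) s)) \<longlongrightarrow> 0) (at t)"
      using tendsto_sandwich[of "\<lambda>s. 0" "\<lambda>s. l1_norm (?d (\<lambda>z. f z + g z) s)" "at t"
          "\<lambda>s. l1_norm (?d f s) + l1_norm (?d g s)" 0] by simp
  qed
  show "calderon_norm (\<lambda>z. f z + g z) \<le> calderon_norm f + calderon_norm g"
    by (rule calderon_normI[OF norm_triangle_le l1])
      (use calderon_le_0[OF f] calderon_le_0[OF g] in \<open>auto intro: add_mono\<close>)
qed

text \<open>The multiplier relation is only required on the boundary of the strip, so that division by
  a function with zeros inside is covered as well.\<close>

lemma calderon_multiplier:
  assumes f: "f \<in> calderon_space"
    and cont: "continuous_on strip g"
    and bdd: "\<And>z. z \<in> strip \<Longrightarrow> norm (g z) \<le> M"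
    and holo: "\<And>k. (\<lambda>z. apply_bcontfun (g z) k) holomorphic_on interior strip"
    and g: "\<And>z. Re z = 0 \<or> Re z = 1 \<Longrightarrow> g z = scaleC_linf (q z) (f z)"
    and contq: "continuous_on {z. Re z = 1} q"
    and q: "\<And>z. Re z = 0 \<or> Re z = 1 \<Longrightarrow> cmod (q z) \<le> B"
  shows "g \<in> calderon_space" and "calderon_norm g \<le> B * calderon_norm f"
proof -
  have l1: "l1_norm (g z) \<le> B * calderon_norm f" if "Re z = 1" for z
    using that calderon_in_l1[OF f that] calderon_l1_le[OF f that] q[of z] l1_norm_nonneg[of "f z"]
    by (auto simp: g l1_norm_scaleC intro!: mult_mono order_trans[OF norm_ge_zero])
  have l0: "norm (g z) \<le> B * calderon_norm f" if "Re z = 0" for z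
    using that calderon_le_0[OF f that] q[of z]
    by (auto simp: g intro!: order_trans[OF norm_scaleC_linf_le] mult_mono order_trans[OF norm_ge_zero])
  have in1: "in_l1 (f (1 + \<i> * of_real t))" for t
    using calderon_in_l1[OF f] by auto
  show "g \<in> calderon_space"
  proof (rule calderonI[OF cont bdd holo])
    show "in_l1 (g (1 + \<i> * of_real t))" for t
      by (simp add: g in_l1_scaleC in1)
    show "l1_norm (g (1 + \<i> * of_real t)) \<le> B * calderon_norm f" for t
      by (rule l1) simp
    fix t
    define d where "d h s = (h (1 + \<i> * of_real s) - h (1 + \<i> * of_real t) :: linf)" for h and s :: real
    define Q where "Q s = q (1 + \<i> * of_real s)" for s
    have "continuous_on UNIV Q"
      unfolding Q_def by (rule continuous_on_compose2[OF contq]) (auto intro!: continuous_intros)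
    then have Q: "(Q \<longlongrightarrow> Q t) (at t)"
      by (simp add: continuous_on_def)
    have eq: "d g s = scaleC_linf (Q s) (d f s) + scaleC_linf (Q s - Q t) (f (1 + \<i> * of_real t))" for s
      by (rule bcontfun_eqI) (simp add: d_def Q_def g apply_scaleC_linf algebra_simps)
    have d1: "in_l1 (d f s)" for s
      by (simp add: d_def in_l1_diff in1)
    have le: "l1_norm (d g s) \<le> cmod (Q s) * l1_norm (d f s) + cmod (Q s - Q t) * l1_norm (f (1 + \<i> * of_real t))" for s
      unfolding eq using l1_norm_triangle[OF in_l1_scaleC[OF d1] in_l1_scaleC[OF in1]]
      by (simp add: l1_norm_scaleC d1 in1)
    have "((\<lambda>s. cmod (Q s) * l1_norm (d f s) + cmod (Q s - Q t) * l1_norm (f (1 + \<i> * of_real t)))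
        \<longlongrightarrow> cmod (Q t) * 0 + cmod (Q t - Q t) * l1_norm (f (1 + \<i> * of_real t))) (at t)"
      unfolding d_def by (intro tendsto_intros Q calderon_l1_tendsto f)
    moreover have "0 \<le> l1_norm (d g s)" for s
      unfolding eq by (intro l1_norm_nonneg in_l1_add in_l1_scaleC d1 in1)
    ultimately have "((\<lambda>s. l1_norm (d g s)) \<longlongrightarrow> 0) (at t)"
      using le tendsto_sandwich[of "\<lambda>s. 0" "\<lambda>s. l1_norm (d g s)" "at t"
          "\<lambda>s. cmod (Q s) * l1_norm (d f s) + cmod (Q s - Q t) * l1_norm (f (1 + \<i> * of_real t))" 0] by simp
    then show "((\<lambda>s. l1_norm (g (1 + \<i> * of_real s) - g (1 + \<i> * of_real t))) \<longlongrightarrow> 0) (at t)"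
      by (simp add: d_def)
  qed
  show "calderon_norm g \<le> B * calderon_norm f"
    by (rule calderon_normI[OF l0 l1])
qed

lemma continuous_on_scaleC_linf:
  assumes "continuous_on S q" "continuous_on S f"
  shows "continuous_on S (\<lambda>z. scaleC_linf (q z) (f z))"
proof -
  interpret bounded_bilinear scaleC_linf
  proof
    show "\<exists>K. \<forall>a b. norm (scaleC_linf a b) \<le> norm a * norm b * K"
      by (rule exI[of _ 1]) (simp add: norm_scaleC_linf_le)
  qed (auto intro!: bcontfun_eqI simp: apply_scaleC_linf algebra_simps)
  show ?thesis using assms by (rule continuous_on)
qed

lemma calderon_mult:
  assumes f: "f \<in> calderon_space" and holo: "q holomorphic_on UNIV"
    and q: "\<And>z. z \<in> strip \<Longrightarrow> cmod (q z) \<le> B"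
  shows "(\<lambda>z. scaleC_linf (q z) (f z)) \<in> calderon_space"
    and "calderon_norm (\<lambda>z. scaleC_linf (q z) (f z)) \<le> B * calderon_norm f"
proof -
  obtain M where M: "\<And>z. z \<in> strip \<Longrightarrow> norm (f z) \<le> M"
    using calderon_bounded[OF f] by blast
  have contq: "continuous_on S q" for S
    using holo holomorphic_on_imp_continuous_on continuous_on_subset by blast
  have 1: "continuous_on strip (\<lambda>z. scaleC_linf (q z) (f z))"
    by (intro continuous_on_scaleC_linf contq calderon_continuous f)
  have 2: "norm (scaleC_linf (q z) (f z)) \<le> B * M" if "z \<in> strip" for z
    using M[OF that] q[OF that]
    by (auto intro!: order_trans[OF norm_scaleC_linf_le] mult_mono order_trans[OF norm_ge_zero])
  have 3: "(\<lambda>z. apply_bcontfun (scaleC_linf (q z) (f z)) k) holomorphic_on interior strip" for k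
    using holomorphic_on_subset[OF holo, of "interior strip"]
    by (auto simp: apply_scaleC_linf intro!: holomorphic_intros calderon_holomorphic f)
  have 4: "cmod (q z) \<le> B" if "Re z = 0 \<or> Re z = 1" for z
    by (rule q) (use that in \<open>auto simp: strip_def\<close>)
  show "(\<lambda>z. scaleC_linf (q z) (f z)) \<in> calderon_space"
    and "calderon_norm (\<lambda>z. scaleC_linf (q z) (f z)) \<le> B * calderon_norm f"
    by (rule calderon_multiplier[OF f 1 2 3 refl contq 4]; assumption)+
qed

section \<open>Weighted reindexing of coordinates\<close>

definition reindex_linf :: "(nat \<Rightarrow> real) \<Rightarrow> (nat \<Rightarrow> nat) \<Rightarrow> linf \<Rightarrow> linf" where
  "reindex_linf s \<sigma> x = Bcontfun (\<lambda>k. of_real (s k) * apply_bcontfun x (\<sigma> k))"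

lemma apply_reindex_linf:
  assumes "\<And>k. \<bar>s k\<bar> \<le> 1"
  shows "apply_bcontfun (reindex_linf s \<sigma> x) k = of_real (s k) * apply_bcontfun x (\<sigma> k)"
proof -
  have "cmod (of_real (s k) * apply_bcontfun x (\<sigma> k)) \<le> 1 * norm x" for k
    unfolding norm_mult using assms by (intro mult_mono norm_bounded) auto
  then show ?thesis
    unfolding reindex_linf_def by (rule apply_Bcontfun_nat)
qed

lemma norm_reindex_linf_le:
  assumes "\<And>k. \<bar>s k\<bar> \<le> 1"
  shows "norm (reindex_linf s \<sigma> x) \<le> norm x"
proof (rule norm_bound)
  fix k
  have "cmod (of_real (s k) * apply_bcontfun x (\<sigma> k)) \<le> 1 * norm x"
    unfolding norm_mult using assms by (intro mult_mono norm_bounded) auto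
  then show "cmod (apply_bcontfun (reindex_linf s \<sigma> x) k) \<le> norm x"
    by (simp add: apply_reindex_linf assms)
qed

lemma reindex_linf_l1:
  assumes s: "\<And>k. \<bar>s k\<bar> \<le> 1" and inj: "inj \<sigma>" and x: "in_l1 x"
  shows "in_l1 (reindex_linf s \<sigma> x)" and "l1_norm (reindex_linf s \<sigma> x) \<le> l1_norm x"
proof -
  let ?c = "\<lambda>k. cmod (apply_bcontfun x k)"
  have 1: "summable (?c \<circ> \<sigma>)" "suminf (?c \<circ> \<sigma>) \<le> suminf ?c"
    using x inj by (auto simp: in_l1_def intro!: summable_reindex suminf_reindex_mono)
  have 2: "cmod (apply_bcontfun (reindex_linf s \<sigma> x) k) \<le> (?c \<circ> \<sigma>) k" for k
    using mult_right_mono[OF s[of k], of "?c (\<sigma> k)"] by (simp add: apply_reindex_linf s norm_mult)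
  show 3: "in_l1 (reindex_linf s \<sigma> x)"
    unfolding in_l1_def by (rule summable_comparison_test'[OF 1(1)]) (use 2 in simp)
  show "l1_norm (reindex_linf s \<sigma> x) \<le> l1_norm x"
    using suminf_le[OF 2 3[unfolded in_l1_def] 1(1)] 1(2) by (simp add: l1_norm_def)
qed

text \<open>Weights of modulus at most 1 and reindexing along an injection increase neither the sup
  norm nor the l1 norm, and they do not involve \<open>z\<close>. In this way symmetries of the
  couple act on lifts and so on Rochberg spaces of every order.\<close>

lemma calderon_reindex:
  assumes f: "f \<in> calderon_space" and s: "\<And>k. \<bar>s k\<bar> \<le> 1" and inj: "inj \<sigma>"
  shows "(\<lambda>z. reindex_linf s \<sigma> (f z)) \<in> calderon_space"
    and "calderon_norm (\<lambda>z. reindex_linf s \<sigma> (f z)) \<le> calderon_norm f"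
proof -
  let ?R = "reindex_linf s \<sigma>"
  have in1: "in_l1 (f (1 + \<i> * of_real t))" for t
    using calderon_in_l1[OF f] by auto
  have diff: "?R x - ?R y = ?R (x - y)" for x y
    by (rule bcontfun_eqI) (simp add: apply_reindex_linf s algebra_simps)
  have "bounded_linear ?R"
    by (rule bounded_linear_intro[of _ 1])
      (auto intro!: bcontfun_eqI simp: apply_reindex_linf s algebra_simps norm_reindex_linf_le scaleR_conv_of_real)
  then have cont: "continuous_on strip (\<lambda>z. ?R (f z))"
    by (rule bounded_linear.continuous_on) (rule calderon_continuous[OF f])
  obtain M where M: "\<And>z. z \<in> strip \<Longrightarrow> norm (f z) \<le> M"
    using calderon_bounded[OF f] by blast
  show "(\<lambda>z. ?R (f z)) \<in> calderon_space"
  proof (rule calderonI[OF cont])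
    show "norm (?R (f z)) \<le> M" if "z \<in> strip" for z
      using norm_reindex_linf_le[OF s] M[OF that] by (rule order_trans)
    show "(\<lambda>z. apply_bcontfun (?R (f z)) k) holomorphic_on interior strip" for k
      by (auto simp: apply_reindex_linf s intro!: holomorphic_intros calderon_holomorphic f)
    show "in_l1 (?R (f (1 + \<i> * of_real t)))" for t
      by (rule reindex_linf_l1[OF s inj in1])
    show "l1_norm (?R (f (1 + \<i> * of_real t))) \<le> calderon_norm f" for t
      by (rule order_trans[OF reindex_linf_l1(2)[OF s inj in1]], rule calderon_l1_le[OF f]) simp
    fix t
    let ?d = "\<lambda>s. f (1 + \<i> * of_real s) - f (1 + \<i> * of_real t)"
    show "((\<lambda>s. l1_norm (?R (f (1 + \<i> * of_real s)) - ?R (f (1 + \<i> * of_real t)))) \<longlongrightarrow> 0) (at t)"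
      unfolding diff
    proof (rule tendsto_sandwich[OF _ _ tendsto_const calderon_l1_tendsto[OF f]])
      show "\<forall>\<^sub>F x in at t. 0 \<le> l1_norm (?R (?d x))"
        by (intro always_eventually allI l1_norm_nonneg reindex_linf_l1(1)[OF s inj] in_l1_diff in1)
      show "\<forall>\<^sub>F x in at t. l1_norm (?R (?d x)) \<le> l1_norm (?d x)"
        by (intro always_eventually allI reindex_linf_l1(2)[OF s inj] in_l1_diff in1)
    qed
  qed
  show "calderon_norm (\<lambda>z. ?R (f z)) \<le> calderon_norm f"
  proof (rule calderon_normI)
    show "norm (?R (f z)) \<le> calderon_norm f" if "Re z = 0" for z
      using norm_reindex_linf_le[OF s] calderon_le_0[OF f that] by (rule order_trans)
    show "l1_norm (?R (f z)) \<le> calderon_norm f" if "Re z = 1" for z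
      using reindex_linf_l1(2)[OF s inj calderon_in_l1[OF f that]] calderon_l1_le[OF f that]
      by (rule order_trans)
  qed
qed


section \<open>Rochberg spaces and their pairing\<close>

definition lifts :: "nat \<Rightarrow> (nat \<Rightarrow> linf) \<Rightarrow> (complex \<Rightarrow> linf) set" where
  "lifts n x = {f \<in> calderon_space. \<forall>i<n. taylor_coeff i f = x i}"

lemma lifts_iff:
  "f \<in> lifts n x \<longleftrightarrow> f \<in> calderon_space \<and>
    (\<forall>i<n. \<forall>k. half_coeff i (\<lambda>z. apply_bcontfun (f z) k) = apply_bcontfun (x i) k)"
  by (auto simp: lifts_def simp flip: calderon_taylor_coeff intro: bcontfun_eqI)

lemma rochberg_iff:
  "x \<in> rochberg n \<longleftrightarrow>
    (\<forall>i\<ge>n. x i = 0) \<and> (\<forall>i k. apply_bcontfun (x i) k \<in> \<real>) \<and> lifts n x \<noteq> {}"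
  by (auto simp: rochberg_def complex_rochberg_def tuples_def lifts_def)

lemma rochberg_norm_lifts: "rochberg_norm n x = (INF f\<in>lifts n x. calderon_norm f)"
  by (simp add: rochberg_norm_def lifts_def)

lemma rochberg_norm_le: "f \<in> lifts n x \<Longrightarrow> rochberg_norm n x \<le> calderon_norm f"
  unfolding rochberg_norm_lifts
  by (rule cINF_lower) (auto simp: bdd_below_def lifts_def intro: calderon_norm_nonneg)

text \<open>Estimates against the quotient norm are proved for an arbitrary lift and then passed to
  the infimum. In bilinear estimates this is done for one argument at a time, with \<open>c\<close>
  containing what depends on the other.\<close>

lemma rochberg_norm_greatest:
  assumes x: "x \<in> rochberg n" and c: "c \<ge> 0"
    and L: "\<And>f. f \<in> lifts n x \<Longrightarrow> L \<le> c * calderon_norm f"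
  shows "L \<le> c * rochberg_norm n x"
proof (cases "c = 0")
  case True
  then show ?thesis using L x by (auto simp: rochberg_iff)
next
  case False
  then have "L / c \<le> rochberg_norm n x"
    unfolding rochberg_norm_lifts using x L c
    by (intro cINF_greatest) (auto simp: rochberg_iff field_simps)
  then show ?thesis using False c by (simp add: field_simps)
qed

lemma rochberg_norm_nonneg: "x \<in> rochberg n \<Longrightarrow> 0 \<le> rochberg_norm n x"
  using rochberg_norm_greatest[of x n 1 0] by (simp add: lifts_def calderon_norm_nonneg)

text \<open>Operators between Rochberg spaces are built in this way: a norm-controlled operation on
  lifts descends to tuples. Scaling, truncation, both shifts and \<open>swap\<close> are
  instances.\<close>

lemma rochberg_transfer:
  assumes x: "x \<in> rochberg n" and c: "c \<ge> 0"
    and y: "\<And>i. i \<ge> m \<Longrightarrow> y i = 0" "\<And>i k. apply_bcontfun (y i) k \<in> \<real>"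
    and lift: "\<And>f. f \<in> lifts n x \<Longrightarrow> \<exists>g\<in>lifts m y. calderon_norm g \<le> c * calderon_norm f"
  shows "y \<in> rochberg m" and "rochberg_norm m y \<le> c * rochberg_norm n x"
proof -
  show "y \<in> rochberg m"
    using x y lift unfolding rochberg_iff by blast
  show "rochberg_norm m y \<le> c * rochberg_norm n x"
    using lift rochberg_norm_le by (intro rochberg_norm_greatest[OF x c]) force
qed

lemma lifts_add:
  assumes "f \<in> lifts n x" "g \<in> lifts n y"
  shows "(\<lambda>z. f z + g z) \<in> lifts n (x + y)"
  using assms by (auto simp: lifts_iff calderon_add calderon_holomorphic half_coeff_add plus_fun_def)

lemma rochberg_add:
  assumes x: "x \<in> rochberg n" and y: "y \<in> rochberg n"
  shows "x + y \<in> rochberg n"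
    and "rochberg_norm n (x + y) \<le> rochberg_norm n x + rochberg_norm n y"
proof -
  have s: "f \<in> lifts n x \<Longrightarrow> g \<in> lifts n y \<Longrightarrow> (\<lambda>z. f z + g z) \<in> lifts n (x + y)" for f g
    by (rule lifts_add)
  show xy: "x + y \<in> rochberg n"
    using x y s by (auto simp: rochberg_iff plus_fun_def Reals_add) blast
  have "rochberg_norm n (x + y) \<le> calderon_norm f + calderon_norm g"
    if "f \<in> lifts n x" "g \<in> lifts n y" for f g
    using order_trans[OF rochberg_norm_le[OF s[OF that]] calderon_add(2)] that by (auto simp: lifts_def)
  then have "rochberg_norm n (x + y) - calderon_norm f \<le> rochberg_norm n y" if "f \<in> lifts n x" for f
    using rochberg_norm_greatest[OF y, of 1 "rochberg_norm n (x + y) - calderon_norm f"] that by fastforce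
  then show "rochberg_norm n (x + y) \<le> rochberg_norm n x + rochberg_norm n y"
    using rochberg_norm_greatest[OF x, of 1 "rochberg_norm n (x + y) - rochberg_norm n y"] by fastforce
qed

lemma rochberg_scale_le:
  assumes x: "x \<in> rochberg n"
  shows "r *\<^sub>R x \<in> rochberg n" and "rochberg_norm n (r *\<^sub>R x) \<le> \<bar>r\<bar> * rochberg_norm n x"
proof -
  have "\<exists>g\<in>lifts n (r *\<^sub>R x). calderon_norm g \<le> \<bar>r\<bar> * calderon_norm f" if f: "f \<in> lifts n x" for f
  proof (rule bexI)
    let ?g = "\<lambda>z. scaleC_linf (of_real r) (f z)"
    have fC: "f \<in> calderon_space" using f by (simp add: lifts_def)
    show "calderon_norm ?g \<le> \<bar>r\<bar> * calderon_norm f"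
      by (rule calderon_mult[OF fC]) auto
    have "?g \<in> calderon_space"
      by (rule calderon_mult[OF fC, where B = "\<bar>r\<bar>"]) auto
    then show "?g \<in> lifts n (r *\<^sub>R x)"
      using f by (auto simp: lifts_iff apply_scaleC_linf half_coeff_cmult calderon_holomorphic scaleR_fun_def scaleR_conv_of_real)
  qed
  then show "r *\<^sub>R x \<in> rochberg n" and "rochberg_norm n (r *\<^sub>R x) \<le> \<bar>r\<bar> * rochberg_norm n x"
    using x by (auto intro!: rochberg_transfer[OF x] simp: rochberg_iff scaleR_fun_def scaleR_conv_of_real Reals_mult)
qed

lemma zero_rochberg: "0 \<in> rochberg n"
proof -
  have "(\<lambda>z. 0) \<in> calderon_space"
    by (rule calderonI[where M = 0 and M' = 0]) (auto simp: in_l1_def l1_norm_def)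
  then have "(\<lambda>z. 0) \<in> lifts n 0"
    by (simp add: lifts_iff)
  then show ?thesis by (auto simp: rochberg_iff)
qed

lemma subspace_rochberg: "subspace (rochberg n)"
  by (simp add: subspace_def zero_rochberg rochberg_add rochberg_scale_le)

lemma rochberg_diff: "x \<in> rochberg n \<Longrightarrow> y \<in> rochberg n \<Longrightarrow> x - y \<in> rochberg n"
  by (rule subspace_diff[OF subspace_rochberg])

lemma rochberg_norm_scale:
  assumes x: "x \<in> rochberg n"
  shows "rochberg_norm n (r *\<^sub>R x) = \<bar>r\<bar> * rochberg_norm n x"
proof (cases "r = 0")
  case True
  have "rochberg_norm n (0 *\<^sub>R x) = 0"
    using rochberg_scale_le[OF x, of 0] rochberg_norm_nonneg by fastforce
  then show ?thesis using True by simp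
next
  case False
  have "rochberg_norm n x = rochberg_norm n (inverse r *\<^sub>R (r *\<^sub>R x))"
    using False by simp
  also have "\<dots> \<le> \<bar>inverse r\<bar> * rochberg_norm n (r *\<^sub>R x)"
    by (rule rochberg_scale_le[OF rochberg_scale_le(1)[OF x]])
  finally have "\<bar>r\<bar> * rochberg_norm n x \<le> rochberg_norm n (r *\<^sub>R x)"
    using False by (simp add: field_simps)
  then show ?thesis
    using rochberg_scale_le(2)[OF x, of r] by simp
qed

lemma rochberg_norm_diff_le:
  assumes x: "x \<in> rochberg n" and y: "y \<in> rochberg n"
  shows "rochberg_norm n (x - y) \<le> rochberg_norm n x + rochberg_norm n y"
  using rochberg_add(2)[OF x rochberg_scale_le(1)[OF y], of "-1"] rochberg_norm_scale[OF y, of "-1"]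
  by simp

text \<open>Cauchy's inequality for a coordinate of a lift. Continuity of the coordinate evaluations
  makes the quotient norm definite.\<close>

lemma rochberg_coordinate_le:
  assumes x: "x \<in> rochberg n"
  shows "cmod (apply_bcontfun (x i) k) \<le> 4 ^ i * rochberg_norm n x"
proof (cases "i < n")
  case True
  show ?thesis
  proof (rule rochberg_norm_greatest[OF x])
    fix f assume f: "f \<in> lifts n x"
    then have fC: "f \<in> calderon_space" by (simp add: lifts_def)
    have "cmod (half_coeff i (\<lambda>z. apply_bcontfun (f z) k)) \<le> calderon_norm f * 4 ^ i"
      by (rule half_coeff_bound[OF calderon_holomorphic[OF fC]])
        (use calderon_coordinate_le[OF fC] interior_subset in blast)
    then show "cmod (apply_bcontfun (x i) k) \<le> 4 ^ i * calderon_norm f"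
      using f True by (simp add: lifts_iff mult.commute)
  qed simp
next
  case False
  then show ?thesis using x rochberg_norm_nonneg[OF x] by (simp add: rochberg_iff)
qed

lemma rochberg_norm_eq_0:
  assumes x: "x \<in> rochberg n" and 0: "rochberg_norm n x = 0"
  shows "x = 0"
proof -
  have "x i = 0" for i
    by (rule bcontfun_eqI) (use rochberg_coordinate_le[OF x, of i] 0 in simp)
  then show ?thesis by (simp add: fun_eq_iff)
qed

lemma rochberg_truncate:
  assumes x: "x \<in> rochberg (Suc n)"
  shows "(\<lambda>i. if i < n then x i else 0) \<in> rochberg n"
    and "rochberg_norm n (\<lambda>i. if i < n then x i else 0) \<le> rochberg_norm (Suc n) x"
proof -
  let ?y = "\<lambda>i. if i < n then x i else 0"
  have lift: "\<exists>g\<in>lifts n ?y. calderon_norm g \<le> 1 * calderon_norm f" if "f \<in> lifts (Suc n) x" for f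
    using that by (intro bexI[of _ f]) (auto simp: lifts_def)
  have real: "apply_bcontfun (?y i) k \<in> \<real>" for i k
    using x by (simp add: rochberg_iff)
  show "?y \<in> rochberg n" "rochberg_norm n ?y \<le> rochberg_norm (Suc n) x"
    using rochberg_transfer[OF x _ _ real lift] by simp_all
qed

text \<open>On both edges of the strip one factor is bounded and the other one summable.\<close>

lemma calderon_pairing:
  assumes f: "f \<in> calderon_space" and g: "g \<in> calderon_space"
  shows "(\<Sum>k<N. cmod (half_coeff m (\<lambda>z. apply_bcontfun (f z) k * apply_bcontfun (g (1 - z)) k)))
    \<le> 4 ^ m * calderon_norm f * calderon_norm g"
proof -
  define P where "P k z = apply_bcontfun (f z) k * apply_bcontfun (g (1 - z)) k" for k z
  \<comment> \<open>Unimodular factors (0 where the coefficient vanishes) turn the sum of absolute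
    values into a Taylor coefficient of the single scalar function \<open>H\<close>, to which the
    maximum principle applies.\<close>
  define u where "u k = cnj (sgn (half_coeff m (P k)))" for k
  have u: "cmod (u k) \<le> 1" for k
    by (simp add: u_def norm_sgn)
  have uc: "u k * half_coeff m (P k) = cmod (half_coeff m (P k))" for k
  proof -
    have "u k * half_coeff m (P k) = (half_coeff m (P k) * cnj (half_coeff m (P k))) / cmod (half_coeff m (P k))"
      by (simp add: u_def sgn_eq)
    also have "\<dots> = complex_of_real ((cmod (half_coeff m (P k)))\<^sup>2) / complex_of_real (cmod (half_coeff m (P k)))"
      by (simp only: complex_norm_square)
    finally show ?thesis by (simp add: power2_eq_square)
  qed
  define H where "H z = (\<Sum>k<N. u k * P k z)" for z
  have holP: "P k holomorphic_on interior strip" for k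
    unfolding P_def[abs_def]
    by (intro holomorphic_intros calderon_holomorphic[OF f] holomorphic_reflect[OF calderon_holomorphic[OF g]])
  have holH: "H holomorphic_on interior strip"
    unfolding H_def[abs_def] by (intro holomorphic_intros holP)
  have contH: "continuous_on strip H"
  proof -
    have "continuous_on strip (\<lambda>z. apply_bcontfun (g (1 - z)) k)" for k
      by (rule continuous_on_compose2[OF calderon_coordinate_continuous[OF g]])
        (auto intro!: continuous_intros simp: reflect_strip)
    then show ?thesis
      unfolding H_def[abs_def] P_def by (intro continuous_intros calderon_coordinate_continuous[OF f])
  qed
  have le: "cmod (H z) \<le> (\<Sum>k<N. cmod (P k z))" for z
    unfolding H_def by (rule order_trans[OF norm_sum])
      (auto intro!: sum_mono mult_left_le_one_le simp: norm_mult u)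
  have part: "(\<Sum>k<N. cmod (apply_bcontfun (h z) k)) \<le> calderon_norm h" if "h \<in> calderon_space" "Re z = 1" for h z
    using sum_le_suminf[of "\<lambda>k. cmod (apply_bcontfun (h z) k)" "{..<N}"] calderon_in_l1[OF that] calderon_l1_le[OF that]
    by (simp add: in_l1_def l1_norm_def)
  have bH: "cmod (H z) \<le> calderon_norm f * calderon_norm g" if z: "z \<in> strip" for z
  proof (rule strip_bounded_by_boundary[OF contH holH _ _ z])
    fix z assume z: "z \<in> strip"
    \<comment> \<open>This bound grows with \<open>N\<close> and serves only to show that
      \<open>H\<close> is bounded on the strip; the estimate free of \<open>N\<close> comes from the
      edges.\<close>
    have "(\<Sum>k<N. cmod (P k z)) \<le> (\<Sum>k<N. calderon_norm f * calderon_norm g)"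
      unfolding P_def norm_mult using z
      by (intro sum_mono mult_mono calderon_coordinate_le f g calderon_norm_nonneg) (auto simp: reflect_strip)
    with le show "cmod (H z) \<le> (\<Sum>k<N. calderon_norm f * calderon_norm g)"
      by (rule order_trans)
  next
    fix z :: complex assume "Re z = 0 \<or> Re z = 1"
    then show "cmod (H z) \<le> calderon_norm f * calderon_norm g"
    proof
      assume z: "Re z = 0"
      have "(\<Sum>k<N. cmod (P k z)) \<le> (\<Sum>k<N. calderon_norm f * cmod (apply_bcontfun (g (1 - z)) k))"
        unfolding P_def norm_mult using z
        by (intro sum_mono mult_right_mono calderon_coordinate_le f) (auto simp: strip_def)
      also have "\<dots> \<le> calderon_norm f * calderon_norm g"
        unfolding sum_distrib_left[symmetric] using z
        by (intro mult_left_mono part g calderon_norm_nonneg f) auto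
      finally show ?thesis using le order_trans by blast
    next
      assume z: "Re z = 1"
      have "(\<Sum>k<N. cmod (P k z)) \<le> (\<Sum>k<N. cmod (apply_bcontfun (f z) k) * calderon_norm g)"
        unfolding P_def norm_mult using z
        by (intro sum_mono mult_left_mono calderon_coordinate_le g) (auto simp: strip_def)
      also have "\<dots> \<le> calderon_norm f * calderon_norm g"
        unfolding sum_distrib_right[symmetric] using z
        by (intro mult_right_mono part g calderon_norm_nonneg f) auto
      finally show ?thesis using le order_trans by blast
    qed
  qed
  have "complex_of_real (\<Sum>k<N. cmod (half_coeff m (P k))) = (\<Sum>k<N. u k * half_coeff m (P k))"
    by (simp add: uc)
  also have "\<dots> = half_coeff m H"
    unfolding H_def[abs_def] by (simp add: half_coeff_sum half_coeff_cmult holP holomorphic_intros)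
  finally have "cmod (half_coeff m H) = \<bar>\<Sum>k<N. cmod (half_coeff m (P k))\<bar>"
    by (metis norm_of_real)
  then have "(\<Sum>k<N. cmod (half_coeff m (P k))) = cmod (half_coeff m H)"
    by (simp add: sum_nonneg)
  also have "\<dots> \<le> (calderon_norm f * calderon_norm g) * 4 ^ m"
    by (rule half_coeff_bound[OF holH]) (use bH interior_subset in blast)
  finally show ?thesis
    by (simp add: P_def[abs_def] algebra_simps)
qed

section \<open>The duality pairing\<close>

definition re_coord :: "(nat \<Rightarrow> linf) \<Rightarrow> nat \<Rightarrow> nat \<Rightarrow> real" where
  "re_coord x i k = Re (apply_bcontfun (x i) k)"

lemma re_coord_rochberg: "x \<in> rochberg n \<Longrightarrow> apply_bcontfun (x i) k = of_real (re_coord x i k)"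
  by (auto simp: rochberg_iff re_coord_def)

lemma re_coord_add: "re_coord (x + y) i k = re_coord x i k + re_coord y i k"
  and re_coord_diff: "re_coord (x - y) i k = re_coord x i k - re_coord y i k"
  and re_coord_scaleR: "re_coord (r *\<^sub>R x) i k = r * re_coord x i k"
  by (simp_all add: re_coord_def plus_fun_def fun_diff_def scaleR_fun_def)

definition pair_term :: "nat \<Rightarrow> (nat \<Rightarrow> linf) \<Rightarrow> (nat \<Rightarrow> linf) \<Rightarrow> nat \<Rightarrow> real" where
  "pair_term n x y k = (\<Sum>i<n. (-1) ^ (n - Suc i) * re_coord x i k * re_coord y (n - Suc i) k)"

definition pairing :: "nat \<Rightarrow> (nat \<Rightarrow> linf) \<Rightarrow> (nat \<Rightarrow> linf) \<Rightarrow> real" where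
  "pairing n x y = (\<Sum>k. pair_term n x y k)"

text \<open>The \<open>k\<close>-th term of the pairing is the last Taylor coefficient of \<open>f\<^sub>k(z) g\<^sub>k(1 - z)\<close>.\<close>

lemma sum_pair_term_le:
  assumes x: "x \<in> rochberg n" and y: "y \<in> rochberg n"
  shows "(\<Sum>k<N. \<bar>pair_term n x y k\<bar>) \<le> 4 ^ n * rochberg_norm n x * rochberg_norm n y"
proof (cases n)
  case 0
  then show ?thesis
    by (simp add: pair_term_def) (metis 0 mult_nonneg_nonneg rochberg_norm_nonneg x y)
next
  case (Suc m)
  have *: "(\<Sum>k<N. \<bar>pair_term n x y k\<bar>) \<le> (4 ^ n * calderon_norm f) * calderon_norm g"
    if f: "f \<in> lifts n x" and g: "g \<in> lifts n y" for f g
  proof -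
    have C: "f \<in> calderon_space" "g \<in> calderon_space"
      using f g by (auto simp: lifts_def)
    have "half_coeff m (\<lambda>z. apply_bcontfun (f z) k * apply_bcontfun (g (1 - z)) k) = of_real (pair_term n x y k)" for k
    proof -
      have "half_coeff m (\<lambda>z. apply_bcontfun (f z) k * apply_bcontfun (g (1 - z)) k)
        = (\<Sum>i\<le>m. half_coeff i (\<lambda>z. apply_bcontfun (f z) k) * half_coeff (m - i) (\<lambda>z. apply_bcontfun (g (1 - z)) k))"
        by (rule half_coeff_mult[OF calderon_holomorphic[OF C(1)] holomorphic_reflect[OF calderon_holomorphic[OF C(2)]]])
      also have "\<dots> = (\<Sum>i\<le>m. apply_bcontfun (x i) k * ((-1) ^ (m - i) * apply_bcontfun (y (m - i)) k))"
        using f g Suc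
        by (intro sum.cong refl) (simp add: half_coeff_reflect[OF calderon_holomorphic[OF C(2)]] lifts_iff)
      also have "\<dots> = of_real (pair_term n x y k)"
        by (simp add: pair_term_def Suc re_coord_rochberg[OF x] re_coord_rochberg[OF y] lessThan_Suc_atMost mult.left_commute mult.assoc)
      finally show ?thesis .
    qed
    then have "(\<Sum>k<N. \<bar>pair_term n x y k\<bar>) \<le> 4 ^ m * calderon_norm f * calderon_norm g"
      using calderon_pairing[OF C, where N = N and m = m] by simp
    \<comment> \<open>The exponent is relaxed from \<open>n - 1\<close> to \<open>n\<close>, so that
      the bound has the same form for \<open>n = 0\<close>.\<close>
    also have "\<dots> \<le> 4 ^ n * calderon_norm f * calderon_norm g"
      using C by (intro mult_right_mono calderon_norm_nonneg) (auto simp: Suc)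
    finally show ?thesis .
  qed
  have "(\<Sum>k<N. \<bar>pair_term n x y k\<bar>) \<le> (4 ^ n * rochberg_norm n y) * calderon_norm f" if f: "f \<in> lifts n x" for f
    using rochberg_norm_greatest[OF y _ *[OF f]] f
    by (simp add: lifts_def calderon_norm_nonneg mult.assoc mult.left_commute mult.commute)
  from rochberg_norm_greatest[OF x _ this] show ?thesis
    by (simp add: rochberg_norm_nonneg[OF y] mult_ac)
qed

lemma summable_pair_term:
  assumes "x \<in> rochberg n" "y \<in> rochberg n"
  shows "summable (\<lambda>k. \<bar>pair_term n x y k\<bar>)" and "summable (pair_term n x y)"
proof -
  show 1: "summable (\<lambda>k. \<bar>pair_term n x y k\<bar>)"
    by (rule bounded_imp_summable[OF _ sum_pair_term_le[OF assms, of "Suc _", unfolded lessThan_Suc_atMost]]) simp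
  show "summable (pair_term n x y)"
    by (rule summable_rabs_cancel[OF 1])
qed

lemma pairing_le:
  assumes "x \<in> rochberg n" "y \<in> rochberg n"
  shows "\<bar>pairing n x y\<bar> \<le> 4 ^ n * rochberg_norm n x * rochberg_norm n y"
  unfolding pairing_def
  by (rule order_trans[OF summable_rabs[OF summable_pair_term(1)[OF assms]]
        suminf_le_const[OF summable_pair_term(1)[OF assms] sum_pair_term_le[OF assms]]])

lemma pairing_add_right:
  assumes "x \<in> rochberg n" "y \<in> rochberg n" "y' \<in> rochberg n"
  shows "pairing n x (y + y') = pairing n x y + pairing n x y'"
proof -
  have "pair_term n x (y + y') = (\<lambda>k. pair_term n x y k + pair_term n x y' k)"
    by (simp add: fun_eq_iff pair_term_def re_coord_add algebra_simps sum.distrib)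
  then show ?thesis
    by (simp add: pairing_def suminf_add summable_pair_term assms)
qed

lemma pairing_scale_right:
  assumes "x \<in> rochberg n" "y \<in> rochberg n"
  shows "pairing n x (r *\<^sub>R y) = r * pairing n x y"
proof -
  have "pair_term n x (r *\<^sub>R y) = (\<lambda>k. r * pair_term n x y k)"
    by (simp add: fun_eq_iff pair_term_def re_coord_scaleR algebra_simps sum_distrib_left)
  then show ?thesis
    by (simp add: pairing_def suminf_mult summable_pair_term assms)
qed

text \<open>Reversing the order of summation exchanges \<open>i\<close> with
  \<open>n - 1 - i\<close>, and the signs \<open>(-1) ^ i\<close> and
  \<open>(-1) ^ (n - 1 - i)\<close> differ by the factor \<open>(-1) ^ (n - 1)\<close>.\<close>

lemma pair_term_swap: "pair_term n y x k = (-1) ^ (n - 1) * pair_term n x y k"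
proof -
  have "pair_term n y x k = (\<Sum>i<n. (-1) ^ (n - Suc (n - Suc i)) * re_coord y (n - Suc i) k * re_coord x (n - Suc (n - Suc i)) k)"
    unfolding pair_term_def by (rule sum.nat_diff_reindex[symmetric])
  also have "\<dots> = (\<Sum>i<n. (-1) ^ (n - 1) * ((-1) ^ (n - Suc i) * re_coord x i k * re_coord y (n - Suc i) k))"
  proof (rule sum.cong[OF refl])
    fix i assume "i \<in> {..<n}"
    then have "n - Suc (n - Suc i) = i" and e: "n - 1 = i + (n - Suc i)" by auto
    moreover have "(-1::real) ^ (n - 1) * (-1) ^ (n - Suc i) = (-1) ^ i"
      unfolding e power_add by (simp flip: power_mult_distrib add: mult.assoc)
    ultimately show "(-1) ^ (n - Suc (n - Suc i)) * re_coord y (n - Suc i) k * re_coord x (n - Suc (n - Suc i)) k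
        = (-1) ^ (n - 1) * ((-1) ^ (n - Suc i) * re_coord x i k * re_coord y (n - Suc i) k)"
      by (simp add: mult.commute mult.left_commute mult.assoc)
  qed
  finally show ?thesis by (simp add: pair_term_def sum_distrib_left)
qed

lemma pairing_swap:
  "x \<in> rochberg n \<Longrightarrow> y \<in> rochberg n \<Longrightarrow> pairing n y x = (-1) ^ (n - 1) * pairing n x y"
  by (simp add: pairing_def pair_term_swap[of n y x] suminf_mult summable_pair_term)

lemma pairing_add_left:
  "x \<in> rochberg n \<Longrightarrow> x' \<in> rochberg n \<Longrightarrow> y \<in> rochberg n \<Longrightarrow>
    pairing n (x + x') y = pairing n x y + pairing n x' y"
  using pairing_swap[of y n "x + x'"] pairing_swap[of y n x] pairing_swap[of y n x']
    pairing_add_right[of y n x x'] by (simp add: rochberg_add distrib_left)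

lemma pairing_scale_left:
  "x \<in> rochberg n \<Longrightarrow> y \<in> rochberg n \<Longrightarrow> pairing n (r *\<^sub>R x) y = r * pairing n x y"
  using pairing_swap[of y n "r *\<^sub>R x"] pairing_swap[of y n x] pairing_scale_right[of y n x r]
  by (simp add: rochberg_scale_le)

lemma pairing_diff_right:
  assumes "x \<in> rochberg n" "y \<in> rochberg n" "y' \<in> rochberg n"
  shows "pairing n x (y - y') = pairing n x y - pairing n x y'"
  using pairing_add_right[of x n y "-1 *\<^sub>R y'"] pairing_scale_right[of x n y' "-1"]
    rochberg_scale_le(1)[of y' n "-1"] assms by simp

text \<open>Pair a lift with itself at order 0: at the fixed point 1/2 the product of
  \<open>f(z)\<close> and \<open>f(1 - z)\<close> in coordinate \<open>k\<close> is the square of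
  the entry. So \<open>x -> x 0\<close> maps contractively into \<open>l2\<close>.\<close>

lemma rochberg_square_summable:
  assumes x: "x \<in> rochberg (Suc n)"
  shows "summable (\<lambda>k. (re_coord x 0 k)\<^sup>2)" and "(\<Sum>k. (re_coord x 0 k)\<^sup>2) \<le> (rochberg_norm (Suc n) x)\<^sup>2"
proof -
  have le: "(\<Sum>k<N. (re_coord x 0 k)\<^sup>2) \<le> (rochberg_norm (Suc n) x)\<^sup>2" for N
  proof -
    have "sqrt (\<Sum>k<N. (re_coord x 0 k)\<^sup>2) \<le> 1 * rochberg_norm (Suc n) x"
    proof (rule rochberg_norm_greatest[OF x])
      fix f assume f: "f \<in> lifts (Suc n) x"
      then have C: "f \<in> calderon_space" by (simp add: lifts_def)
      have "apply_bcontfun (f (1/2)) k = of_real (re_coord x 0 k)" for k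
        using f[unfolded lifts_iff] re_coord_rochberg[OF x, of 0 k] by (metis half_coeff_0 zero_less_Suc)
      then have "cmod (half_coeff 0 (\<lambda>z. apply_bcontfun (f z) k * apply_bcontfun (f (1 - z)) k)) = (re_coord x 0 k)\<^sup>2" for k
        by (simp add: norm_mult power2_eq_square)
      then have "(\<Sum>k<N. (re_coord x 0 k)\<^sup>2) \<le> (calderon_norm f)\<^sup>2"
        using calderon_pairing[OF C C, where N = N and m = 0] by (simp add: power2_eq_square)
      then show "sqrt (\<Sum>k<N. (re_coord x 0 k)\<^sup>2) \<le> 1 * calderon_norm f"
        using calderon_norm_nonneg[OF C] by (simp add: real_le_lsqrt)
    qed simp
    then show ?thesis
      using sqrt_le_D by simp
  qed
  show s: "summable (\<lambda>k. (re_coord x 0 k)\<^sup>2)"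
    by (rule bounded_imp_summable[OF _ le[of "Suc _", unfolded lessThan_Suc_atMost]]) simp
  show "(\<Sum>k. (re_coord x 0 k)\<^sup>2) \<le> (rochberg_norm (Suc n) x)\<^sup>2"
    by (rule suminf_le_const[OF s le])
qed


section \<open>Shifting tuples\<close>

text \<open>A zero of order \<open>m\<close> kills all lower Taylor coefficients; the Leibniz rule
  peels off one factor \<open>A\<close> at a time.\<close>

lemma half_coeff_power_mult_eq_0:
  assumes A: "A holomorphic_on interior strip" "A (1/2) = 0"
    and G: "G holomorphic_on interior strip"
  shows "i < m \<Longrightarrow> half_coeff i (\<lambda>z. A z ^ m * G z) = 0"
proof (induction m arbitrary: i)
  case (Suc m)
  have "half_coeff i (\<lambda>z. A z * (A z ^ m * G z)) = (\<Sum>j\<le>i. half_coeff j A * half_coeff (i - j) (\<lambda>z. A z ^ m * G z))"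
    by (intro half_coeff_mult holomorphic_intros A G)
  also have "\<dots> = 0"
  proof (rule sum.neutral, rule ballI)
    fix j assume "j \<in> {..i}"
    then show "half_coeff j A * half_coeff (i - j) (\<lambda>z. A z ^ m * G z) = 0"
      using Suc A(2) by (cases j) auto
  qed
  finally show ?case by (simp add: mult.assoc)
qed simp

text \<open>Multiplication by \<open>z - 1/2\<close> is not available, as it is unbounded on the strip; the multiplier
  below has the same Taylor polynomial of degree \<open>n\<close>.\<close>

lemma shift_multiplier:
  obtains q B where "q holomorphic_on UNIV" "B \<ge> 0" "\<And>z. z \<in> strip \<Longrightarrow> cmod (q z) \<le> B"
    "\<And>F i. F holomorphic_on interior strip \<Longrightarrow> i \<le> n \<Longrightarrow>
      half_coeff i (\<lambda>z. q z * F z) = (case i of 0 \<Rightarrow> 0 | Suc j \<Rightarrow> half_coeff j F)"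
proof
  \<comment> \<open>Since \<open>E (1/2) = 1\<close>, \<open>A\<close> vanishes at 1/2 and its power
    \<open>Suc n\<close> does not affect Taylor coefficients up to order \<open>n\<close>. On the
    other hand \<open>1 - A z ^ Suc n\<close> is divisible by \<open>E\<close>, whose Gaussian decay
    outweighs the growth of \<open>z - 1/2\<close>.\<close>
  define E :: "complex \<Rightarrow> complex" where "E z = exp ((z - 1/2)\<^sup>2)" for z
  define A where "A z = 1 - E z" for z
  define q where "q z = (z - 1/2) * (1 - A z ^ Suc n)" for z
  have holA: "A holomorphic_on S" for S
    unfolding A_def[abs_def] E_def by (intro holomorphic_intros)
  show "q holomorphic_on UNIV"
    unfolding q_def[abs_def] by (intro holomorphic_intros holA)
  \<comment> \<open>The factor \<open>2 * exp 1\<close> bounds the product of \<open>z - 1/2\<close>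
    and \<open>E z\<close>; the geometric sum bounds the cofactor of \<open>E\<close> in
    \<open>1 - A z ^ Suc n\<close>, as \<open>A\<close> has modulus at most
    \<open>1 + exp 1\<close>.\<close>
  show "0 \<le> 2 * exp 1 * (\<Sum>j<Suc n. (1 + exp 1 :: real) ^ j)"
    by (intro mult_nonneg_nonneg sum_nonneg) (auto intro: add_nonneg_nonneg)
  show "cmod (q z) \<le> 2 * exp 1 * (\<Sum>j<Suc n. (1 + exp 1) ^ j)" if z: "z \<in> strip" for z
  proof -
    define x y where "x = Re z - 1/2" and "y = \<bar>Im z\<bar>"
    have x: "\<bar>x\<bar> \<le> 1/2" and y: "y \<ge> 0"
      using z by (auto simp: strip_def x_def y_def abs_if)
    have "x\<^sup>2 \<le> (1/2)\<^sup>2"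
      using x abs_le_square_iff[of x "1/2"] by simp
    then have x2: "x\<^sup>2 \<le> 1"
      by (simp add: power2_eq_square)
    have normE: "cmod (E z) = exp (x\<^sup>2 - y\<^sup>2)"
      by (simp add: E_def x_def y_def power2_eq_square)
    have E1: "cmod (E z) \<le> exp 1"
    proof -
      have "x\<^sup>2 - y\<^sup>2 \<le> 1" using x2 zero_le_power2[of y] by linarith
      then show ?thesis by (simp add: normE)
    qed
    have E2: "cmod (E z) \<le> exp 1 * exp (- y\<^sup>2)"
      unfolding normE exp_add[symmetric] using x2 by simp
    have 2: "2 * y \<le> 1 + y\<^sup>2"
      using zero_le_power2[of "y - 1"] by (simp add: power2_eq_square algebra_simps)
    have "cmod (z - 1/2) \<le> \<bar>x\<bar> + y"
      using cmod_le[of "z - 1/2"] by (simp add: x_def y_def)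
    also have "\<dots> \<le> 2 * (1 + y\<^sup>2)"
      using x 2 zero_le_power2[of y] by argo
    also have "\<dots> \<le> 2 * exp (y\<^sup>2)"
      by (intro mult_left_mono exp_ge_add_one_self) simp
    finally have "cmod (z - 1/2) * cmod (E z) \<le> 2 * exp (y\<^sup>2) * (exp 1 * exp (- y\<^sup>2))"
      using E2 by (intro mult_mono) auto
    also have "\<dots> = 2 * exp 1"
      by (simp add: exp_minus)
    finally have wE: "cmod (z - 1/2) * cmod (E z) \<le> 2 * exp 1" .
    have normA: "cmod (A z) \<le> 1 + exp 1"
      unfolding A_def using norm_triangle_ineq4[of 1 "E z"] E1 by simp
    have "1 - A z ^ Suc n = E z * (\<Sum>j<Suc n. A z ^ j)"
      using one_diff_power_eq[of "A z" "Suc n"] by (simp add: A_def)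
    then have "cmod (q z) = (cmod (z - 1/2) * cmod (E z)) * cmod (\<Sum>j<Suc n. A z ^ j)"
      by (simp only: q_def norm_mult mult.assoc)
    also have "\<dots> \<le> 2 * exp 1 * (\<Sum>j<Suc n. (1 + exp 1) ^ j)"
    proof (rule mult_mono[OF wE])
      show "cmod (\<Sum>j<Suc n. A z ^ j) \<le> (\<Sum>j<Suc n. (1 + exp 1) ^ j)"
        by (rule order_trans[OF norm_sum], rule sum_mono) (simp add: norm_power normA power_mono)
    qed auto
    finally show ?thesis .
  qed
  show "half_coeff i (\<lambda>z. q z * F z) = (case i of 0 \<Rightarrow> 0 | Suc j \<Rightarrow> half_coeff j F)"
    if F: "F holomorphic_on interior strip" and i: "i \<le> n" for F i
  proof -
    have "(\<lambda>z. q z * F z) = (\<lambda>z. (z - 1/2) * F z + (-1) * (A z ^ Suc n * ((z - 1/2) * F z)))"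
      by (simp add: q_def fun_eq_iff algebra_simps)
    then have "half_coeff i (\<lambda>z. q z * F z) = half_coeff i (\<lambda>z. (z - 1/2) * F z + (-1) * (A z ^ Suc n * ((z - 1/2) * F z)))"
      by (simp only:)
    also have "\<dots> = half_coeff i (\<lambda>z. (z - 1/2) * F z) + half_coeff i (\<lambda>z. (-1) * (A z ^ Suc n * ((z - 1/2) * F z)))"
      by (intro half_coeff_add holomorphic_intros holA F)
    also have "half_coeff i (\<lambda>z. (-1) * (A z ^ Suc n * ((z - 1/2) * F z))) = (-1) * half_coeff i (\<lambda>z. A z ^ Suc n * ((z - 1/2) * F z))"
      by (intro half_coeff_cmult holomorphic_intros holA F)
    also have "half_coeff i (\<lambda>z. A z ^ Suc n * ((z - 1/2) * F z)) = 0"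
      by (rule half_coeff_power_mult_eq_0) (use i in \<open>auto intro!: holomorphic_intros holA F simp: A_def E_def\<close>)
    also have "half_coeff i (\<lambda>z. (z - 1/2) * F z) = (case i of 0 \<Rightarrow> 0 | Suc j \<Rightarrow> half_coeff j F)"
      by (simp add: half_coeff_shift F split: nat.split)
    finally show ?thesis by simp
  qed
qed

text \<open>The injection in the exact sequence, induced by multiplying lifts with the shift
  multiplier.\<close>

lemma rochberg_shift:
  obtains C where "C \<ge> 0"
    "\<And>x. x \<in> rochberg n \<Longrightarrow> case_nat 0 x \<in> rochberg (Suc n)"
    "\<And>x. x \<in> rochberg n \<Longrightarrow> rochberg_norm (Suc n) (case_nat 0 x) \<le> C * rochberg_norm n x"
proof -
  obtain q B where q: "q holomorphic_on UNIV" and B: "B \<ge> 0" "\<And>z. z \<in> strip \<Longrightarrow> cmod (q z) \<le> B"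
    and tcq: "\<And>F i. F holomorphic_on interior strip \<Longrightarrow> i \<le> n \<Longrightarrow>
      half_coeff i (\<lambda>z. q z * F z) = (case i of 0 \<Rightarrow> 0 | Suc j \<Rightarrow> half_coeff j F)"
    using shift_multiplier[of n] by blast
  have lift: "\<exists>g\<in>lifts (Suc n) (case_nat 0 x). calderon_norm g \<le> B * calderon_norm f"
    if f: "f \<in> lifts n x" for f x
  proof
    have fC: "f \<in> calderon_space" using f by (simp add: lifts_def)
    let ?g = "\<lambda>z. scaleC_linf (q z) (f z)"
    show "calderon_norm ?g \<le> B * calderon_norm f"
      by (rule calderon_mult(2)[OF fC q B(2)])
    have "?g \<in> calderon_space"
      by (rule calderon_mult(1)[OF fC q B(2)])
    then show "?g \<in> lifts (Suc n) (case_nat 0 x)"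
      using f by (auto simp: lifts_iff apply_scaleC_linf tcq calderon_holomorphic[OF fC] split: nat.split)
  qed
  have zero: "case_nat 0 x i = 0" if "x \<in> rochberg n" "i \<ge> Suc n" for x and i
    using that by (auto simp: rochberg_iff split: nat.split)
  have real: "apply_bcontfun (case_nat 0 x i) k \<in> \<real>" if "x \<in> rochberg n" for x i k
    using that by (auto simp: rochberg_iff split: nat.split)
  show ?thesis
    by (rule that[OF B(1)]; rule rochberg_transfer[OF _ B(1) zero real lift]; assumption)
qed

text \<open>The quotient of \<open>f\<close> by \<open>z - 1/2\<close> has a removable singularity.
  The norm is read off on the edges, where \<open>z - 1/2\<close> has modulus at least 1/2; hence
  the factor 2.\<close>

lemma calderon_divide:
  assumes f: "f \<in> calderon_space" and 0: "f (1/2) = 0"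
  obtains g where "g \<in> calderon_space" "calderon_norm g \<le> 2 * calderon_norm f"
    "\<And>i k. half_coeff i (\<lambda>z. apply_bcontfun (g z) k) = half_coeff (Suc i) (\<lambda>z. apply_bcontfun (f z) k)"
proof -
  obtain D where D: "has_complex_deriv f D (1/2)"
    using f half_in_strip unfolding calderon_space_def by auto
  \<comment> \<open>The derivative \<open>D\<close> is the value that fills the removable
    singularity continuously.\<close>
  define g where "g z = (if z = 1/2 then D else scaleC_linf (inverse (z - 1/2)) (f z))" for z
  have lim: "(g \<longlongrightarrow> D) (at (1/2))"
  proof -
    have "((\<lambda>z. norm (f z - f (1/2) - scaleC_linf (z - 1/2) D) / norm (z - 1/2)) \<longlongrightarrow> 0) (at (1/2))"
      using D unfolding has_complex_deriv_def has_derivative_iff_norm by simp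
    moreover have "norm (g z - D) \<le> norm (f z - f (1/2) - scaleC_linf (z - 1/2) D) / norm (z - 1/2)"
      if "z \<noteq> 1/2" for z
    proof -
      have "g z - D = scaleC_linf (inverse (z - 1/2)) (f z - f (1/2) - scaleC_linf (z - 1/2) D)"
        using that 0 by (intro bcontfun_eqI) (simp add: g_def apply_scaleC_linf field_simps)
      then have "norm (g z - D) \<le> inverse (cmod (z - 1/2)) * norm (f z - f (1/2) - scaleC_linf (z - 1/2) D)"
        using norm_scaleC_linf_le[of "inverse (z - 1/2)"] by (simp only: norm_inverse)
      then show ?thesis
        by (simp only: divide_inverse mult.commute)
    qed
    ultimately have "((\<lambda>z. g z - D) \<longlongrightarrow> 0) (at (1/2))"
      by (intro Lim_null_comparison[of "\<lambda>z. g z - D"]) (auto simp: eventually_at_filter)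
    then show ?thesis
      by (rule LIM_zero_cancel)
  qed
  have cont: "continuous_on strip g"
    unfolding continuous_on_def
  proof
    fix z assume z: "z \<in> strip"
    show "(g \<longlongrightarrow> g z) (at z within strip)"
    proof (cases "z = 1/2")
      case True
      have "(g \<longlongrightarrow> D) (at (1/2) within strip)"
        using lim by (rule tendsto_within_subset) simp
      moreover have "g (1/2) = D" by (simp add: g_def)
      ultimately show ?thesis unfolding True by (simp only:)
    next
      case False
      let ?h = "\<lambda>z. scaleC_linf (inverse (z - 1/2)) (f z)"
      have "continuous_on (strip - {1/2}) ?h"
        using calderon_continuous[OF f]
        by (intro continuous_on_scaleC_linf continuous_intros) (auto intro: continuous_on_subset)
      then have "(?h \<longlongrightarrow> ?h z) (at z within strip - {1/2})"
        using z False by (simp add: continuous_on_def)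
      moreover have "at z within strip - {1/2} = at z within strip"
        by (rule at_within_nhd[of z "- {1/2}"]) (use False in auto)
      ultimately have "(?h \<longlongrightarrow> g z) (at z within strip)"
        using False by (simp add: g_def)
      then show ?thesis
        by (rule Lim_transform_within_open[of _ _ _ _ "- {1/2}"]) (use False in \<open>auto simp: g_def\<close>)
    qed
  qed
  obtain M where M: "\<And>z. z \<in> strip \<Longrightarrow> norm (f z) \<le> M"
    using calderon_bounded[OF f] by blast
  have "\<forall>\<^sub>F z in at (1/2). dist (g z) D < 1"
    using lim by (rule tendstoD) simp
  then obtain d where d: "d > 0" "\<And>z. z \<noteq> 1/2 \<Longrightarrow> dist z (1/2) < d \<Longrightarrow> dist (g z) D < 1"
    by (auto simp: eventually_at)
  have bdd: "norm (g z) \<le> max (norm D + 1) (inverse d * M)" if z: "z \<in> strip" for z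
  proof (cases "z = 1/2 \<or> dist z (1/2) < d")
    case True
    then have "dist (g z) D < 1" using d by (auto simp: g_def)
    then have "norm (g z) \<le> norm D + 1"
      using norm_triangle_ineq2[of "g z" D] by (simp add: dist_norm)
    then show ?thesis by simp
  next
    case False
    then have "norm (g z) \<le> inverse (cmod (z - 1/2)) * norm (f z)"
      using norm_scaleC_linf_le[of "inverse (z - 1/2)" "f z"] by (simp add: g_def norm_inverse)
    also have "\<dots> \<le> inverse d * M"
      using False d(1) M[OF z] by (intro mult_mono le_imp_inverse_le) (auto simp: dist_norm)
    finally show ?thesis by simp
  qed
  \<comment> \<open>Riemann's theorem: the coordinate is continuous at 1/2 and holomorphic
    elsewhere.\<close>
  have holo: "(\<lambda>z. apply_bcontfun (g z) k) holomorphic_on interior strip" for k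
  proof (rule no_isolated_singularity[of _ _ "{1/2}"])
    show "continuous_on (interior strip) (\<lambda>z. apply_bcontfun (g z) k)"
      using bounded_linear.continuous_on[OF bounded_linear_coordinate cont] interior_subset
      by (rule continuous_on_subset)
    have "(\<lambda>z. apply_bcontfun (f z) k) holomorphic_on interior strip - {1/2}"
      using calderon_holomorphic[OF f] by (rule holomorphic_on_subset) auto
    then have "(\<lambda>z. inverse (z - 1/2) * apply_bcontfun (f z) k) holomorphic_on interior strip - {1/2}"
      by (auto intro!: holomorphic_intros)
    then show "(\<lambda>z. apply_bcontfun (g z) k) holomorphic_on interior strip - {1/2}"
      by (rule holomorphic_transform) (auto simp: g_def apply_scaleC_linf)
  qed auto
  have half: "z \<noteq> 1/2 \<and> cmod (inverse (z - 1/2)) \<le> 2" if "Re z = 0 \<or> Re z = 1" for z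
  proof -
    have "1/2 \<le> cmod (z - 1/2)"
      using abs_Re_le_cmod[of "z - 1/2"] that by auto
    moreover from this have "z \<noteq> 1/2"
      by (metis diff_self norm_zero half_gt_zero_iff not_le zero_less_one)
    ultimately show ?thesis
      using le_imp_inverse_le[of "1/2" "cmod (z - 1/2)"] by (simp add: norm_inverse)
  qed
  have q: "g z = scaleC_linf (inverse (z - 1/2)) (f z)" "cmod (inverse (z - 1/2)) \<le> 2"
    if "Re z = 0 \<or> Re z = 1" for z
    using half[OF that] by (auto simp: g_def)
  have contq: "continuous_on {z. Re z = 1} (\<lambda>z. inverse (z - 1/2))"
    by (intro continuous_intros) (use half in auto)
  show ?thesis
  proof (rule that)
    show "g \<in> calderon_space" and "calderon_norm g \<le> 2 * calderon_norm f"
      by (rule calderon_multiplier[OF f cont bdd holo q(1) contq q(2)]; assumption)+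
    show "half_coeff i (\<lambda>z. apply_bcontfun (g z) k) = half_coeff (Suc i) (\<lambda>z. apply_bcontfun (f z) k)" for i k
    proof -
      have "half_coeff i (\<lambda>z. apply_bcontfun (g z) k) = half_coeff (Suc i) (\<lambda>z. (z - 1/2) * apply_bcontfun (g z) k)"
        by (rule half_coeff_shift[OF holo, symmetric])
      also have "(\<lambda>z. (z - 1/2) * apply_bcontfun (g z) k) = (\<lambda>z. apply_bcontfun (f z) k)"
      proof
        fix z show "(z - 1/2) * apply_bcontfun (g z) k = apply_bcontfun (f z) k"
        proof (cases "z = 1/2")
          case True
          show ?thesis unfolding True by (simp add: 0)
        next
          case False
          then have "z - 1/2 \<noteq> 0" by (metis right_minus_eq)
          then have "(z - 1/2) * (inverse (z - 1/2) * apply_bcontfun (f z) k) = apply_bcontfun (f z) k"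
            by (metis mult.assoc mult_1 right_inverse)
          then show ?thesis
            using False by (simp only: g_def if_False apply_scaleC_linf)
        qed
      qed
      finally show ?thesis .
    qed
  qed
qed

text \<open>Inverse of the shift on the kernel of \<open>x -> x 0\<close>. Together with
  \<open>rochberg_shift\<close> it gives exactness in the middle, with norm control.\<close>

lemma rochberg_unshift:
  assumes x: "x \<in> rochberg (Suc n)" and 0: "x 0 = 0"
  shows "(\<lambda>i. x (Suc i)) \<in> rochberg n"
    and "rochberg_norm n (\<lambda>i. x (Suc i)) \<le> 2 * rochberg_norm (Suc n) x"
proof -
  have "\<exists>g\<in>lifts n (\<lambda>i. x (Suc i)). calderon_norm g \<le> 2 * calderon_norm f"
    if f: "f \<in> lifts (Suc n) x" for f
  proof -
    have "f \<in> calderon_space" "f (1/2) = 0"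
      using f 0 by (auto simp: lifts_def taylor_coeff_def)
    then obtain g where "g \<in> calderon_space" "calderon_norm g \<le> 2 * calderon_norm f"
      "\<And>i k. half_coeff i (\<lambda>z. apply_bcontfun (g z) k) = half_coeff (Suc i) (\<lambda>z. apply_bcontfun (f z) k)"
      using calderon_divide by blast
    then show ?thesis
      using f by (auto simp: lifts_iff intro!: bexI[of _ g])
  qed
  then show "(\<lambda>i. x (Suc i)) \<in> rochberg n"
    and "rochberg_norm n (\<lambda>i. x (Suc i)) \<le> 2 * rochberg_norm (Suc n) x"
    using x by (auto intro!: rochberg_transfer[OF x] simp: rochberg_iff)
qed


section \<open>Square summable sequences\<close>

lemma higher_deriv_cmult_exp:
  "(deriv ^^ i) (\<lambda>z. c * exp (b * z)) = (\<lambda>z::complex. c * b ^ i * exp (b * z))"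
proof (induction i)
  case (Suc i)
  have "((\<lambda>z. c * b ^ i * exp (b * z)) has_field_derivative c * b ^ Suc i * exp (b * z)) (at z)" for z
    by (auto intro!: derivative_eq_intros)
  then show ?case
    by (simp add: Suc fun_eq_iff DERIV_imp_deriv)
qed simp

text \<open>The function \<open>z \<mapsto> v\<^sub>k \<bar>v\<^sub>k\<bar>\<^bsup>2z-1\<^esup>\<close> that is usually taken as lift of \<open>v\<close> is not norm
  continuous on the edges. Dividing \<open>\<bar>v\<^sub>k\<bar>\<close> by the square root of the tail \<open>t\<^sub>k = (\<Sum>j\<ge>k. v\<^sub>j\<^sup>2)\<close> makes the
  coordinates tend to 0 uniformly on the strip, while the sum of \<open>v\<^sub>k\<^sup>2 / sqrt t\<^sub>k\<close> still telescopes.\<close>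

lemma square_summable_lift:
  fixes v :: "nat \<Rightarrow> real"
  assumes v: "summable (\<lambda>k. (v k)\<^sup>2)"
  obtains f where "f \<in> calderon_space" "calderon_norm f \<le> 2 * sqrt (\<Sum>k. (v k)\<^sup>2)"
    "\<And>k. half_coeff 0 (\<lambda>z. apply_bcontfun (f z) k) = of_real (v k)"
    "\<And>i k. half_coeff i (\<lambda>z. apply_bcontfun (f z) k) \<in> \<real>"
proof -
  define S where "S = (\<Sum>k. (v k)\<^sup>2)"
  define t where "t k = S - (\<Sum>j<k. (v j)\<^sup>2)" for k
  have t0: "t 0 = S" and tSuc: "t (Suc k) = t k - (v k)\<^sup>2" for k
    by (auto simp: t_def)
  have t_nonneg: "t k \<ge> 0" for k
    unfolding t_def S_def using sum_le_suminf[OF v, of "{..<k}"] by simp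
  have t_v: "(v k)\<^sup>2 \<le> t k" for k
    using t_nonneg[of "Suc k"] tSuc[of k] by simp
  have S: "S \<ge> 0" using t_nonneg[of 0] t0 by simp
  have t_mono: "t l \<le> t k" if "k \<le> l" for k l
    by (rule lift_Suc_antimono_le[OF _ that]) (simp add: tSuc)
  have t_lim: "t \<longlonglongrightarrow> 0"
  proof -
    have "t \<longlonglongrightarrow> S - S"
      unfolding t_def[abs_def] S_def by (intro tendsto_intros summable_LIMSEQ v)
    then show ?thesis by simp
  qed
  define d where "d k = (v k)\<^sup>2 / sqrt (t k)" for k
  have d_nonneg: "d k \<ge> 0" for k
    by (simp add: d_def t_nonneg)
  \<comment> \<open>With \<open>s\<close> and \<open>r\<close> the square roots of consecutive
    tails, \<open>(v k)^2 = (s - r) * (s + r)\<close> and \<open>s + r \<le> 2 * s\<close>. Division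
    by \<open>s\<close> gives a telescoping bound.\<close>
  have d_le: "d k \<le> 2 * (sqrt (t k) - sqrt (t (Suc k)))" for k
  proof (cases "t k = 0")
    case True
    then have "v k = 0" using t_v[of k] by simp
    then show ?thesis using True by (simp add: d_def tSuc)
  next
    case False
    define s r where "s = sqrt (t k)" and "r = sqrt (t (Suc k))"
    have s: "s > 0" using False t_nonneg[of k] by (simp add: s_def)
    have "(s - r)\<^sup>2 \<ge> 0" by simp
    moreover have "s\<^sup>2 - r\<^sup>2 = (v k)\<^sup>2"
      by (simp add: s_def r_def t_nonneg) (simp add: tSuc)
    ultimately have "(v k)\<^sup>2 \<le> 2 * (s - r) * s"
      by (simp add: power2_eq_square algebra_simps)
    then show ?thesis
      using s by (simp add: d_def field_simps flip: s_def r_def)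
  qed
  have sum_d: "(\<Sum>k<N. d k) \<le> 2 * sqrt S" for N
  proof -
    have "(\<Sum>k<N. d k) \<le> 2 * (sqrt (t 0) - sqrt (t N))"
    proof (induction N)
      case (Suc N)
      then show ?case using d_le[of N] by simp
    qed simp
    then show ?thesis
      using t0 t_nonneg[of N] by (smt (verit) real_sqrt_ge_zero)
  qed
  have summable_d: "summable d"
    by (rule bounded_imp_summable[OF d_nonneg sum_d[of "Suc _", unfolded lessThan_Suc_atMost]])
  have suminf_d: "suminf d \<le> 2 * sqrt S"
    by (rule suminf_le_const[OF summable_d sum_d])
  \<comment> \<open>The coordinate function is \<open>c k * a k powr (2 * z)\<close>, written as an
    exponential: its modulus is \<open>sqrt (t k)\<close> on the left edge and \<open>d k\<close> on
    the right one, and its value at 1/2 is \<open>v k\<close>. If \<open>v k = 0\<close>, then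
    \<open>sgn 0 = 0\<close> makes it vanish and \<open>ln 0 = 0\<close> keeps
    \<open>b k \<le> 0\<close> true.\<close>
  define a where "a k = \<bar>v k\<bar> / sqrt (t k)" for k
  define b where "b k = 2 * ln (a k)" for k
  define c where "c k = sgn (v k) * sqrt (t k)" for k
  have t_pos: "t k > 0" if "v k \<noteq> 0" for k
    using that t_v[of k] by (meson less_le_trans zero_less_power2)
  have a_pos: "a k > 0" if "v k \<noteq> 0" for k
    using that t_pos by (simp add: a_def)
  have a_le: "a k \<le> 1" if "v k \<noteq> 0" for k
    using that t_pos real_sqrt_le_mono[OF t_v[of k]] by (simp add: a_def)
  have b: "b k \<le> 0" for k
  proof (cases "v k = 0")
    case False
    then show ?thesis using a_pos a_le by (simp add: b_def)
  qed (simp add: b_def a_def)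
  define F where "F k z = complex_of_real (c k) * exp (complex_of_real (b k) * z)" for k z
  have normF: "cmod (F k z) = \<bar>c k\<bar> * exp (b k * Re z)" for k z
    by (simp add: F_def norm_mult)
  have c_le: "\<bar>c k\<bar> \<le> sqrt (t k)" for k
    by (cases "v k = 0") (auto simp: c_def abs_mult sgn_if t_nonneg)
  have F_le: "cmod (F k z) \<le> sqrt (t k)" if "Re z \<ge> 0" for k z
  proof -
    have "exp (b k * Re z) \<le> 1" using b that by (simp add: mult_nonpos_nonneg)
    then have "cmod (F k z) \<le> sqrt (t k) * 1"
      unfolding normF by (intro mult_mono c_le) (auto simp: t_nonneg)
    then show ?thesis by simp
  qed
  have F_le_S: "cmod (F k z) \<le> sqrt S" if "Re z \<ge> 0" for k z
    using order_trans[OF F_le[OF that] real_sqrt_le_mono[OF t_mono[of 0 k]]] t0 by simp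
  have F_1: "cmod (F k z) = d k" if "Re z = 1" for k z
  proof (cases "v k = 0")
    case False
    define s where "s = sqrt (t k)"
    have s: "s > 0" using t_pos[OF False] by (simp add: s_def)
    have "exp (b k) = exp (ln (a k)) * exp (ln (a k))"
      unfolding b_def mult_2 by (rule exp_add)
    then have "exp (b k) = (\<bar>v k\<bar> / s) * (\<bar>v k\<bar> / s)"
      using a_pos[OF False] by (simp add: a_def s_def)
    moreover have "\<bar>c k\<bar> = s"
      using False s by (simp add: c_def abs_mult s_def abs_sgn_eq)
    ultimately show ?thesis
      using s by (simp add: normF that d_def power2_eq_square flip: s_def)
  qed (simp add: normF c_def d_def)
  have F_half: "F k (1/2) = of_real (v k)" for k
  proof (cases "v k = 0")
    case False
    have "exp (complex_of_real (b k) * (1/2)) = of_real (exp (ln (a k)))"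
      unfolding exp_of_real[symmetric] by (simp add: b_def)
    also have "\<dots> = of_real (a k)"
      using a_pos[OF False] by simp
    finally have "F k (1/2) = of_real (c k * a k)"
      by (simp add: F_def)
    also have "c k * a k = v k"
      using t_pos[OF False] by (simp add: c_def a_def sgn_if)
    finally show ?thesis .
  qed (simp add: F_def c_def)
  have tcF: "half_coeff i (F k) \<in> \<real>" for i k
  proof -
    have "exp (complex_of_real (b k) * (1/2)) = of_real (exp (b k / 2))"
      unfolding exp_of_real[symmetric] by simp
    then have "half_coeff i (F k) = of_real (c k * b k ^ i * exp (b k / 2) / fact i)"
      unfolding half_coeff_def F_def[abs_def] higher_deriv_cmult_exp by simp
    then show ?thesis by (simp only: Reals_of_real)
  qed
  have contF: "continuous_on A (F k)" and holF: "F k holomorphic_on A" for A k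
    unfolding F_def[abs_def] by (intro continuous_intros holomorphic_intros)+
  \<comment> \<open>For negative real part the coordinates need not be bounded and
    \<open>Bcontfun\<close> may be unspecified; membership in \<open>calderon_space\<close> concerns
    values on the strip.\<close>
  define f where "f z = (Bcontfun (\<lambda>k. F k z) :: linf)" for z
  have apply_f: "apply_bcontfun (f z) k = F k z" if "Re z \<ge> 0" for z k
    unfolding f_def by (rule apply_Bcontfun_nat[OF F_le_S[OF that]])
  have in1: "in_l1 (f z)" and l1: "l1_norm (f z) \<le> 2 * sqrt S" if "Re z = 1" for z
    using that summable_d suminf_d by (auto simp: in_l1_def l1_norm_def apply_f F_1)
  have cont: "continuous_on strip f"
    unfolding continuous_on_iff
  proof (intro ballI allI impI)
    fix z and e :: real assume z: "z \<in> strip" and e: "e > 0"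
    \<comment> \<open>From \<open>K\<close> on all coordinates are below \<open>e / 4\<close> on the
      whole strip; finitely many continuous ones remain.\<close>
    have "(\<lambda>k. sqrt (t k)) \<longlonglongrightarrow> sqrt 0"
      by (intro tendsto_intros t_lim)
    then have "\<forall>\<^sub>F k in sequentially. sqrt (t k) < e / 4"
      using e by (intro order_tendstoD) auto
    then obtain K where K: "\<And>k. k \<ge> K \<Longrightarrow> sqrt (t k) < e / 4"
      by (auto simp: eventually_sequentially)
    have "\<forall>\<^sub>F w in at z within strip. \<forall>k\<in>{..<K}. dist (F k w) (F k z) < e / 2"
      using contF[of strip] z e
      by (intro eventually_ball_finite ballI tendstoD) (auto simp: continuous_on_def)
    then obtain \<delta> where \<delta>: "\<delta> > 0" "\<And>w k. w \<in> strip \<Longrightarrow> w \<noteq> z \<Longrightarrow> dist w z < \<delta> \<Longrightarrow> k < K \<Longrightarrow> dist (F k w) (F k z) < e / 2"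
      unfolding eventually_at by auto
    have "dist (f w) (f z) < e" if w: "w \<in> strip" "dist w z < \<delta>" for w
    proof -
      have "dist (apply_bcontfun (f w) k) (apply_bcontfun (f z) k) \<le> e / 2" for k
      proof (cases "k < K")
        case True
        then show ?thesis
          using \<delta>(2)[OF w(1) _ w(2) True] z w e
          by (cases "w = z") (auto simp: apply_f strip_def less_imp_le)
      next
        case False
        have "dist (F k w) (F k z) \<le> cmod (F k w) + cmod (F k z)"
          by (simp add: dist_norm norm_triangle_ineq4)
        also have "\<dots> \<le> e / 4 + e / 4"
          using F_le[of w k] F_le[of z k] K[of k] False z w by (intro add_mono) (auto simp: strip_def)
        finally show ?thesis
          using z w by (simp add: apply_f strip_def)
      qed
      then have "dist (f w) (f z) \<le> e / 2" by (rule dist_bound)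
      then show ?thesis using e by simp
    qed
    then show "\<exists>\<delta>>0. \<forall>w\<in>strip. dist w z < \<delta> \<longrightarrow> dist (f w) (f z) < e"
      using \<delta>(1) by blast
  qed
  have fC: "f \<in> calderon_space"
  proof (rule calderonI[OF cont])
    show "norm (f z) \<le> sqrt S" if "z \<in> strip" for z
      using that F_le_S by (intro norm_bound) (auto simp: apply_f strip_def)
    show "(\<lambda>z. apply_bcontfun (f z) k) holomorphic_on interior strip" for k
      by (rule holomorphic_transform[OF holF]) (auto simp: apply_f interior_strip)
    show "in_l1 (f (1 + \<i> * of_real x))" and "l1_norm (f (1 + \<i> * of_real x)) \<le> 2 * sqrt S" for x
      by (auto intro: in1 l1)
    fix x
    \<comment> \<open>Continuity in the l1 norm on the right edge follows from the Weierstrass test: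
      there the coordinates have the constant moduli \<open>d k\<close>, so \<open>2 * d k\<close>
      majorizes the differences.\<close>
    define \<phi> where "\<phi> k y = cmod (F k (1 + \<i> * of_real y) - F k (1 + \<i> * of_real x))" for k and y :: real
    have unif: "uniform_limit UNIV (\<lambda>N y. \<Sum>k<N. \<phi> k y) (\<lambda>y. \<Sum>k. \<phi> k y) sequentially"
    proof (rule Weierstrass_m_test)
      show "norm (\<phi> k y) \<le> 2 * d k" for k y
        using norm_triangle_ineq4[of "F k (1 + \<i> * of_real y)" "F k (1 + \<i> * of_real x)"]
        by (simp add: \<phi>_def F_1)
      show "summable (\<lambda>k. 2 * d k)"
        by (intro summable_mult summable_d)
    qed
    have "continuous_on UNIV (\<phi> k)" for k
      unfolding \<phi>_def[abs_def]
      by (intro continuous_intros continuous_on_compose2[OF contF[of UNIV]]) auto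
    then have "\<forall>\<^sub>F N in sequentially. continuous_on UNIV (\<lambda>y. \<Sum>k<N. \<phi> k y)"
      by (intro always_eventually allI continuous_on_sum) auto
    then have "continuous_on UNIV (\<lambda>y. \<Sum>k. \<phi> k y)"
      by (rule uniform_limit_theorem[OF _ unif]) simp
    then have "((\<lambda>y. \<Sum>k. \<phi> k y) \<longlongrightarrow> (\<Sum>k. \<phi> k x)) (at x)"
      by (simp add: continuous_on_def)
    then show "((\<lambda>y. l1_norm (f (1 + \<i> * of_real y) - f (1 + \<i> * of_real x))) \<longlongrightarrow> 0) (at x)"
      by (simp add: l1_norm_def \<phi>_def apply_f)
  qed
  show ?thesis
  proof (rule that[OF fC])
    show "calderon_norm f \<le> 2 * sqrt (\<Sum>k. (v k)\<^sup>2)"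
      unfolding S_def[symmetric]
    proof (rule calderon_normI)
      show "norm (f z) \<le> 2 * sqrt S" if "Re z = 0" for z
      proof -
        have "norm (f z) \<le> sqrt S"
          using that F_le_S[of z] by (intro norm_bound) (simp add: apply_f)
        then show ?thesis using S by (smt (verit) real_sqrt_ge_zero)
      qed
      show "l1_norm (f z) \<le> 2 * sqrt S" if "Re z = 1" for z
        using that by (rule l1)
    qed
    have tcf: "half_coeff i (\<lambda>z. apply_bcontfun (f z) k) = half_coeff i (F k)" for i k
      by (rule half_coeff_cong[OF calderon_holomorphic[OF fC]]) (simp add: apply_f interior_strip)
    show "half_coeff 0 (\<lambda>z. apply_bcontfun (f z) k) = of_real (v k)" for k
      by (simp only: tcf half_coeff_0 F_half)
    show "half_coeff i (\<lambda>z. apply_bcontfun (f z) k) \<in> \<real>" for i k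
      by (simp only: tcf tcF)
  qed
qed

text \<open>Surjectivity of \<open>x -> x 0\<close> onto \<open>l2\<close>. One lift serves all
  orders, and since all its Taylor coefficients are real, the resulting tuple lies in the real
  space.\<close>

lemma square_summable_rochberg:
  fixes v :: "nat \<Rightarrow> real"
  assumes v: "summable (\<lambda>k. (v k)\<^sup>2)"
  obtains x where "x \<in> rochberg (Suc n)" "rochberg_norm (Suc n) x \<le> 2 * sqrt (\<Sum>k. (v k)\<^sup>2)"
    "re_coord x 0 = v"
proof -
  obtain f where f: "f \<in> calderon_space" "calderon_norm f \<le> 2 * sqrt (\<Sum>k. (v k)\<^sup>2)"
    "\<And>k. half_coeff 0 (\<lambda>z. apply_bcontfun (f z) k) = of_real (v k)"
    "\<And>i k. half_coeff i (\<lambda>z. apply_bcontfun (f z) k) \<in> \<real>"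
    using square_summable_lift[OF v] by blast
  define x where "x i = (if i < Suc n then taylor_coeff i f else 0)" for i
  have "f \<in> lifts (Suc n) x"
    using f(1) by (simp add: lifts_def x_def)
  moreover from this have "x \<in> rochberg (Suc n)"
    using f(4) by (auto simp: rochberg_iff x_def calderon_taylor_coeff[OF f(1)])
  moreover have "re_coord x 0 = v"
    by (simp add: fun_eq_iff re_coord_def x_def calderon_taylor_coeff[OF f(1)] f(3) del: half_coeff_0)
  ultimately show ?thesis
    using that[of x] rochberg_norm_le f(2) order_trans by blast
qed

lemma square_summable_mult:
  fixes v w :: "nat \<Rightarrow> real"
  assumes "summable (\<lambda>k. (v k)\<^sup>2)" "summable (\<lambda>k. (w k)\<^sup>2)"
  shows "summable (\<lambda>k. v k * w k)"
proof (rule summable_comparison_test'[OF summable_add[OF assms]])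
  fix k
  have "0 \<le> \<bar>v k\<bar> * \<bar>w k\<bar>" by simp
  moreover have "2 * \<bar>v k\<bar> * \<bar>w k\<bar> \<le> (v k)\<^sup>2 + (w k)\<^sup>2"
    using sum_squares_bound[of "\<bar>v k\<bar>" "\<bar>w k\<bar>"] by simp
  ultimately show "norm (v k * w k) \<le> (v k)\<^sup>2 + (w k)\<^sup>2"
    unfolding real_norm_def abs_mult by argo
qed

text \<open>The representing sequence consists of the values on unit vectors. Testing the functional
  on truncations of that sequence bounds its norm by \<open>K\<close>; density of finite sequences
  gives the representation.\<close>

lemma square_summable_riesz:
  fixes \<psi> :: "(nat \<Rightarrow> real) \<Rightarrow> real"
  assumes diff: "\<And>u v. summable (\<lambda>k. (u k)\<^sup>2) \<Longrightarrow> summable (\<lambda>k. (v k)\<^sup>2) \<Longrightarrow> \<psi> (\<lambda>k. u k - v k) = \<psi> u - \<psi> v"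
    and scale: "\<And>r v. summable (\<lambda>k. (v k)\<^sup>2) \<Longrightarrow> \<psi> (\<lambda>k. r * v k) = r * \<psi> v"
    and bound: "\<And>v. summable (\<lambda>k. (v k)\<^sup>2) \<Longrightarrow> \<bar>\<psi> v\<bar> \<le> K * sqrt (\<Sum>k. (v k)\<^sup>2)"
    and K: "K \<ge> 0"
  obtains w where "summable (\<lambda>k. (w k)\<^sup>2)" "sqrt (\<Sum>k. (w k)\<^sup>2) \<le> K"
    "\<And>v. summable (\<lambda>k. (v k)\<^sup>2) \<Longrightarrow> \<psi> v = (\<Sum>k. v k * w k)"
proof -
  define e where "e j k = (if k = j then 1 else 0 :: real)" for j k :: nat
  define w where "w j = \<psi> (e j)" for j
  define cut where "cut N v k = (if k < N then v k else 0)" for N k and v :: "nat \<Rightarrow> real"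
  have sum_cut: "summable (\<lambda>k. (cut N v k)\<^sup>2)" for N v
    by (rule summable_finite[of "{..<N}"]) (auto simp: cut_def)
  have suminf_cut: "(\<Sum>k. (cut N v k)\<^sup>2) = (\<Sum>k<N. (v k)\<^sup>2)" for N v
    using suminf_finite[of "{..<N}" "\<lambda>k. (cut N v k)\<^sup>2"] by (auto simp: cut_def)
  have sum_e: "summable (\<lambda>k. (e j k)\<^sup>2)" for j
    by (rule summable_finite[of "{j}"]) (auto simp: e_def)
  have \<psi>_cut: "\<psi> (cut N v) = (\<Sum>k<N. v k * w k)" for N v
  proof (induction N)
    case 0
    have "\<psi> (\<lambda>k. 0 * cut 0 v k) = 0 * \<psi> (cut 0 v)"
      by (rule scale[OF sum_cut])
    then show ?case by (simp add: cut_def[abs_def])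
  next
    case (Suc N)
    have "cut N v = (\<lambda>k. cut (Suc N) v k - v N * e N k)"
      by (auto simp: cut_def e_def fun_eq_iff less_Suc_eq)
    then have "\<psi> (cut N v) = \<psi> (\<lambda>k. cut (Suc N) v k - v N * e N k)"
      by (rule arg_cong)
    also have "\<dots> = \<psi> (cut (Suc N) v) - \<psi> (\<lambda>k. v N * e N k)"
      by (rule diff[OF sum_cut]) (simp add: power_mult_distrib summable_mult sum_e)
    also have "\<psi> (\<lambda>k. v N * e N k) = v N * w N"
      by (simp add: scale sum_e w_def)
    finally show ?case using Suc by simp
  qed
  have w_le: "(\<Sum>k<N. (w k)\<^sup>2) \<le> K\<^sup>2" for N
  proof -
    define s where "s = sqrt (\<Sum>k<N. (w k)\<^sup>2)"
    have s2: "(\<Sum>k<N. (w k)\<^sup>2) = s\<^sup>2" and s: "s \<ge> 0"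
      by (simp_all add: s_def sum_nonneg)
    have "s\<^sup>2 = \<psi> (cut N w)"
      unfolding \<psi>_cut s2[symmetric] by (simp add: power2_eq_square)
    also have "\<dots> \<le> K * s"
      using bound[OF sum_cut[of N w]] by (simp add: suminf_cut s2 s)
    finally have "s \<le> K"
      using s K by (cases "s = 0") (auto simp: power2_eq_square)
    then show ?thesis unfolding s2 using s by (rule power_mono)
  qed
  have sum_w: "summable (\<lambda>k. (w k)\<^sup>2)"
    by (rule bounded_imp_summable[OF _ w_le[of "Suc _", unfolded lessThan_Suc_atMost]]) simp
  show ?thesis
  proof (rule that[OF sum_w])
    show "sqrt (\<Sum>k. (w k)\<^sup>2) \<le> K"
      using suminf_le_const[OF sum_w w_le] K by (simp add: real_le_lsqrt suminf_nonneg sum_w)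
    fix v :: "nat \<Rightarrow> real" assume v: "summable (\<lambda>k. (v k)\<^sup>2)"
    define S where "S = (\<Sum>k. (v k)\<^sup>2)"
    \<comment> \<open>The left side is the value of the functional on the tail of \<open>v\<close>,
      so it is bounded by \<open>K\<close> times the norm of that tail.\<close>
    have "\<bar>(\<Sum>k<N. v k * w k) - \<psi> v\<bar> \<le> K * sqrt (S - (\<Sum>k<N. (v k)\<^sup>2))" for N
    proof -
      have tail: "(\<lambda>k. (v k - cut N v k)\<^sup>2) = (\<lambda>k. (v k)\<^sup>2 - (cut N v k)\<^sup>2)"
        by (auto simp: cut_def)
      have "summable (\<lambda>k. (v k - cut N v k)\<^sup>2)"
        unfolding tail by (intro summable_diff v sum_cut)
      moreover have "(\<Sum>k. (v k - cut N v k)\<^sup>2) = S - (\<Sum>k<N. (v k)\<^sup>2)"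
        unfolding tail S_def suminf_cut[symmetric] by (rule suminf_diff[symmetric, OF v sum_cut])
      ultimately have "\<bar>\<psi> (\<lambda>k. v k - cut N v k)\<bar> \<le> K * sqrt (S - (\<Sum>k<N. (v k)\<^sup>2))"
        using bound by metis
      then show ?thesis
        by (simp add: diff[OF v sum_cut] \<psi>_cut abs_minus_commute)
    qed
    then have le: "\<forall>\<^sub>F N in sequentially. norm ((\<Sum>k<N. v k * w k) - \<psi> v) \<le> K * sqrt (S - (\<Sum>k<N. (v k)\<^sup>2))"
      by simp
    have "(\<lambda>N. K * sqrt (S - (\<Sum>k<N. (v k)\<^sup>2))) \<longlonglongrightarrow> K * sqrt (S - S)"
      unfolding S_def by (intro tendsto_intros summable_LIMSEQ v)
    then have "(\<lambda>N. K * sqrt (S - (\<Sum>k<N. (v k)\<^sup>2))) \<longlonglongrightarrow> 0"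
      by simp
    with le have "(\<lambda>N. (\<Sum>k<N. v k * w k) - \<psi> v) \<longlonglongrightarrow> 0"
      by (rule Lim_null_comparison)
    then have "(\<lambda>k. v k * w k) sums \<psi> v"
      unfolding sums_def by (rule LIM_zero_cancel)
    then show "\<psi> v = (\<Sum>k. v k * w k)"
      by (rule sums_unique)
  qed
qed


section \<open>Representation of functionals\<close>

lemma rochberg_norm_0 [simp]: "rochberg_norm n 0 = 0"
  using rochberg_norm_scale[OF zero_rochberg, of n 0] by simp

lemma rochberg_eqI:
  assumes "x \<in> rochberg n" "y \<in> rochberg n" "\<And>i k. i < n \<Longrightarrow> re_coord x i k = re_coord y i k"
  shows "x = y"
proof
  fix i show "x i = y i"
  proof (cases "i < n")
    case True
    then show ?thesis
      using assms by (intro bcontfun_eqI) (simp add: re_coord_rochberg)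
  next
    case False
    then show ?thesis
      using assms by (simp add: rochberg_iff)
  qed
qed

lemma rochberg_coordinate_eqI:
  assumes "x \<in> rochberg n" "y \<in> rochberg m" "re_coord x i = re_coord y j"
  shows "x i = y j"
  using assms by (intro bcontfun_eqI) (simp add: re_coord_rochberg)

lemma case_nat_Suc_eq: "x 0 = 0 \<Longrightarrow> case_nat 0 (\<lambda>i. x (Suc i)) = x"
  by (simp add: fun_eq_iff split: nat.split)

lemma rochberg_square_le:
  assumes x: "x \<in> rochberg (Suc n)"
  shows "sqrt (\<Sum>k. (re_coord x 0 k)\<^sup>2) \<le> rochberg_norm (Suc n) x"
  using rochberg_square_summable[OF x] rochberg_norm_nonneg[OF x]
  by (simp add: real_le_lsqrt suminf_nonneg)

text \<open>Not immediate from the definition: the next Taylor coefficient of a lift need not be real.\<close>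

lemma rochberg_extend:
  obtains C where "C \<ge> 0"
    "\<And>x. x \<in> rochberg n \<Longrightarrow>
      \<exists>y\<in>rochberg (Suc n). (\<forall>i<n. y i = x i) \<and> rochberg_norm (Suc n) y \<le> C * rochberg_norm n x"
proof -
  have "\<exists>C\<ge>0. \<forall>x\<in>rochberg n.
      \<exists>y\<in>rochberg (Suc n). (\<forall>i<n. y i = x i) \<and> rochberg_norm (Suc n) y \<le> C * rochberg_norm n x"
  proof (induction n)
    case 0
    show ?case
      by (rule exI[of _ 0]) (auto intro!: bexI[of _ 0] zero_rochberg)
  next
    case (Suc n)
    then obtain C where C: "C \<ge> 0" "\<And>x. x \<in> rochberg n \<Longrightarrow>
        \<exists>y\<in>rochberg (Suc n). (\<forall>i<n. y i = x i) \<and> rochberg_norm (Suc n) y \<le> C * rochberg_norm n x"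
      by blast
    obtain B where B: "B \<ge> 0"
      "\<And>x. x \<in> rochberg (Suc n) \<Longrightarrow> case_nat 0 x \<in> rochberg (Suc (Suc n))"
      "\<And>x. x \<in> rochberg (Suc n) \<Longrightarrow> rochberg_norm (Suc (Suc n)) (case_nat 0 x) \<le> B * rochberg_norm (Suc n) x"
      using rochberg_shift[of "Suc n"] by blast
    \<comment> \<open>Subtract from \<open>x\<close> the truncation of a real tuple \<open>a\<close>
      with the same first entry, unshift the difference, extend it by induction, shift back and add
      \<open>a\<close>. The norms are 2 for \<open>a\<close>, 3 for the difference, 6 after
      unshifting, then the factors \<open>C\<close> and \<open>B\<close>.\<close>
    have "\<exists>y\<in>rochberg (Suc (Suc n)). (\<forall>i<Suc n. y i = x i) \<and>
        rochberg_norm (Suc (Suc n)) y \<le> (2 + B * (C * 6)) * rochberg_norm (Suc n) x"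
      if x: "x \<in> rochberg (Suc n)" for x
    proof -
      let ?N = "rochberg_norm (Suc n) x"
      obtain a where a: "a \<in> rochberg (Suc (Suc n))"
        "rochberg_norm (Suc (Suc n)) a \<le> 2 * sqrt (\<Sum>k. (re_coord x 0 k)\<^sup>2)" "re_coord a 0 = re_coord x 0"
        using square_summable_rochberg[OF rochberg_square_summable(1)[OF x]] by metis
      have Na: "rochberg_norm (Suc (Suc n)) a \<le> 2 * ?N"
        using a(2) rochberg_square_le[OF x] by simp
      define b where "b = (\<lambda>i. if i < Suc n then a i else 0)"
      have b: "b \<in> rochberg (Suc n)" "rochberg_norm (Suc n) b \<le> 2 * ?N"
        using rochberg_truncate[OF a(1)] Na by (simp_all add: b_def)
      define d where "d = x - b"
      have d: "d \<in> rochberg (Suc n)" "rochberg_norm (Suc n) d \<le> 3 * ?N"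
        using rochberg_diff[OF x b(1)] rochberg_norm_diff_le[OF x b(1)] b(2) by (simp_all add: d_def)
      have "a 0 = x 0"
        using rochberg_coordinate_eqI[OF a(1) x a(3)] .
      then have d0: "d 0 = 0"
        by (simp add: d_def b_def fun_diff_def)
      obtain y where y: "y \<in> rochberg (Suc n)" "\<And>i. i < n \<Longrightarrow> y i = d (Suc i)"
        "rochberg_norm (Suc n) y \<le> C * rochberg_norm n (\<lambda>i. d (Suc i))"
        using C(2)[OF rochberg_unshift(1)[OF d(1) d0]] by auto
      have "rochberg_norm n (\<lambda>i. d (Suc i)) \<le> 6 * ?N"
        using rochberg_unshift(2)[OF d(1) d0] d(2) by simp
      then have "C * rochberg_norm n (\<lambda>i. d (Suc i)) \<le> C * (6 * ?N)"
        using C(1) by (rule mult_left_mono)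
      then have "rochberg_norm (Suc n) y \<le> C * (6 * ?N)"
        using y(3) by linarith
      then have "B * rochberg_norm (Suc n) y \<le> B * (C * (6 * ?N))"
        using B(1) by (rule mult_left_mono)
      then have Ny: "rochberg_norm (Suc (Suc n)) (case_nat 0 y) \<le> B * (C * (6 * ?N))"
        using B(3)[OF y(1)] by linarith
      show ?thesis
      proof (intro bexI conjI allI impI)
        show "a + case_nat 0 y \<in> rochberg (Suc (Suc n))"
          by (intro rochberg_add a B y)
        show "rochberg_norm (Suc (Suc n)) (a + case_nat 0 y) \<le> (2 + B * (C * 6)) * ?N"
          using rochberg_add(2)[OF a(1) B(2)[OF y(1)]] Na Ny by (simp add: algebra_simps)
        show "(a + case_nat 0 y) i = x i" if "i < Suc n" for i
        proof (cases i)
          case 0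
          then show ?thesis using \<open>a 0 = x 0\<close> by (simp add: plus_fun_def)
        next
          case (Suc j)
          then show ?thesis using that y(2)[of j] by (simp add: plus_fun_def d_def b_def fun_diff_def)
        qed
      qed
    qed
    moreover have "0 \<le> 2 + B * (C * 6)"
      using B(1) C(1) by simp
    ultimately show ?case by blast
  qed
  then show ?thesis using that by blast
qed

text \<open>Shifting \<open>n\<close> times moves a sequence from the first entry to the last. By
  \<open>pairing_top\<close> this represents functionals that depend on the first entry of the other
  argument only.\<close>

lemma rochberg_top_embedding:
  obtains C where "C \<ge> 0"
    "\<And>w. summable (\<lambda>k. (w k)\<^sup>2) \<Longrightarrow>
      \<exists>e\<in>rochberg (Suc n). (\<forall>i<n. re_coord e i = (\<lambda>k. 0)) \<and> re_coord e n = w \<and>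
        rochberg_norm (Suc n) e \<le> C * sqrt (\<Sum>k. (w k)\<^sup>2)"
proof -
  have "\<exists>C\<ge>0. \<forall>w. summable (\<lambda>k. (w k)\<^sup>2) \<longrightarrow>
      (\<exists>e\<in>rochberg (Suc n). (\<forall>i<n. re_coord e i = (\<lambda>k. 0)) \<and> re_coord e n = w \<and>
        rochberg_norm (Suc n) e \<le> C * sqrt (\<Sum>k. (w k)\<^sup>2))"
  proof (induction n)
    case 0
    show ?case
    proof (intro exI[of _ 2] conjI allI impI)
      fix w :: "nat \<Rightarrow> real" assume "summable (\<lambda>k. (w k)\<^sup>2)"
      then show "\<exists>e\<in>rochberg (Suc 0). (\<forall>i<0. re_coord e i = (\<lambda>k. 0)) \<and> re_coord e 0 = w \<and>
          rochberg_norm (Suc 0) e \<le> 2 * sqrt (\<Sum>k. (w k)\<^sup>2)"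
        using square_summable_rochberg[of w 0] by blast
    qed simp
  next
    case (Suc n)
    then obtain C where C: "C \<ge> 0" "\<And>w. summable (\<lambda>k. (w k)\<^sup>2) \<Longrightarrow>
        \<exists>e\<in>rochberg (Suc n). (\<forall>i<n. re_coord e i = (\<lambda>k. 0)) \<and> re_coord e n = w \<and>
          rochberg_norm (Suc n) e \<le> C * sqrt (\<Sum>k. (w k)\<^sup>2)"
      by blast
    obtain B where B: "B \<ge> 0"
      "\<And>x. x \<in> rochberg (Suc n) \<Longrightarrow> case_nat 0 x \<in> rochberg (Suc (Suc n))"
      "\<And>x. x \<in> rochberg (Suc n) \<Longrightarrow> rochberg_norm (Suc (Suc n)) (case_nat 0 x) \<le> B * rochberg_norm (Suc n) x"
      using rochberg_shift[of "Suc n"] by blast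
    show ?case
    proof (intro exI[of _ "B * C"] conjI allI impI)
      show "0 \<le> B * C" using B C by simp
      fix w :: "nat \<Rightarrow> real" assume "summable (\<lambda>k. (w k)\<^sup>2)"
      then obtain e where e: "e \<in> rochberg (Suc n)" "\<And>i. i < n \<Longrightarrow> re_coord e i = (\<lambda>k. 0)" "re_coord e n = w"
        "rochberg_norm (Suc n) e \<le> C * sqrt (\<Sum>k. (w k)\<^sup>2)"
        using C(2) by blast
      have "re_coord (case_nat 0 e) i = (\<lambda>k. 0)" if "i < Suc n" for i
        using that e(2) by (cases i) (simp_all add: re_coord_def[abs_def] fun_eq_iff)
      moreover have "re_coord (case_nat 0 e) (Suc n) = w"
        using e(3) by (simp add: re_coord_def[abs_def])
      moreover have "rochberg_norm (Suc (Suc n)) (case_nat 0 e) \<le> B * C * sqrt (\<Sum>k. (w k)\<^sup>2)"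
        using B(3)[OF e(1)] mult_left_mono[OF e(4) B(1)] by (simp add: mult.assoc)
      ultimately show "\<exists>e\<in>rochberg (Suc (Suc n)). (\<forall>i<Suc n. re_coord e i = (\<lambda>k. 0)) \<and> re_coord e (Suc n) = w \<and>
          rochberg_norm (Suc (Suc n)) e \<le> B * C * sqrt (\<Sum>k. (w k)\<^sup>2)"
        using B(2)[OF e(1)] by blast
    qed
  qed
  then show ?thesis using that by blast
qed

text \<open>Shift and truncation are adjoint: the zero first entry removes the only term in which
  \<open>y n\<close> occurs, and the remaining signs agree.\<close>

lemma pairing_shift:
  assumes "\<And>i. i < n \<Longrightarrow> y i = y' i"
  shows "pairing (Suc n) (case_nat 0 x) y = pairing n x y'"
proof -
  have "pair_term (Suc n) (case_nat 0 x) y k = pair_term n x y' k" for k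
    unfolding pair_term_def sum.lessThan_Suc_shift using assms
    by (auto simp: re_coord_def intro!: sum.cong)
  then show ?thesis by (simp add: pairing_def)
qed

lemma pairing_top:
  assumes "\<And>i. i < n \<Longrightarrow> re_coord y i = (\<lambda>k. 0)"
  shows "pairing (Suc n) x y = (\<Sum>k. (-1) ^ n * (re_coord x 0 k * re_coord y n k))"
proof -
  have "pair_term (Suc n) x y k = (-1) ^ n * (re_coord x 0 k * re_coord y n k)" for k
  proof -
    have "(\<Sum>i<n. (-1) ^ (Suc n - Suc (Suc i)) * re_coord x (Suc i) k * re_coord y (Suc n - Suc (Suc i)) k) = 0"
      using assms by (intro sum.neutral) auto
    then show ?thesis
      unfolding pair_term_def sum.lessThan_Suc_shift by simp
  qed
  then show ?thesis by (simp add: pairing_def)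
qed

text \<open>Testing with shifted tuples reduces to the truncation of \<open>y\<close>, which
  vanishes by induction. What remains is the top entry, detected by tuples whose first entry is a
  unit vector.\<close>

lemma pairing_nondegenerate:
  "y \<in> rochberg n \<Longrightarrow> (\<And>x. x \<in> rochberg n \<Longrightarrow> pairing n x y = 0) \<Longrightarrow> y = 0"
proof (induction n arbitrary: y)
  case 0
  then show ?case by (simp add: rochberg_iff fun_eq_iff)
next
  case (Suc n)
  let ?t = "\<lambda>i. if i < n then y i else 0"
  obtain B where B: "\<And>x. x \<in> rochberg n \<Longrightarrow> case_nat 0 x \<in> rochberg (Suc n)"
    using rochberg_shift[of n] by blast
  have "pairing n x ?t = 0" if "x \<in> rochberg n" for x
    using Suc.prems(2)[OF B[OF that]] pairing_shift[of n y ?t x] by simp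
  then have "?t = 0"
    by (rule Suc.IH[OF rochberg_truncate(1)[OF Suc.prems(1)]])
  then have y0: "y i = 0" if "i < n" for i
    using that fun_cong[OF \<open>?t = 0\<close>, of i] by (simp add: zero_fun_def)
  show ?case
  proof (rule rochberg_eqI[OF Suc.prems(1) zero_rochberg])
    fix i j assume "i < Suc n"
    show "re_coord y i j = re_coord 0 i j"
    proof (cases "i < n")
      case True
      then show ?thesis by (simp add: re_coord_def y0)
    next
      case False
      define v where "v k = (if k = j then 1 else 0 :: real)" for k
      have "summable (\<lambda>k. (v k)\<^sup>2)"
        by (rule summable_finite[of "{j}"]) (auto simp: v_def)
      then obtain x where x: "x \<in> rochberg (Suc n)" "re_coord x 0 = v"
        using square_summable_rochberg by metis
      have "pairing (Suc n) x y = (\<Sum>k. (-1) ^ n * (v k * re_coord y n k))"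
        unfolding x(2)[symmetric] by (rule pairing_top) (simp add: re_coord_def[abs_def] y0)
      also have "\<dots> = (\<Sum>k\<in>{j}. (-1) ^ n * (v k * re_coord y n k))"
        by (rule suminf_finite) (auto simp: v_def)
      also have "\<dots> = (-1) ^ n * re_coord y n j"
        by (simp add: v_def)
      finally have "re_coord y n j = 0"
        using Suc.prems(2)[OF x(1)] by simp
      moreover have "i = n"
        using False \<open>i < Suc n\<close> by simp
      ultimately show ?thesis by (simp add: re_coord_def)
    qed
  qed
qed

text \<open>The kernel of \<open>x \<mapsto> x\<^sub>0\<close> is a copy of the previous Rochberg space. Once a functional is corrected
  by an element that represents it there, it depends on \<open>x\<^sub>0\<close> only and Riesz's theorem in \<open>\<ell>\<^sub>2\<close> applies.\<close>

lemma rochberg_riesz: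
  obtains C where "C \<ge> 0"
    "\<And>\<phi> K. linear_functional_on (rochberg n) \<phi> \<Longrightarrow> K \<ge> 0 \<Longrightarrow>
      (\<And>x. x \<in> rochberg n \<Longrightarrow> \<bar>\<phi> x\<bar> \<le> K * rochberg_norm n x) \<Longrightarrow>
      \<exists>y\<in>rochberg n. rochberg_norm n y \<le> C * K \<and> (\<forall>x\<in>rochberg n. \<phi> x = pairing n x y)"
proof -
  have "\<exists>C\<ge>0. \<forall>\<phi> K. linear_functional_on (rochberg n) \<phi> \<and> K \<ge> 0 \<and>
      (\<forall>x\<in>rochberg n. \<bar>\<phi> x\<bar> \<le> K * rochberg_norm n x) \<longrightarrow>
      (\<exists>y\<in>rochberg n. rochberg_norm n y \<le> C * K \<and> (\<forall>x\<in>rochberg n. \<phi> x = pairing n x y))"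
  proof (induction n)
    case 0
    show ?case
    proof (rule exI[of _ 0], intro conjI allI impI)
      fix \<phi> :: "(nat \<Rightarrow> linf) \<Rightarrow> real" and K :: real
      assume *: "linear_functional_on (rochberg 0) \<phi> \<and> 0 \<le> K \<and>
        (\<forall>x\<in>rochberg 0. \<bar>\<phi> x\<bar> \<le> K * rochberg_norm 0 x)"
      show "\<exists>y\<in>rochberg 0. rochberg_norm 0 y \<le> 0 * K \<and> (\<forall>x\<in>rochberg 0. \<phi> x = pairing 0 x y)"
      proof (rule bexI[OF _ zero_rochberg], intro conjI ballI)
        show "rochberg_norm 0 0 \<le> 0 * K"
          by (simp only: rochberg_norm_0 mult_zero_left order_refl)
        fix x assume x: "x \<in> rochberg 0"
        have "x = 0"
          using x by (intro rochberg_eqI[OF x zero_rochberg]) simp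
        have "\<bar>\<phi> x\<bar> \<le> K * rochberg_norm 0 x"
          using * x by blast
        then show "\<phi> x = pairing 0 x 0"
          unfolding \<open>x = 0\<close> rochberg_norm_0 by (simp add: pairing_def pair_term_def)
      qed
    qed simp
  next
    case (Suc n)
    let ?V = "rochberg (Suc n)" and ?N = "rochberg_norm (Suc n)"
    obtain C where C: "C \<ge> 0" and C2: "\<forall>\<phi> K. linear_functional_on (rochberg n) \<phi> \<and> K \<ge> 0 \<and>
        (\<forall>x\<in>rochberg n. \<bar>\<phi> x\<bar> \<le> K * rochberg_norm n x) \<longrightarrow>
        (\<exists>y\<in>rochberg n. rochberg_norm n y \<le> C * K \<and> (\<forall>x\<in>rochberg n. \<phi> x = pairing n x y))"
      using Suc by blast
    obtain B where B: "B \<ge> 0"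
      "\<And>x. x \<in> rochberg n \<Longrightarrow> case_nat 0 x \<in> ?V"
      "\<And>x. x \<in> rochberg n \<Longrightarrow> ?N (case_nat 0 x) \<le> B * rochberg_norm n x"
      using rochberg_shift[of n] by blast
    obtain L where L: "L \<ge> 0" "\<And>x. x \<in> rochberg n \<Longrightarrow>
        \<exists>y\<in>?V. (\<forall>i<n. y i = x i) \<and> ?N y \<le> L * rochberg_norm n x"
      using rochberg_extend[of n] by blast
    obtain T where T: "T \<ge> 0" "\<And>w. summable (\<lambda>k. (w k)\<^sup>2) \<Longrightarrow>
        \<exists>e\<in>?V. (\<forall>i<n. re_coord e i = (\<lambda>k. 0)) \<and> re_coord e n = w \<and> ?N e \<le> T * sqrt (\<Sum>k. (w k)\<^sup>2)"
      using rochberg_top_embedding[of n] by blast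
    \<comment> \<open>\<open>D * K\<close> bounds the element that corrects \<phi> on the kernel:
      \<open>B\<close> from restricting along the shift, \<open>C\<close> from the induction
      hypothesis, \<open>L\<close> from extending. \<open>E * K\<close> bounds the corrected
      functional \<psi>.\<close>
    define D where "D = L * (C * B)"
    have D: "D \<ge> 0" using L C B by (simp add: D_def)
    define E where "E = 1 + 4 ^ Suc n * D"
    have E: "E \<ge> 0" using D by (simp add: E_def)
    show ?case
    proof (intro exI[of _ "D + T * (2 * E)"] conjI allI impI)
      show "0 \<le> D + T * (2 * E)" using D T E by simp
      fix \<phi> :: "(nat \<Rightarrow> linf) \<Rightarrow> real" and K :: real
      assume *: "linear_functional_on ?V \<phi> \<and> 0 \<le> K \<and> (\<forall>x\<in>?V. \<bar>\<phi> x\<bar> \<le> K * ?N x)"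
      then have \<phi>_add: "\<And>x y. x \<in> ?V \<Longrightarrow> y \<in> ?V \<Longrightarrow> \<phi> (x + y) = \<phi> x + \<phi> y"
        and \<phi>_scale: "\<And>r x. x \<in> ?V \<Longrightarrow> \<phi> (r *\<^sub>R x) = r * \<phi> x"
        and K: "K \<ge> 0" and \<phi>_le: "\<And>x. x \<in> ?V \<Longrightarrow> \<bar>\<phi> x\<bar> \<le> K * ?N x"
        by (auto simp: linear_functional_on_def)
      have "linear_functional_on (rochberg n) (\<lambda>x. \<phi> (case_nat 0 x))"
        unfolding linear_functional_on_def
      proof (intro conjI ballI allI)
        fix x y r assume x: "x \<in> rochberg n" and y: "y \<in> rochberg n"
        have "case_nat 0 (x + y) = case_nat 0 x + case_nat 0 y"
          by (simp add: fun_eq_iff plus_fun_def split: nat.split)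
        then show "\<phi> (case_nat 0 (x + y)) = \<phi> (case_nat 0 x) + \<phi> (case_nat 0 y)"
          using \<phi>_add B(2) x y by simp
      next
        fix x and r :: real assume x: "x \<in> rochberg n"
        have "case_nat 0 (r *\<^sub>R x) = r *\<^sub>R case_nat 0 x"
          by (simp add: fun_eq_iff scaleR_fun_def split: nat.split)
        then show "\<phi> (case_nat 0 (r *\<^sub>R x)) = r * \<phi> (case_nat 0 x)"
          using \<phi>_scale B(2) x by simp
      qed
      moreover have "\<bar>\<phi> (case_nat 0 x)\<bar> \<le> (B * K) * rochberg_norm n x" if "x \<in> rochberg n" for x
        using \<phi>_le[OF B(2)[OF that]] mult_left_mono[OF B(3)[OF that] K] by (simp add: mult_ac)
      ultimately obtain y' where y': "y' \<in> rochberg n" "rochberg_norm n y' \<le> C * (B * K)"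
        "\<And>x. x \<in> rochberg n \<Longrightarrow> \<phi> (case_nat 0 x) = pairing n x y'"
        using C2[rule_format, of "\<lambda>x. \<phi> (case_nat 0 x)" "B * K"] B(1) K by auto
      \<comment> \<open>Any extension of \<open>y'\<close> is suitable: by
        \<open>pairing_shift\<close> its top entry is invisible on shifted tuples.\<close>
      obtain y where y: "y \<in> ?V" "\<And>i. i < n \<Longrightarrow> y i = y' i" "?N y \<le> L * rochberg_norm n y'"
        using L(2)[OF y'(1)] by blast
      have Ny: "?N y \<le> D * K"
        using y(3) mult_left_mono[OF y'(2) L(1)] by (simp add: D_def mult.assoc)
      define \<psi> where "\<psi> x = \<phi> x - pairing (Suc n) x y" for x
      have \<psi>_diff: "\<psi> (u - v) = \<psi> u - \<psi> v" if "u \<in> ?V" "v \<in> ?V" for u v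
        using \<phi>_add[of u "-1 *\<^sub>R v"] \<phi>_scale[of v "-1"] pairing_add_left[of u "Suc n" "-1 *\<^sub>R v" y]
          pairing_scale_left[of v "Suc n" y "-1"] that y(1) rochberg_scale_le(1)[of v "Suc n" "-1"]
        by (simp add: \<psi>_def)
      have \<psi>_scale: "\<psi> (r *\<^sub>R v) = r * \<psi> v" if "v \<in> ?V" for v r
        using \<phi>_scale[of v r] pairing_scale_left[of v "Suc n" y r] that y(1)
        by (simp add: \<psi>_def right_diff_distrib)
      have \<psi>_le: "\<bar>\<psi> x\<bar> \<le> (E * K) * ?N x" if x: "x \<in> ?V" for x
      proof -
        have "\<bar>pairing (Suc n) x y\<bar> \<le> 4 ^ Suc n * ?N x * ?N y"
          by (rule pairing_le[OF x y(1)])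
        also have "\<dots> \<le> 4 ^ Suc n * ?N x * (D * K)"
          by (rule mult_left_mono[OF Ny]) (simp add: rochberg_norm_nonneg[OF x])
        finally have "\<bar>\<psi> x\<bar> \<le> K * ?N x + 4 ^ Suc n * ?N x * (D * K)"
          using \<phi>_le[OF x] unfolding \<psi>_def by linarith
        then show ?thesis by (simp add: E_def algebra_simps)
      qed
      have \<psi>_0: "\<psi> x = 0" if x: "x \<in> ?V" and "x 0 = 0" for x
        using y'(3)[OF rochberg_unshift(1)[OF that]] pairing_shift[OF y(2), where x = "\<lambda>i. x (Suc i)"]
        by (simp add: \<psi>_def case_nat_Suc_eq[of x, OF that(2)])
      have \<psi>_eq: "\<psi> u = \<psi> v" if uv: "u \<in> ?V" "v \<in> ?V" "re_coord u 0 = re_coord v 0" for u v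
      proof -
        have "(u - v) 0 = 0"
          using rochberg_coordinate_eqI[OF uv] by (simp add: fun_diff_def)
        then show ?thesis
          using \<psi>_0[OF rochberg_diff[OF uv(1,2)]] \<psi>_diff[OF uv(1,2)] by simp
      qed
      \<comment> \<open>\<open>J\<close> is an arbitrary, possibly nonlinear, choice of preimages.
        Its composition with \<psi> is nevertheless linear, because \<psi> depends on the first
        entry only.\<close>
      define J where "J v = (SOME x. x \<in> ?V \<and> ?N x \<le> 2 * sqrt (\<Sum>k. (v k)\<^sup>2) \<and> re_coord x 0 = v)" for v
      have "J v \<in> ?V \<and> ?N (J v) \<le> 2 * sqrt (\<Sum>k. (v k)\<^sup>2) \<and> re_coord (J v) 0 = v"
        if v: "summable (\<lambda>k. (v k)\<^sup>2)" for v
      proof -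
        have "\<exists>x. x \<in> ?V \<and> ?N x \<le> 2 * sqrt (\<Sum>k. (v k)\<^sup>2) \<and> re_coord x 0 = v"
          by (rule square_summable_rochberg[OF v, of n]) blast
        then show ?thesis
          unfolding J_def by (rule someI_ex)
      qed
      then have J: "\<And>v. summable (\<lambda>k. (v k)\<^sup>2) \<Longrightarrow> J v \<in> ?V"
        "\<And>v. summable (\<lambda>k. (v k)\<^sup>2) \<Longrightarrow> ?N (J v) \<le> 2 * sqrt (\<Sum>k. (v k)\<^sup>2)"
        "\<And>v. summable (\<lambda>k. (v k)\<^sup>2) \<Longrightarrow> re_coord (J v) 0 = v"
        by simp_all
      have J_diff: "\<psi> (J (\<lambda>k. u k - v k)) = \<psi> (J u) - \<psi> (J v)"
        if uv: "summable (\<lambda>k. (u k)\<^sup>2)" "summable (\<lambda>k. (v k)\<^sup>2)" for u v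
      proof -
        have Juv: "J u - J v \<in> ?V" "re_coord (J u - J v) 0 = (\<lambda>k. u k - v k)"
          using J(3)[OF uv(1)] J(3)[OF uv(2)] by (auto simp: re_coord_diff fun_eq_iff intro: rochberg_diff J uv)
        have s: "summable (\<lambda>k. (u k - v k)\<^sup>2)"
          using rochberg_square_summable(1)[OF Juv(1)] by (simp add: Juv(2))
        show ?thesis
          using \<psi>_eq[OF J(1)[OF s] Juv(1)] J(3)[OF s] Juv(2) \<psi>_diff[OF J(1)[OF uv(1)] J(1)[OF uv(2)]]
          by simp
      qed
      have J_scale: "\<psi> (J (\<lambda>k. r * v k)) = r * \<psi> (J v)"
        if v: "summable (\<lambda>k. (v k)\<^sup>2)" for r v
      proof -
        have s: "summable (\<lambda>k. (r * v k)\<^sup>2)"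
          using v by (simp add: power_mult_distrib summable_mult)
        have "re_coord (J (\<lambda>k. r * v k)) 0 = re_coord (r *\<^sub>R J v) 0"
          using J(3)[OF v] J(3)[OF s] by (simp add: re_coord_scaleR fun_eq_iff)
        then have "\<psi> (J (\<lambda>k. r * v k)) = \<psi> (r *\<^sub>R J v)"
          by (rule \<psi>_eq[OF J(1)[OF s] rochberg_scale_le(1)[OF J(1)[OF v]]])
        then show ?thesis
          by (simp only: \<psi>_scale[OF J(1)[OF v]])
      qed
      have J_le: "\<bar>\<psi> (J v)\<bar> \<le> 2 * (E * K) * sqrt (\<Sum>k. (v k)\<^sup>2)"
        if v: "summable (\<lambda>k. (v k)\<^sup>2)" for v
        using \<psi>_le[OF J(1)[OF v]] mult_left_mono[OF J(2)[OF v], of "E * K"] E K by (simp add: mult_ac)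
      have EK: "0 \<le> 2 * (E * K)" using E K by simp
      obtain w where w: "summable (\<lambda>k. (w k)\<^sup>2)" "sqrt (\<Sum>k. (w k)\<^sup>2) \<le> 2 * (E * K)"
        "\<And>v. summable (\<lambda>k. (v k)\<^sup>2) \<Longrightarrow> \<psi> (J v) = (\<Sum>k. v k * w k)"
        using square_summable_riesz[of "\<lambda>v. \<psi> (J v)", OF J_diff J_scale J_le EK] by blast
      obtain e where e: "e \<in> ?V" "\<And>i. i < n \<Longrightarrow> re_coord e i = (\<lambda>k. 0)" "re_coord e n = w"
        "?N e \<le> T * sqrt (\<Sum>k. (w k)\<^sup>2)"
        using T(2)[OF w(1)] by blast
      have Ne: "?N e \<le> T * (2 * (E * K))"
        using e(4) mult_left_mono[OF w(2) T(1)] by linarith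
      have \<psi>_e: "\<psi> x = (-1) ^ n * pairing (Suc n) x e" if x: "x \<in> ?V" for x
      proof -
        note s = rochberg_square_summable(1)[OF x]
        have "\<psi> x = \<psi> (J (re_coord x 0))"
          by (rule \<psi>_eq[OF x J(1)[OF s]]) (simp add: J(3)[OF s])
        also have "\<dots> = (\<Sum>k. re_coord x 0 k * w k)"
          by (rule w(3)[OF s])
        finally have "\<psi> x = (\<Sum>k. re_coord x 0 k * w k)" .
        moreover have "pairing (Suc n) x e = (-1) ^ n * (\<Sum>k. re_coord x 0 k * w k)"
          using pairing_top[of n e x, OF e(2)] suminf_mult[OF square_summable_mult[OF s w(1)], of "(-1) ^ n"]
          by (simp only: e(3))
        ultimately show ?thesis
          by (simp flip: power_mult_distrib mult.assoc)
      qed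
      have e': "(-1) ^ n *\<^sub>R e \<in> ?V"
        by (rule rochberg_scale_le(1)[OF e(1)])
      show "\<exists>y\<in>?V. ?N y \<le> (D + T * (2 * E)) * K \<and> (\<forall>x\<in>?V. \<phi> x = pairing (Suc n) x y)"
      \<comment> \<open>The sign cancels the one in \<open>pairing_top\<close>.\<close>
      proof (intro bexI[of _ "y + (-1) ^ n *\<^sub>R e"] conjI ballI)
        show "y + (-1) ^ n *\<^sub>R e \<in> ?V"
          by (rule rochberg_add(1)[OF y(1) e'])
        show "?N (y + (-1) ^ n *\<^sub>R e) \<le> (D + T * (2 * E)) * K"
          using rochberg_add(2)[OF y(1) e'] rochberg_norm_scale[OF e(1), of "(-1) ^ n"] Ny Ne
          by (simp add: power_abs algebra_simps)
        fix x assume x: "x \<in> ?V"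
        show "\<phi> x = pairing (Suc n) x (y + (-1) ^ n *\<^sub>R e)"
          using \<psi>_e[OF x] pairing_add_right[OF x y(1) e'] pairing_scale_right[OF x e(1)]
          by (simp add: \<psi>_def)
      qed
    qed
  qed
  then obtain C where C: "C \<ge> 0" and C2: "\<forall>\<phi> K. linear_functional_on (rochberg n) \<phi> \<and> K \<ge> 0 \<and>
      (\<forall>x\<in>rochberg n. \<bar>\<phi> x\<bar> \<le> K * rochberg_norm n x) \<longrightarrow>
      (\<exists>y\<in>rochberg n. rochberg_norm n y \<le> C * K \<and> (\<forall>x\<in>rochberg n. \<phi> x = pairing n x y))"
    by blast
  show ?thesis
    by (rule that[OF C], rule C2[rule_format]) blast
qed


section \<open>Symplectic forms\<close>

text \<open>For the norm bound, the functional induced by \<open>y\<close> has some representative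
  of controlled norm, and by nondegeneracy this representative is \<open>y\<close> itself.\<close>

lemma rochberg_pairing_duality:
  obtains C where "C > 0"
    "\<And>\<phi> K. linear_functional_on (rochberg n) \<phi> \<Longrightarrow>
      (\<And>x. x \<in> rochberg n \<Longrightarrow> \<bar>\<phi> x\<bar> \<le> K * rochberg_norm n x) \<Longrightarrow>
      \<exists>y\<in>rochberg n. \<forall>x\<in>rochberg n. \<phi> x = pairing n x y"
    "\<And>y K. y \<in> rochberg n \<Longrightarrow> K \<ge> 0 \<Longrightarrow>
      (\<And>x. x \<in> rochberg n \<Longrightarrow> \<bar>pairing n x y\<bar> \<le> K * rochberg_norm n x) \<Longrightarrow>
      rochberg_norm n y \<le> C * K"
proof -
  obtain C where C: "C \<ge> 0" and ex: "\<And>\<phi> K. linear_functional_on (rochberg n) \<phi> \<Longrightarrow> K \<ge> 0 \<Longrightarrow>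
      (\<And>x. x \<in> rochberg n \<Longrightarrow> \<bar>\<phi> x\<bar> \<le> K * rochberg_norm n x) \<Longrightarrow>
      \<exists>y\<in>rochberg n. rochberg_norm n y \<le> C * K \<and> (\<forall>x\<in>rochberg n. \<phi> x = pairing n x y)"
    by (rule rochberg_riesz[of n], rule that) blast+
  show ?thesis
  proof
    \<comment> \<open>The increment makes the constant positive, so that its inverse can serve as a
      lower bound in the symplectic form.\<close>
    show "C + 1 > 0" using C by simp
    fix \<phi> :: "(nat \<Rightarrow> linf) \<Rightarrow> real" and K :: real
    assume lin: "linear_functional_on (rochberg n) \<phi>"
      and le: "\<And>x. x \<in> rochberg n \<Longrightarrow> \<bar>\<phi> x\<bar> \<le> K * rochberg_norm n x"
    have "\<bar>\<phi> x\<bar> \<le> \<bar>K\<bar> * rochberg_norm n x" if x: "x \<in> rochberg n" for x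
      using le[OF x] mult_right_mono[OF abs_ge_self[of K] rochberg_norm_nonneg[OF x]] by linarith
    from ex[OF lin abs_ge_zero this] show "\<exists>y\<in>rochberg n. \<forall>x\<in>rochberg n. \<phi> x = pairing n x y"
      by blast
  next
    fix y and K :: real
    assume y: "y \<in> rochberg n" and K: "K \<ge> 0"
      and le: "\<And>x. x \<in> rochberg n \<Longrightarrow> \<bar>pairing n x y\<bar> \<le> K * rochberg_norm n x"
    have "linear_functional_on (rochberg n) (\<lambda>x. pairing n x y)"
      by (simp add: linear_functional_on_def pairing_add_left pairing_scale_left y)
    then obtain y' where y': "y' \<in> rochberg n" "rochberg_norm n y' \<le> C * K"
      "\<And>x. x \<in> rochberg n \<Longrightarrow> pairing n x y = pairing n x y'"
      using ex[OF _ K le] by blast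
    have "y - y' = 0"
      by (rule pairing_nondegenerate[OF rochberg_diff[OF y y'(1)]])
        (simp add: pairing_diff_right y y'(1) flip: y'(3))
    then show "rochberg_norm n y \<le> (C + 1) * K"
      using y'(2) K by (simp add: algebra_simps)
  qed
qed

text \<open>A Cauchy sequence converges weakly to a functional, which is represented by its limit.\<close>

lemma real_banach_on_rochberg: "real_banach_on (rochberg n) (rochberg_norm n)"
proof -
  let ?V = "rochberg n" and ?N = "rochberg_norm n"
  obtain C where C: "C > 0"
    and ex: "\<And>\<phi> K. linear_functional_on ?V \<phi> \<Longrightarrow> (\<And>x. x \<in> ?V \<Longrightarrow> \<bar>\<phi> x\<bar> \<le> K * ?N x) \<Longrightarrow>
      \<exists>y\<in>?V. \<forall>x\<in>?V. \<phi> x = pairing n x y"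
    and bdd: "\<And>y K. y \<in> ?V \<Longrightarrow> K \<ge> 0 \<Longrightarrow> (\<And>x. x \<in> ?V \<Longrightarrow> \<bar>pairing n x y\<bar> \<le> K * ?N x) \<Longrightarrow>
      ?N y \<le> C * K"
    by (rule rochberg_pairing_duality[of n], rule that) blast+
  have "\<exists>x\<in>?V. (\<lambda>m. ?N (X m - x)) \<longlonglongrightarrow> 0"
    if X: "\<And>m::nat. X m \<in> ?V"
      and cauchy: "\<And>e. e > 0 \<Longrightarrow> \<exists>M. \<forall>m\<ge>M. \<forall>k\<ge>M. ?N (X m - X k) < e" for X
  proof -
    have XX: "X m - X k \<in> ?V" for m k
      by (rule rochberg_diff[OF X X])
    have le: "\<bar>pairing n y (X m) - pairing n y (X k)\<bar> \<le> 4 ^ n * ?N y * ?N (X m - X k)"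
      if "y \<in> ?V" for y m k
      using pairing_le[OF that XX[of m k]] pairing_diff_right[OF that X X, of m k] by simp
    have "convergent (\<lambda>m. pairing n y (X m))" if y: "y \<in> ?V" for y
    proof (rule Cauchy_convergent, rule CauchyI)
      fix e :: real assume e: "e > 0"
      define c where "c = 4 ^ n * ?N y"
      have c: "c \<ge> 0" using rochberg_norm_nonneg[OF y] by (simp add: c_def)
      have "e / (c + 1) > 0" using e c by simp
      then obtain M where M: "\<And>m k. m \<ge> M \<Longrightarrow> k \<ge> M \<Longrightarrow> ?N (X m - X k) < e / (c + 1)"
        using cauchy by blast
      show "\<exists>M. \<forall>m\<ge>M. \<forall>k\<ge>M. norm (pairing n y (X m) - pairing n y (X k)) < e"
      proof (intro exI[of _ M] allI impI)
        fix m k assume "m \<ge> M" "k \<ge> M"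
        have "\<bar>pairing n y (X m) - pairing n y (X k)\<bar> \<le> c * ?N (X m - X k)"
          using le[OF y] by (simp add: c_def)
        also have "\<dots> \<le> c * (e / (c + 1))"
          using M[OF \<open>m \<ge> M\<close> \<open>k \<ge> M\<close>] c by (intro mult_left_mono) auto
        also have "\<dots> < (c + 1) * (e / (c + 1))"
          using e c by (intro mult_strict_right_mono) auto
        also have "\<dots> = e" using c by simp
        finally show "norm (pairing n y (X m) - pairing n y (X k)) < e" by simp
      qed
    qed
    then have lim: "(\<lambda>m. pairing n y (X m)) \<longlonglongrightarrow> lim (\<lambda>m. pairing n y (X m))" if "y \<in> ?V" for y
      using that by (simp add: convergent_LIMSEQ_iff)
    define \<phi> where "\<phi> y = lim (\<lambda>m. pairing n y (X m))" for y
    have lim\<phi>: "(\<lambda>m. pairing n y (X m)) \<longlonglongrightarrow> \<phi> y" if "y \<in> ?V" for y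
      using lim[OF that] by (simp add: \<phi>_def)
    have "linear_functional_on ?V \<phi>"
      unfolding linear_functional_on_def
    proof (intro conjI ballI allI)
      fix x y assume x: "x \<in> ?V" and y: "y \<in> ?V"
      have "(\<lambda>m. pairing n (x + y) (X m)) \<longlonglongrightarrow> \<phi> x + \<phi> y"
        using tendsto_add[OF lim\<phi>[OF x] lim\<phi>[OF y]] by (simp add: pairing_add_left x y X)
      then show "\<phi> (x + y) = \<phi> x + \<phi> y"
        using lim\<phi>[OF rochberg_add(1)[OF x y]] LIMSEQ_unique by blast
    next
      fix x and r :: real assume x: "x \<in> ?V"
      have "(\<lambda>m. pairing n (r *\<^sub>R x) (X m)) \<longlonglongrightarrow> r * \<phi> x"
        using tendsto_mult_left[OF lim\<phi>[OF x], of r] by (simp add: pairing_scale_left x X)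
      then show "\<phi> (r *\<^sub>R x) = r * \<phi> x"
        using lim\<phi>[OF rochberg_scale_le(1)[OF x]] LIMSEQ_unique by blast
    qed
    moreover obtain M where M: "\<And>m k. m \<ge> M \<Longrightarrow> k \<ge> M \<Longrightarrow> ?N (X m - X k) < 1"
      using cauchy[of 1] by auto
    have "\<bar>\<phi> y\<bar> \<le> 4 ^ n * (?N (X M) + 1) * ?N y" if y: "y \<in> ?V" for y
    proof (rule LIMSEQ_le_const2[OF tendsto_rabs[OF lim\<phi>[OF y]]], intro exI[of _ M] allI impI)
      fix m assume m: "m \<ge> M"
      have "?N (X m) \<le> ?N (X M) + ?N (X m - X M)"
        using rochberg_add(2)[OF X[of M] XX[of m M]] by simp
      then have "?N (X m) \<le> ?N (X M) + 1"
        using M[OF m order_refl] by simp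
      then have "4 ^ n * ?N y * ?N (X m) \<le> 4 ^ n * ?N y * (?N (X M) + 1)"
        by (rule mult_left_mono) (simp add: rochberg_norm_nonneg[OF y])
      then show "\<bar>pairing n y (X m)\<bar> \<le> 4 ^ n * (?N (X M) + 1) * ?N y"
        using pairing_le[OF y X[of m]] by (simp add: mult_ac)
    qed
    ultimately obtain x where x: "x \<in> ?V" "\<And>y. y \<in> ?V \<Longrightarrow> \<phi> y = pairing n y x"
      using ex by blast
    \<comment> \<open>The Cauchy estimate is uniform over the functionals, so the bound in the
      duality upgrades weak convergence to norm convergence.\<close>
    have "(\<lambda>m. ?N (X m - x)) \<longlonglongrightarrow> 0"
    proof (rule LIMSEQ_I)
      fix e :: real assume e: "e > 0"
      \<comment> \<open>Chosen so that \<open>C * (4 ^ n * \<delta>) = e / 2\<close>.\<close>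
      define \<delta> where "\<delta> = e / (2 * C * 4 ^ n)"
      have \<delta>: "\<delta> > 0" using e C by (simp add: \<delta>_def)
      obtain M where M: "\<And>m k. m \<ge> M \<Longrightarrow> k \<ge> M \<Longrightarrow> ?N (X m - X k) < \<delta>"
        using cauchy[OF \<delta>] by blast
      have "?N (X m - x) < e" if m: "m \<ge> M" for m
      proof -
        have "\<bar>pairing n y (X m - x)\<bar> \<le> 4 ^ n * \<delta> * ?N y" if y: "y \<in> ?V" for y
        proof -
          have "(\<lambda>k. \<bar>pairing n y (X m) - pairing n y (X k)\<bar>) \<longlonglongrightarrow> \<bar>pairing n y (X m) - \<phi> y\<bar>"
            by (intro tendsto_intros lim\<phi> y)
          then have lim_m: "(\<lambda>k. \<bar>pairing n y (X m) - pairing n y (X k)\<bar>) \<longlonglongrightarrow> \<bar>pairing n y (X m - x)\<bar>"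
            by (simp add: pairing_diff_right y X x)
          have "\<bar>pairing n y (X m) - pairing n y (X k)\<bar> \<le> 4 ^ n * \<delta> * ?N y" if k: "k \<ge> M" for k
          proof -
            have "4 ^ n * ?N y * ?N (X m - X k) \<le> 4 ^ n * ?N y * \<delta>"
              using M[OF m k] by (intro mult_left_mono) (auto simp: rochberg_norm_nonneg[OF y])
            then show ?thesis
              using le[OF y, of m k] by (simp add: mult_ac)
          qed
          then show ?thesis
            by (intro LIMSEQ_le_const2[OF lim_m]) blast
        qed
        then have "?N (X m - x) \<le> C * (4 ^ n * \<delta>)"
          using \<delta> by (intro bdd rochberg_diff X x) auto
        also have "\<dots> = e / 2" using C by (simp add: \<delta>_def)
        also have "\<dots> < e" using e by simp
        finally show ?thesis .
      qed
      then show "\<exists>M. \<forall>m\<ge>M. norm (?N (X m - x) - 0) < e"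
        by (auto simp: rochberg_norm_nonneg[OF rochberg_diff[OF X x(1)]] intro!: exI[of _ M])
    qed
    then show ?thesis using x(1) by blast
  qed
  then show ?thesis
    unfolding real_banach_on_def
    using subspace_rochberg rochberg_norm_nonneg rochberg_norm_eq_0 rochberg_add(2) rochberg_norm_scale
    by auto
qed

text \<open>Treats both parities at once: the identity with \<open>\<epsilon> = 1\<close> and
  \<open>swap\<close> with \<open>\<epsilon> = -1\<close>. The duality represents functionals by the
  second argument of the pairing, so \<open>x\<close> is put there, twisted by
  \<open>U\<close>.\<close>

lemma symplectic_form_twisted_pairing:
  assumes U: "\<And>x. x \<in> rochberg n \<Longrightarrow> U x \<in> rochberg n"
      "\<And>x. x \<in> rochberg n \<Longrightarrow> rochberg_norm n (U x) \<le> rochberg_norm n x"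
      "\<And>x. x \<in> rochberg n \<Longrightarrow> U (U x) = \<epsilon> *\<^sub>R x"
      "\<And>x r. x \<in> rochberg n \<Longrightarrow> U (r *\<^sub>R x) = r *\<^sub>R U x"
    and \<epsilon>: "\<epsilon> * \<epsilon> = 1"
    and anti: "\<And>x y. x \<in> rochberg n \<Longrightarrow> y \<in> rochberg n \<Longrightarrow> pairing n y (U x) = - pairing n x (U y)"
  shows "symplectic_form (rochberg n) (rochberg_norm n) (\<lambda>x y. pairing n y (U x))"
proof -
  let ?V = "rochberg n" and ?N = "rochberg_norm n" and ?\<omega> = "\<lambda>x y. pairing n y (U x)"
  obtain C where C: "C > 0"
    and ex: "\<And>\<phi> K. linear_functional_on ?V \<phi> \<Longrightarrow> (\<And>x. x \<in> ?V \<Longrightarrow> \<bar>\<phi> x\<bar> \<le> K * ?N x) \<Longrightarrow>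
      \<exists>y\<in>?V. \<forall>x\<in>?V. \<phi> x = pairing n x y"
    and bdd: "\<And>y K. y \<in> ?V \<Longrightarrow> K \<ge> 0 \<Longrightarrow> (\<And>x. x \<in> ?V \<Longrightarrow> \<bar>pairing n x y\<bar> \<le> K * ?N x) \<Longrightarrow>
      ?N y \<le> C * K"
    by (rule rochberg_pairing_duality[of n], rule that) blast+
  have lin_right: "linear_functional_on ?V (\<lambda>y. ?\<omega> x y)" if "x \<in> ?V" for x
    using that by (simp add: linear_functional_on_def pairing_add_left pairing_scale_left U)
  have lin_left: "linear_functional_on ?V (\<lambda>x. ?\<omega> x y)" if y: "y \<in> ?V" for y
    unfolding linear_functional_on_def
  proof (intro conjI ballI allI)
    \<comment> \<open>Antisymmetry moves \<open>x + x'\<close> to the argument that is not twisted,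
      where the pairing is additive.\<close>
    show "?\<omega> (x + x') y = ?\<omega> x y + ?\<omega> x' y" if "x \<in> ?V" "x' \<in> ?V" for x x'
      using anti[OF _ y] that by (simp add: pairing_add_left rochberg_add U y)
    show "?\<omega> (r *\<^sub>R x) y = r * ?\<omega> x y" if "x \<in> ?V" for r x
      using that by (simp add: U pairing_scale_right y)
  qed
  have le: "\<bar>?\<omega> x y\<bar> \<le> 4 ^ n * ?N x * ?N y" if x: "x \<in> ?V" and y: "y \<in> ?V" for x y
  proof -
    have "\<bar>?\<omega> x y\<bar> \<le> 4 ^ n * ?N y * ?N (U x)"
      by (rule pairing_le[OF y U(1)[OF x]])
    also have "\<dots> \<le> 4 ^ n * ?N y * ?N x"
      by (rule mult_left_mono[OF U(2)[OF x]]) (simp add: rochberg_norm_nonneg[OF y])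
    finally show ?thesis by (simp add: mult_ac)
  qed
  have \<epsilon>1: "\<bar>\<epsilon>\<bar> = 1"
    using \<epsilon> by (metis abs_1 abs_mult abs_mult_self_eq abs_ge_zero power2_eq_1_iff power2_eq_square abs_minus)
  \<comment> \<open>\<open>U\<close> is contractive and its square is a sign, so its inverse is
    contractive as well.\<close>
  have NU: "?N (U x) = ?N x" if x: "x \<in> ?V" for x
    using U(2)[OF x] U(2)[OF U(1)[OF x]] U(3)[OF x] rochberg_norm_scale[OF x, of \<epsilon>] \<epsilon>1 by simp
  define D where "D x = dual_norm ?V ?N (restrict (?\<omega> x) ?V)" for x
  have D: "D x = (SUP y\<in>{y \<in> ?V. ?N y \<le> 1}. \<bar>?\<omega> x y\<bar>)" for x
    unfolding D_def dual_norm_def by (rule SUP_cong) auto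
  have ball: "{y \<in> ?V. ?N y \<le> 1} \<noteq> {}"
    using zero_rochberg[of n] rochberg_norm_0[of n] by force
  have ball_le: "\<bar>?\<omega> x y\<bar> \<le> 4 ^ n * ?N x" if "x \<in> ?V" "y \<in> {y \<in> ?V. ?N y \<le> 1}" for x y
  proof -
    have "\<bar>?\<omega> x y\<bar> \<le> 4 ^ n * ?N x * ?N y"
      using le that by blast
    also have "\<dots> \<le> 4 ^ n * ?N x * 1"
      using that by (intro mult_left_mono) (auto simp: rochberg_norm_nonneg)
    finally show ?thesis by simp
  qed
  have D_le: "D x \<le> 4 ^ n * ?N x" if "x \<in> ?V" for x
    unfolding D using ball ball_le[OF that] by (rule cSUP_least)
  have D_ge: "?N x \<le> C * D x" if x: "x \<in> ?V" for x
  proof -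
    have unit: "\<bar>?\<omega> x y\<bar> \<le> D x" if "y \<in> ?V" "?N y \<le> 1" for y
      unfolding D using that ball_le[OF x] by (intro cSUP_upper) (auto simp: bdd_above_def)
    have D0: "D x \<ge> 0"
      using unit[OF zero_rochberg] by (metis abs_ge_zero order_trans rochberg_norm_0 zero_le_one)
    have "\<bar>pairing n y (U x)\<bar> \<le> D x * ?N y" if y: "y \<in> ?V" for y
    proof (cases "?N y = 0")
      case True
      then show ?thesis using le[OF x y] by simp
    next
      case False
      then have pos: "?N y > 0" using rochberg_norm_nonneg[OF y] by simp
      have "\<bar>?\<omega> x (inverse (?N y) *\<^sub>R y)\<bar> \<le> D x"
        using pos by (intro unit rochberg_scale_le y) (simp add: rochberg_norm_scale y)
      then show ?thesis
        using pos by (simp add: pairing_scale_left y U x abs_mult field_simps)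
    qed
    then have "?N (U x) \<le> C * D x"
      by (intro bdd U x D0)
    then show ?thesis by (simp add: NU x)
  qed
  have inj: "inj_on (\<lambda>x. restrict (?\<omega> x) ?V) ?V"
  proof (rule inj_onI)
    fix x x' assume x: "x \<in> ?V" "x' \<in> ?V" and eq: "restrict (?\<omega> x) ?V = restrict (?\<omega> x') ?V"
    have "pairing n y (U x) = pairing n y (U x')" if "y \<in> ?V" for y
      using fun_cong[OF eq, of y] that by simp
    then have "U x - U x' = 0"
      by (intro pairing_nondegenerate[where n = n] rochberg_diff U x)
        (simp add: pairing_diff_right U x)
    then have "U (U x) = U (U x')" by simp
    then have "\<epsilon> *\<^sub>R x = \<epsilon> *\<^sub>R x'"
      by (simp only: U(3)[OF x(1)] U(3)[OF x(2)])
    then show "x = x'" using \<epsilon> by auto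
  qed
  have surj: "(\<lambda>x. restrict (?\<omega> x) ?V) ` ?V = dual_on ?V ?N"
  proof (intro equalityI subsetI)
    fix \<phi> assume "\<phi> \<in> (\<lambda>x. restrict (?\<omega> x) ?V) ` ?V"
    then obtain x where x: "x \<in> ?V" and \<phi>: "\<phi> = restrict (?\<omega> x) ?V" by blast
    have "linear_functional_on ?V \<phi>"
      using lin_right[OF x] by (simp add: linear_functional_on_def \<phi> rochberg_add rochberg_scale_le)
    moreover have "\<forall>y\<in>?V. \<bar>\<phi> y\<bar> \<le> (4 ^ n * ?N x) * ?N y"
      using le[OF x] by (simp add: \<phi>)
    ultimately show "\<phi> \<in> dual_on ?V ?N"
      by (auto simp: dual_on_def \<phi>)
  next
    fix \<phi> assume \<phi>: "\<phi> \<in> dual_on ?V ?N"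
    then obtain y where y: "y \<in> ?V" "\<And>x. x \<in> ?V \<Longrightarrow> \<phi> x = pairing n x y"
      using ex unfolding dual_on_def by blast
    \<comment> \<open>The inverse of \<open>U\<close> is \<epsilon> times \<open>U\<close>; this
      gives the preimage of the functional represented by \<open>y\<close>.\<close>
    have Uy: "U (\<epsilon> *\<^sub>R U y) = y"
      using U(3)[OF y(1)] U(4)[OF U(1)[OF y(1)], of \<epsilon>] \<epsilon> by simp
    have "restrict (?\<omega> (\<epsilon> *\<^sub>R U y)) ?V = \<phi>"
    proof
      show "restrict (?\<omega> (\<epsilon> *\<^sub>R U y)) ?V x = \<phi> x" for x
        using \<phi> y(2)[of x] unfolding Uy by (simp add: dual_on_def extensional_def)
    qed
    then show "\<phi> \<in> (\<lambda>x. restrict (?\<omega> x) ?V) ` ?V"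
      using rochberg_scale_le(1)[OF U(1)[OF y(1)], of \<epsilon>] by blast
  qed
  show ?thesis
    unfolding symplectic_form_def
  proof (intro conjI ballI)
    show "\<exists>K>0. \<forall>x\<in>?V. \<forall>y\<in>?V. \<bar>?\<omega> x y\<bar> \<le> K * ?N x * ?N y"
      using le by (intro exI[of _ "4 ^ n"]) auto
    show "bij_betw (\<lambda>x. restrict (?\<omega> x) ?V) ?V (dual_on ?V ?N)"
      using inj surj by (simp add: bij_betw_def)
    show "\<exists>c>0. \<exists>C>0. \<forall>x\<in>?V. c * ?N x \<le> dual_norm ?V ?N (restrict (?\<omega> x) ?V) \<and>
        dual_norm ?V ?N (restrict (?\<omega> x) ?V) \<le> C * ?N x"
    proof (rule exI[of _ "inverse C"], intro conjI exI[of _ "4 ^ n"] ballI)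
      fix x assume x: "x \<in> ?V"
      show "inverse C * ?N x \<le> dual_norm ?V ?N (restrict (?\<omega> x) ?V)"
        using D_ge[OF x] C unfolding D_def by (simp add: field_simps)
      show "dual_norm ?V ?N (restrict (?\<omega> x) ?V) \<le> 4 ^ n * ?N x"
        using D_le[OF x] unfolding D_def .
    qed (use C in auto)
    show "?\<omega> x y = - ?\<omega> y x" if "x \<in> ?V" "y \<in> ?V" for x y
      using that by (rule anti)
  qed (use lin_right lin_left in blast)+
qed

text \<open>Exchanging the coordinates \<open>2k\<close> and \<open>2k + 1\<close>, with a sign, is an isometry of square \<open>-1\<close>.\<close>

definition swap_index :: "nat \<Rightarrow> nat" where
  "swap_index k = (if even k then k + 1 else k - 1)"

definition swap_sign :: "nat \<Rightarrow> real" where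
  "swap_sign k = (if even k then 1 else -1)"

definition swap :: "(nat \<Rightarrow> linf) \<Rightarrow> nat \<Rightarrow> linf" where
  "swap x i = reindex_linf swap_sign swap_index (x i)"

lemma swap_index_swap_index [simp]: "swap_index (swap_index k) = k"
  by (auto simp: swap_index_def)

lemma swap_sign_swap_index [simp]: "swap_sign (swap_index k) = - swap_sign k"
  by (auto simp: swap_index_def swap_sign_def)

lemma swap_sign_le: "\<bar>swap_sign k\<bar> \<le> 1"
  by (simp add: swap_sign_def)

lemma apply_swap:
  "apply_bcontfun (swap x i) k = of_real (swap_sign k) * apply_bcontfun (x i) (swap_index k)"
  by (simp add: swap_def apply_reindex_linf swap_sign_le)

lemma bij_swap_index: "bij swap_index"
  by (rule o_bij[of swap_index]) (auto simp: fun_eq_iff)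

lemma re_coord_swap: "re_coord (swap x) i k = swap_sign k * re_coord x i (swap_index k)"
  by (simp add: re_coord_def apply_swap)

lemma swap_rochberg:
  assumes x: "x \<in> rochberg n"
  shows "swap x \<in> rochberg n" and "rochberg_norm n (swap x) \<le> rochberg_norm n x"
proof -
  have lift: "\<exists>g\<in>lifts n (swap x). calderon_norm g \<le> 1 * calderon_norm f" if f: "f \<in> lifts n x" for f
  proof (rule bexI)
    have C: "f \<in> calderon_space" using f by (simp add: lifts_def)
    let ?g = "\<lambda>z. reindex_linf swap_sign swap_index (f z)"
    note R = calderon_reindex[OF C swap_sign_le bij_is_inj[OF bij_swap_index]]
    show "calderon_norm ?g \<le> 1 * calderon_norm f"
      using R(2) by simp
    show "?g \<in> lifts n (swap x)"
      using f R(1)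
      by (auto simp: lifts_iff apply_reindex_linf swap_sign_le apply_swap half_coeff_cmult calderon_holomorphic)
  qed
  have zero: "swap x i = 0" if "i \<ge> n" for i
    using x that by (intro bcontfun_eqI) (simp add: apply_swap rochberg_iff)
  have real: "apply_bcontfun (swap x i) k \<in> \<real>" for i k
    using x by (simp add: apply_swap rochberg_iff Reals_mult)
  show "swap x \<in> rochberg n" "rochberg_norm n (swap x) \<le> rochberg_norm n x"
    using rochberg_transfer[OF x _ zero real lift] by simp_all
qed

lemma swap_swap: "swap (swap x) = (-1) *\<^sub>R x"
proof
  fix i
  have "swap_sign k * swap_sign k = 1" for k
    by (simp add: swap_sign_def)
  then have "complex_of_real (swap_sign k) * of_real (swap_sign k) = 1" for k
    by (metis of_real_1 of_real_mult)
  then show "swap (swap x) i = ((-1) *\<^sub>R x) i"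
    by (intro bcontfun_eqI) (simp add: apply_swap scaleR_fun_def flip: mult.assoc)
qed

lemma swap_scaleR: "swap (r *\<^sub>R x) = r *\<^sub>R swap x"
  by (rule ext, rule bcontfun_eqI) (simp add: apply_swap scaleR_fun_def scaleR_conv_of_real)

text \<open>Substitute \<open>swap_index k\<close> for \<open>k\<close> in the series, which is
  allowed by absolute convergence. The sign changes because \<open>swap_sign\<close> takes opposite
  values on the two members of each exchanged pair.\<close>

lemma pairing_swap_right:
  assumes x: "x \<in> rochberg n" and y: "y \<in> rochberg n"
  shows "pairing n x (swap y) = - pairing n (swap x) y"
proof -
  have eq: "pair_term n (swap x) y (swap_index k) = - pair_term n x (swap y) k" for k
    by (simp add: pair_term_def re_coord_swap sum_negf[symmetric] mult_ac)
  have "pair_term n (swap x) y sums pairing n (swap x) y"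
    unfolding pairing_def by (rule summable_sums[OF summable_pair_term(2)[OF swap_rochberg(1)[OF x] y]])
  then have "(pair_term n (swap x) y has_sum pairing n (swap x) y) UNIV"
    by (rule norm_summable_imp_has_sum[rotated])
      (simp add: summable_pair_term(1)[OF swap_rochberg(1)[OF x] y])
  then have "((\<lambda>k. pair_term n (swap x) y (swap_index k)) has_sum pairing n (swap x) y) UNIV"
    by (simp add: has_sum_reindex_bij_betw[OF bij_swap_index])
  then have "(\<lambda>k. - pair_term n x (swap y) k) sums pairing n (swap x) y"
    unfolding eq by (rule has_sum_imp_sums)
  then have "pair_term n x (swap y) sums (- pairing n (swap x) y)"
    using sums_minus by fastforce
  then show ?thesis
    unfolding pairing_def[of n x] by (rule sums_unique[symmetric])
qed

theorem theorem5p2: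
  fixes n :: nat
  assumes "n \<ge> 1"
  shows "symplectic_space (rochberg n) (rochberg_norm n)"
proof -
  have "\<exists>\<omega>. symplectic_form (rochberg n) (rochberg_norm n) \<omega>"
  proof (cases "even n")
    case True
    \<comment> \<open>Here \<open>n\<close> must be positive: for \<open>n = 0\<close> the truncated
      difference \<open>n - 1\<close> is 0 and the sign would be 1.\<close>
    then have sgn: "(-1 :: real) ^ (n - 1) = -1"
      using assms by simp
    have anti: "pairing n y x = - pairing n x y" if "x \<in> rochberg n" "y \<in> rochberg n" for x y
      using pairing_swap[OF that] sgn by simp
    have "symplectic_form (rochberg n) (rochberg_norm n) (\<lambda>x y. pairing n y x)"
      by (rule symplectic_form_twisted_pairing[where U = "\<lambda>x. x" and \<epsilon> = 1, OF _ _ _ _ _ anti]) simp_all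
    then show ?thesis by blast
  next
    case False
    then obtain m where "n = Suc (2 * m)"
      by (auto elim: oddE)
    then have sgn: "(-1 :: real) ^ (n - 1) = 1"
      by simp
    \<comment> \<open>The pairing is symmetric and \<open>swap\<close> is skew-adjoint for it, so
      the twisted form is antisymmetric.\<close>
    have anti: "pairing n y (swap x) = - pairing n x (swap y)" if "x \<in> rochberg n" "y \<in> rochberg n" for x y
      using pairing_swap_right[OF that(2,1)] pairing_swap[OF that(1) swap_rochberg(1)[OF that(2)]]
      unfolding sgn by linarith
    have "symplectic_form (rochberg n) (rochberg_norm n) (\<lambda>x y. pairing n y (swap x))"
      by (rule symplectic_form_twisted_pairing[where U = swap and \<epsilon> = "-1", OF _ _ _ _ _ anti])
        (simp_all add: swap_rochberg swap_swap swap_scaleR)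
    then show ?thesis by blast
  qed
  then show ?thesis
    by (simp add: symplectic_space_def real_banach_on_rochberg)
qed

end
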